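(* The map $\theta^\phi:\mathcal G[-1]\to\Lambda^2\mathcal G[-1]$ induced by the cobracket $\theta=\Delta\partial_H-\partial_H\Delta$ is a graded Lie cobracket on $\mathcal G[-1]$.
   Context: Graded Lie cobracket on a graded vector space $V$: a linear map $\vartheta:V\to V\otimes V$ with (co-antisymmetry) $(\mathrm{id}+\tau)\circ\vartheta=0$ and (co-Jacobi) $(\mathrm{id}+\sigma+\sigma^2)\circ(\mathrm{id}\otimes\vartheta)\circ\vartheta=0$, where $\tau(v\otimes w)=(-1)^{|v||w|}w\otimes v$ and $\sigma(u\otimes v\otimes w)=(-1)^{|w|(|u|+|v|)}w\otimes u\otimes v$. Co-antisymmetry means $\vartheta$ takes values in $\Lambda^2V\subset V\otimes V$, where $v\wedge w$ is identified with $v\otimes w-(-1)^{|v||w|}w\otimes v$. Graphs. A graph is a finite 1-dimensional CW complex (not necessarily connected, multiple edges allowed, the empty graph allowed) all of whose vertices have valence at least 3. A labelling of a graph is a numbering $1,2,\dots$ of its vertices together with an arrow on each edge. An orientation is an equivalence class of labellings: reversing the arrow on one edge, or switching the numbers of two vertices, changes the orientation to the opposite one. $\mathcal G$ is the vector space, over a fixed field of characteristic zero, of linear combinations of (isomorphism classes of) oriented graphs modulo $(X,or)=-(X,-or)$; it is graded by the number of vertices. $\mathcal G[-1]$ is the same space with degree shifted down by 1: a graph with $x$ vertices has degree $x-1$. A graph with a loop is zero in $\mathcal G$, so graphs may be assumed loopless. The orientation is suppressed from the notation. Collapse. For a (non-loop) edge $e$ of $X$, $X_e$ is obtained by collapsing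 $e$ to a point. Induced orientation: represent the orientation of $X$ by a labelling in which the initial vertex of $e$ is 1 and the terminal vertex is 2; in $X_e$ the vertex resulting from the collapse is numbered 1, the numbers of all other vertices are reduced by one, and arrows on uncontracted edges are unchanged. Half-edges. Each half-edge $h$ begins at a vertex $v(h)$, lies in an edge $e(h)$, and has a complementary half-edge $\bar h$ with $e(h)=h\cup\bar h$. For distinct half-edges $h,k$ with $k\ne\bar h$, $X\langle hk\rangle$ is obtained by cutting $e(h)$ and $e(k)$ at their midpoints and gluing $h$ to $k$ and $\bar h$ to $\bar k$; orientation: represent the orientation of $X$ so that $h$ is the initial half-edge of $e(h)$ and $k$ is the terminal half-edge of $e(k)$; in $X\langle hk\rangle$ the edge $h\cup k$ is directed from $h$ to $k$ and the edge $\bar h\cup\bar k$ from $\bar k$ to $\bar h$, all else unchanged. If $v(h)\ne v(k)$, $X_{hk}:=(X\langle hk\rangle)_{h\cup k}$; if $v(h)=v(k)$, $X_{hk}:=0$. $\partial_H X=\sum X_{hk}$, sum over all unordered pairs $\{h,k\}$ of distinct half-edges of $X$ with $k\neq\bar h$. On $\mathcal G\otimes\mathcal G$, $\partial_H(X\otimes Y)=\partial_H X\otimes Y+(-1)^xX\otimes\partial_HY$. Product and coproduct. If $X$ has vertices numbered $1,\dots,x$ and $Y$ has vertices numbered $1,\dots,y$, then $X\cdot Y$ is the disjoint union with the vertex numbers of $Y$ shifted to $x+1,\dots,x+y$, extended bilinearly; the unit $1$ is the empty graph. $\mathcal G\otimes\mathcal G$ is an algebra by $(X\otimes Y)(Z\otimes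 W)=(-1)^{yz}X\cdot Z\otimes Y\cdot W$. $\Delta:\mathcal G\to\mathcal G\otimes\mathcal G$ is linear with $\Delta(1)=1\otimes1$, $\Delta(X)=X\otimes1+1\otimes X$ for connected $X$, and $\Delta(X\cdot Y)=\Delta(X)\Delta(Y)$. Cobracket. $\theta(X)=\Delta(\partial_HX)-\partial_H\Delta(X)$. It takes values in graded-symmetric tensors $S^2\mathcal G\subset\mathcal G\otimes\mathcal G$, where $A\odot B$ is identified with $A\otimes B+(-1)^{ab}B\otimes A$ ($A,B$ having $a,b$ vertices). $\theta^\phi=\phi\circ\theta$, where $\phi:S^2\mathcal G\to\Lambda^2(\mathcal G[-1])$ is the isomorphism $\phi(A\odot B)=(-1)^{a}A\wedge B$; in terms of tensors, $\phi(A\otimes B)=(-1)^aA\otimes B$. *)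

theory Defs
  imports Complex_Main "HOL-Library.Poly_Mapping" "HOL-Combinatorics.Permutations"
begin

section \<open>Vector spaces generated by symbols with signed identifications\<close>

text \<open>
  A vector space is given by a type \<^typ>\<open>'b\<close> of generators and relations \<open>x = \<epsilon> y\<close> between
  them, written \<open>srel x \<epsilon> y\<close>. With no relations this is the free vector space on \<^typ>\<open>'b\<close>, so
  every vector space is of this form up to isomorphism.
\<close>

class signed_set =
  fixes srel :: "'a \<Rightarrow> int \<Rightarrow> 'a \<Rightarrow> bool"

definition pscale :: "'k::field \<Rightarrow> ('b \<Rightarrow>\<^sub>0 'k) \<Rightarrow> ('b \<Rightarrow>\<^sub>0 'k)" where
  "pscale c = Poly_Mapping.map ((*) c)"

lemma lookup_pscale: "Poly_Mapping.lookup (pscale c p) x = c * Poly_Mapping.lookup p x"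
  by (simp add: pscale_def Poly_Mapping.map.rep_eq when_def)

global_interpretation free_space: vector_space pscale
  by unfold_locales (auto intro!: poly_mapping_eqI simp: lookup_pscale lookup_add algebra_simps)

definition relators :: "('b::signed_set \<Rightarrow>\<^sub>0 'k::field) set" where
  "relators = {Poly_Mapping.single x 1 - Poly_Mapping.single y (of_int \<epsilon>) | x \<epsilon> y. srel x \<epsilon> y}"

quotient_type (overloaded) ('b, 'k) svec = "'b::signed_set \<Rightarrow>\<^sub>0 'k::field"
  / "\<lambda>p q. p - q \<in> free_space.span relators"
proof (rule equivpI)
  show "reflp (\<lambda>p q :: 'b \<Rightarrow>\<^sub>0 'k. p - q \<in> free_space.span relators)"
    by (auto simp: reflp_def free_space.span_zero)
  show "symp (\<lambda>p q :: 'b \<Rightarrow>\<^sub>0 'k. p - q \<in> free_space.span relators)"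
    by (rule sympI) (metis free_space.span_neg minus_diff_eq)
  show "transp (\<lambda>p q :: 'b \<Rightarrow>\<^sub>0 'k. p - q \<in> free_space.span relators)"
  proof (rule transpI)
    fix x y z :: "'b \<Rightarrow>\<^sub>0 'k"
    assume "x - y \<in> free_space.span relators" "y - z \<in> free_space.span relators"
    from free_space.span_add[OF this] show "x - z \<in> free_space.span relators" by simp
  qed
qed

instantiation svec :: (signed_set, field) ab_group_add
begin

lift_definition zero_svec :: "('a, 'b) svec" is 0 .

lift_definition plus_svec :: "('a, 'b) svec \<Rightarrow> ('a, 'b) svec \<Rightarrow> ('a, 'b) svec" is "(+)"
proof -
  fix a b c d :: "'a \<Rightarrow>\<^sub>0 'b"
  assume "a - b \<in> free_space.span relators" "c - d \<in> free_space.span relators"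
  from free_space.span_add[OF this] show "a + c - (b + d) \<in> free_space.span relators"
    by (simp add: algebra_simps)
qed

lift_definition uminus_svec :: "('a, 'b) svec \<Rightarrow> ('a, 'b) svec" is uminus
proof -
  fix a b :: "'a \<Rightarrow>\<^sub>0 'b"
  assume "a - b \<in> free_space.span relators"
  from free_space.span_neg[OF this] show "- a - - b \<in> free_space.span relators" by simp
qed

lift_definition minus_svec :: "('a, 'b) svec \<Rightarrow> ('a, 'b) svec \<Rightarrow> ('a, 'b) svec" is "(-)"
proof -
  fix a b c d :: "'a \<Rightarrow>\<^sub>0 'b"
  assume "a - b \<in> free_space.span relators" "c - d \<in> free_space.span relators"
  from free_space.span_diff[OF this] show "a - c - (b - d) \<in> free_space.span relators"
    by (simp add: algebra_simps)
qed

instance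
  by standard (transfer, simp add: algebra_simps free_space.span_zero)+

end

lift_definition vscale :: "'k::field \<Rightarrow> ('b::signed_set, 'k) svec \<Rightarrow> ('b, 'k) svec" (infixr \<open>*\<^sub>v\<close> 75)
  is pscale
  by (metis free_space.scale_right_diff_distrib free_space.span_scale)

lift_definition cls :: "'b::signed_set \<Rightarrow> ('b, 'k::field) svec" is "\<lambda>x. Poly_Mapping.single x 1" .

global_interpretation svec: vector_space vscale
  by unfold_locales
    (transfer, simp add: free_space.scale_right_distrib free_space.scale_left_distrib free_space.span_zero)+

lemma srel_cls:
  assumes "srel x \<epsilon> y"
  shows "(cls x :: ('b::signed_set, 'k::field) svec) = of_int \<epsilon> *\<^sub>v cls y"
proof -
  have "pscale (of_int \<epsilon>) (Poly_Mapping.single y 1)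
      = (Poly_Mapping.single y (of_int \<epsilon>) :: 'b \<Rightarrow>\<^sub>0 'k)"
    by (auto intro!: poly_mapping_eqI simp: lookup_pscale lookup_single when_def)
  then show ?thesis
    using assms by transfer (auto simp: relators_def intro!: free_space.span_base)
qed

lemma span_cls: "svec.span (range cls) = (UNIV :: ('b::signed_set, 'k::field) svec set)"
proof -
  have "v \<in> svec.span (range cls)" for v :: "('b, 'k) svec"
  proof (induction v rule: svec.abs_induct)
    case (1 p)
    show ?case
    proof (induction p rule: update_induct)
      case const
      then show ?case by (simp add: zero_svec.abs_eq[symmetric] svec.span_zero)
    next
      case (update p x c)
      have eq: "Poly_Mapping.update x c p = p + pscale c (Poly_Mapping.single x 1)"
        using update by (auto intro!: poly_mapping_eqI
            simp: lookup_update lookup_add lookup_pscale lookup_single when_def in_keys_iff)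
      show ?case
        unfolding eq plus_svec.abs_eq[symmetric] vscale.abs_eq[symmetric] cls.abs_eq[symmetric]
        using update(3) by (intro svec.span_add svec.span_scale svec.span_base[of "cls x"]) auto
    qed
  qed
  then show ?thesis by auto
qed

text \<open>
  The linear map with prescribed values on generators. It is meaningful only if the prescribed
  values respect the identifications of the generators (lemma \<open>lext_cls\<close> below).
\<close>

definition lext ::
    "('b \<Rightarrow> ('c, 'k) svec) \<Rightarrow> ('b::signed_set, 'k::field) svec \<Rightarrow> ('c::signed_set, 'k) svec" where
  "lext f = (THE L. Vector_Spaces.linear (*\<^sub>v) (*\<^sub>v) L \<and> (\<forall>x. L (cls x) = f x))"

lemma linear_eq_on_cls:
  assumes "Vector_Spaces.linear (*\<^sub>v) (s :: 'k \<Rightarrow> 'v \<Rightarrow> 'v) L"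
    and "Vector_Spaces.linear (*\<^sub>v) s M"
    and "\<And>x. L (cls x) = M (cls x)"
  shows "L = (M :: ('b::signed_set, 'k::field) svec \<Rightarrow> 'v::ab_group_add)"
proof -
  interpret vector_space_pair "vscale :: 'k \<Rightarrow> ('b, 'k) svec \<Rightarrow> _" s
    using assms(1) by (simp add: Vector_Spaces.linear_def vector_space_pair_def)
  show ?thesis
    using linear_eq_on_span[OF assms(1,2), of "range cls"] assms(3) by (auto simp: span_cls)
qed

lemma linear_ext_exists:
  fixes s :: "'k::field \<Rightarrow> 'v \<Rightarrow> 'v::ab_group_add" and f :: "'b::signed_set \<Rightarrow> 'v"
  assumes s: "vector_space s"
    and f: "\<And>x \<epsilon> y. srel x \<epsilon> y \<Longrightarrow> f x = s (of_int \<epsilon>) (f y)"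
  shows "\<exists>L. Vector_Spaces.linear (*\<^sub>v) s L \<and> (\<forall>x. L (cls x) = f x)"
proof -
  interpret s: vector_space s by fact
  define F where "F = (\<lambda>p. \<Sum>x\<in>Poly_Mapping.keys p. s (Poly_Mapping.lookup p x) (f x))"
  have F_sup: "F p = (\<Sum>x\<in>A. s (Poly_Mapping.lookup p x) (f x))"
    if "finite A" "Poly_Mapping.keys p \<subseteq> A" for p A
    unfolding F_def using that
    by (intro sum.mono_neutral_left) (auto simp: in_keys_iff)
  have F_add: "F (p + q) = F p + F q" for p q
  proof -
    have "Poly_Mapping.keys (p + q) \<subseteq> Poly_Mapping.keys p \<union> Poly_Mapping.keys q"
      by (rule Poly_Mapping.keys_add)
    then show ?thesis
      by (subst (1 2 3) F_sup[of "Poly_Mapping.keys p \<union> Poly_Mapping.keys q"])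
        (auto simp: lookup_add s.scale_left_distrib sum.distrib)
  qed
  have F_scale: "F (pscale c p) = s c (F p)" for c p
  proof -
    have "Poly_Mapping.keys (pscale c p) \<subseteq> Poly_Mapping.keys p"
      by (auto simp: in_keys_iff lookup_pscale)
    then show ?thesis
      by (subst (1 2) F_sup[of "Poly_Mapping.keys p"]) (auto simp: lookup_pscale s.scale_sum_right)
  qed
  have F_single: "F (Poly_Mapping.single x c) = s c (f x)" for x c
    by (subst F_sup[of "{x}"]) auto
  have F_diff: "F (p - q) = F p - F q" for p q
    using F_add[of "p - q" q] by simp
  have F_rel: "F p = 0" if "p \<in> free_space.span relators" for p
    using that
  proof (induction rule: free_space.span_induct_alt)
    case base
    then show ?case by (simp add: F_def)
  next
    case (step c x y)
    then show ?case
      by (auto simp: F_add F_scale relators_def F_diff F_single f)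
  qed
  define L where "L = (\<lambda>v. F (rep_svec v))"
  have L_abs: "L (abs_svec p) = F p" for p
  proof -
    have "rep_svec (abs_svec p) - p \<in> free_space.span relators"
      by (rule rep_abs_rsp_left[OF Quotient3_svec]) (simp add: free_space.span_zero)
    from F_rel[OF this] show ?thesis by (simp add: L_def F_diff)
  qed
  have "L (u + v) = L u + L v" for u v
    by (induction u rule: svec.abs_induct, induction v rule: svec.abs_induct)
      (simp add: plus_svec.abs_eq L_abs F_add)
  moreover have "L (c *\<^sub>v v) = s c (L v)" for c v
    by (induction v rule: svec.abs_induct) (simp add: vscale.abs_eq L_abs F_scale)
  ultimately have "Vector_Spaces.linear (*\<^sub>v) s L"
    by unfold_locales auto
  moreover have "L (cls x) = f x" for x
    by (simp add: cls.abs_eq L_abs F_single)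
  ultimately show ?thesis by blast
qed

lemma lext_cls:
  assumes "\<And>x \<epsilon> y. srel x \<epsilon> y \<Longrightarrow> f x = of_int \<epsilon> *\<^sub>v f y"
  shows "Vector_Spaces.linear (*\<^sub>v) (*\<^sub>v) (lext f)" and "lext f (cls x) = f x"
proof -
  have "\<exists>!L. Vector_Spaces.linear (*\<^sub>v) (*\<^sub>v) L \<and> (\<forall>x. L (cls x) = f x)"
    using linear_ext_exists[OF svec.vector_space_axioms assms]
    by (intro ex_ex1I) (auto intro: linear_eq_on_cls)
  from theI'[OF this] show "Vector_Spaces.linear (*\<^sub>v) (*\<^sub>v) (lext f)" "lext f (cls x) = f x"
    by (auto simp: lext_def)
qed


subsection \<open>Tensor products\<close>

text \<open>
  The tensor product of the spaces presented by \<^typ>\<open>'a\<close> and \<^typ>\<open>'b\<close> is the space presented by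
  \<^typ>\<open>'a \<times> 'b\<close>, with the identifications of either factor; see \<open>tens_universal\<close>.
\<close>

instantiation prod :: (signed_set, signed_set) signed_set
begin

definition srel_prod :: "'a \<times> 'b \<Rightarrow> int \<Rightarrow> 'a \<times> 'b \<Rightarrow> bool" where
  "srel_prod p \<epsilon> q \<longleftrightarrow>
     srel (fst p) \<epsilon> (fst q) \<and> snd p = snd q \<or> fst p = fst q \<and> srel (snd p) \<epsilon> (snd q)"

instance ..

end

definition tens :: "('a::signed_set, 'k::field) svec \<Rightarrow> ('b::signed_set, 'k) svec \<Rightarrow> ('a \<times> 'b, 'k) svec"
    (infixr \<open>\<otimes>\<close> 72) where
  "v \<otimes> w = lext (\<lambda>x. lext (\<lambda>y. cls (x, y)) w) v"

lemma tens_inner: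
  fixes x :: "'a::signed_set"
  shows "Vector_Spaces.linear (*\<^sub>v) (*\<^sub>v)
      (lext (\<lambda>y. cls (x, y)) :: ('b::signed_set, 'k::field) svec \<Rightarrow> _)"
    and "lext (\<lambda>y. cls (x, y)) (cls y) = (cls (x, y) :: ('a \<times> 'b, 'k) svec)"
  by (rule lext_cls; rule srel_cls; simp add: srel_prod_def)+

lemma linear_scale_comp:
  "Vector_Spaces.linear (*\<^sub>v) (*\<^sub>v) L \<Longrightarrow> Vector_Spaces.linear (*\<^sub>v) (*\<^sub>v) (\<lambda>w. c *\<^sub>v L w)"
  by (simp add: Vector_Spaces.linear_iff svec.scale_right_distrib mult.commute)

lemma tens_outer:
  fixes w :: "('b::signed_set, 'k::field) svec" and x :: "'a::signed_set"
  shows "Vector_Spaces.linear (*\<^sub>v) (*\<^sub>v) (\<lambda>v :: ('a, 'k) svec. v \<otimes> w)"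
    and "cls x \<otimes> w = lext (\<lambda>y. cls (x, y)) w"
proof -
  have "lext (\<lambda>y. cls (x, y)) w = of_int \<epsilon> *\<^sub>v lext (\<lambda>y. cls (x', y)) w"
    if "srel x \<epsilon> x'" for x x' :: 'a and \<epsilon>
  proof -
    have "lext (\<lambda>y. cls (x, y)) = (\<lambda>w :: ('b, 'k) svec. of_int \<epsilon> *\<^sub>v lext (\<lambda>y. cls (x', y)) w)"
      using that by (intro linear_eq_on_cls[of vscale] linear_scale_comp tens_inner)
        (auto simp: tens_inner srel_prod_def intro: srel_cls)
    then show ?thesis by (rule fun_cong)
  qed
  from lext_cls[OF this] show "Vector_Spaces.linear (*\<^sub>v) (*\<^sub>v) (\<lambda>v :: ('a, 'k) svec. v \<otimes> w)"
    and "cls x \<otimes> w = lext (\<lambda>y. cls (x, y)) w"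
    by (simp_all add: tens_def[abs_def])
qed

lemma cls_tens_cls: "cls x \<otimes> cls y = cls (x, y)"
  by (simp add: tens_outer tens_inner)

lemma tens_linear_left: "Vector_Spaces.linear (*\<^sub>v) (*\<^sub>v) (\<lambda>v. v \<otimes> w)"
  by (rule tens_outer)

lemma tens_linear_right:
  fixes v :: "('a::signed_set, 'k::field) svec"
  shows "Vector_Spaces.linear (*\<^sub>v) (*\<^sub>v) (\<lambda>w :: ('b::signed_set, 'k) svec. v \<otimes> w)"
proof -
  have l: "(a + b) \<otimes> w = a \<otimes> w + b \<otimes> w" "(c *\<^sub>v a) \<otimes> w = c *\<^sub>v (a \<otimes> w)"
    for a b :: "('a, 'k) svec" and w :: "('b, 'k) svec" and c
    using tens_linear_left[of w] by (auto simp: Vector_Spaces.linear_iff)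
  have i: "cls x \<otimes> (a + b) = cls x \<otimes> a + cls x \<otimes> b" "cls x \<otimes> (c *\<^sub>v a) = c *\<^sub>v (cls x \<otimes> a)"
    for a b :: "('b, 'k) svec" and x :: 'a and c
    using tens_inner(1)[of x] by (auto simp: Vector_Spaces.linear_iff tens_outer)
  have "(\<lambda>v :: ('a, 'k) svec. v \<otimes> (a + b)) = (\<lambda>v. v \<otimes> a + v \<otimes> b)" for a b :: "('b, 'k) svec"
    by (rule linear_eq_on_cls[of vscale])
      (auto simp: Vector_Spaces.linear_iff svec.vector_space_axioms l i svec.scale_right_distrib)
  moreover have "(\<lambda>v :: ('a, 'k) svec. v \<otimes> (c *\<^sub>v a)) = (\<lambda>v. c *\<^sub>v (v \<otimes> a))"
    for a :: "('b, 'k) svec" and c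
    by (rule linear_eq_on_cls[of vscale])
      (auto simp: Vector_Spaces.linear_iff svec.vector_space_axioms l i svec.scale_right_distrib
        mult.commute)
  ultimately show ?thesis
    by (auto simp: Vector_Spaces.linear_iff svec.vector_space_axioms fun_eq_iff)
qed

theorem tens_universal:
  fixes s :: "'k::field \<Rightarrow> 'v \<Rightarrow> 'v::ab_group_add"
    and B :: "('a::signed_set, 'k) svec \<Rightarrow> ('b::signed_set, 'k) svec \<Rightarrow> 'v"
  assumes "vector_space s"
    and B1: "\<And>w. Vector_Spaces.linear (*\<^sub>v) s (\<lambda>v. B v w)"
    and B2: "\<And>v. Vector_Spaces.linear (*\<^sub>v) s (\<lambda>w. B v w)"
  shows "\<exists>!L. Vector_Spaces.linear (*\<^sub>v) s L \<and> (\<forall>v w. L (v \<otimes> w) = B v w)"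
proof (rule ex_ex1I)
  have B_scale: "B (c *\<^sub>v v) w = s c (B v w)" "B v (c *\<^sub>v w) = s c (B v w)" for c v w
    using B1[of w] B2[of v] by (auto simp: Vector_Spaces.linear_iff)
  have "B (cls (fst p)) (cls (snd p)) = s (of_int \<epsilon>) (B (cls (fst q)) (cls (snd q)))"
    if "srel p \<epsilon> q" for p q \<epsilon>
    using that unfolding srel_prod_def
  proof (elim disjE conjE)
    assume "srel (fst p) \<epsilon> (fst q)" "snd p = snd q"
    then show ?thesis by (simp only: srel_cls B_scale)
  next
    assume "srel (snd p) \<epsilon> (snd q)" "fst p = fst q"
    then show ?thesis by (simp only: srel_cls B_scale)
  qed
  from linear_ext_exists[OF assms(1), of "\<lambda>p. B (cls (fst p)) (cls (snd p))", OF this]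
  obtain L where L: "Vector_Spaces.linear (*\<^sub>v) s L"
    and L_cls: "\<And>p. L (cls p) = B (cls (fst p)) (cls (snd p))" by auto
  have comp: "Vector_Spaces.linear (*\<^sub>v) s (\<lambda>x. L (M x))"
    if "Vector_Spaces.linear (*\<^sub>v) (*\<^sub>v) M" for M :: "('c::signed_set, 'k) svec \<Rightarrow> _"
    using that L by (auto simp: Vector_Spaces.linear_iff)
  have "(\<lambda>w. L (cls x \<otimes> w)) = B (cls x)" for x
    by (rule linear_eq_on_cls[of s])
      (auto simp: comp tens_linear_right B2 L_cls cls_tens_cls)
  then have "(\<lambda>v. L (v \<otimes> w)) = (\<lambda>v. B v w)" for w
    by (intro linear_eq_on_cls[of s])
      (auto simp: comp tens_linear_left B1 fun_eq_iff)
  then show "\<exists>L. Vector_Spaces.linear (*\<^sub>v) s L \<and> (\<forall>v w. L (v \<otimes> w) = B v w)"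
    using L by (auto simp: fun_eq_iff intro!: exI[of _ L])
next
  fix L M
  assume "Vector_Spaces.linear (*\<^sub>v) s L \<and> (\<forall>v w. L (v \<otimes> w) = B v w)"
    and "Vector_Spaces.linear (*\<^sub>v) s M \<and> (\<forall>v w. M (v \<otimes> w) = B v w)"
  then show "L = M"
    by (intro linear_eq_on_cls[of s L M]) (auto simp flip: cls_tens_cls)
qed


section \<open>Graded Lie cobrackets\<close>

text \<open>
  A grading assigns to each generator a degree, compatibly with the identifications. Signs are
  given on generators, which are homogeneous. Triple tensors associate to the right, as tuples do.
\<close>

definition grading :: "('b::signed_set \<Rightarrow> int) \<Rightarrow> bool" where
  "grading deg \<longleftrightarrow> (\<forall>x \<epsilon> y. srel x \<epsilon> y \<longrightarrow> deg x = deg y)"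

definition tau :: "('b::signed_set \<Rightarrow> int) \<Rightarrow> ('b \<times> 'b, 'k::field) svec \<Rightarrow> ('b \<times> 'b, 'k) svec" where
  "tau deg = lext (\<lambda>(v, w). (-1) powi (deg v * deg w) *\<^sub>v cls (w, v))"

definition sigma ::
    "('b::signed_set \<Rightarrow> int) \<Rightarrow> ('b \<times> 'b \<times> 'b, 'k::field) svec \<Rightarrow> ('b \<times> 'b \<times> 'b, 'k) svec" where
  "sigma deg = lext (\<lambda>(u, v, w). (-1) powi (deg w * (deg u + deg v)) *\<^sub>v cls (w, u, v))"

definition id_tens ::
    "(('b, 'k) svec \<Rightarrow> ('c, 'k) svec) \<Rightarrow> ('a::signed_set \<times> 'b::signed_set, 'k::field) svec
      \<Rightarrow> ('a \<times> 'c::signed_set, 'k) svec" where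
  "id_tens f = lext (\<lambda>(x, y). cls x \<otimes> f (cls y))"

definition exterior_square ::
    "('b::signed_set \<Rightarrow> int) \<Rightarrow> ('b \<times> 'b, 'k::field) svec set" where
  "exterior_square deg =
     svec.span {cls v \<otimes> cls w - (-1) powi (deg v * deg w) *\<^sub>v (cls w \<otimes> cls v) | v w. True}"

definition graded_lie_cobracket ::
    "('b::signed_set \<Rightarrow> int) \<Rightarrow> (('b, 'k::field) svec \<Rightarrow> ('b \<times> 'b, 'k) svec) \<Rightarrow> bool" where
  "graded_lie_cobracket deg \<theta> \<longleftrightarrow>
     grading deg \<and>
     Vector_Spaces.linear (*\<^sub>v) (*\<^sub>v) \<theta> \<and>
     (\<forall>v. \<theta> v + tau deg (\<theta> v) = 0) \<and>
     (\<forall>v. let t = id_tens \<theta> (\<theta> v) in t + sigma deg t + sigma deg (sigma deg t) = 0)"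


section \<open>Oriented graphs\<close>

text \<open>
  A labelled graph has vertices \<open>1, \<dots>, n\<close> and a list of edges, each running from its first to its
  second component. Positions in the list serve only to name the edges. Loops and multiple edges
  are allowed; a loop counts twice towards the valence.
\<close>

definition valence :: "(nat \<times> nat) list \<Rightarrow> nat \<Rightarrow> nat" where
  "valence es v = count_list (map fst es) v + count_list (map snd es) v"

typedef lgraph = "{(n :: nat, es :: (nat \<times> nat) list).
    (\<forall>e\<in>set es. fst e \<in> {1..n} \<and> snd e \<in> {1..n}) \<and> (\<forall>v\<in>{1..n}. 3 \<le> valence es v)}"
  by (rule exI[of _ "(0, [])"]) auto

setup_lifting type_definition_lgraph

lift_definition nv :: "lgraph \<Rightarrow> nat" is fst .

lift_definition edges :: "lgraph \<Rightarrow> (nat \<times> nat) list" is snd .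

lemma valence_mset:
  "valence es v = count (mset (map fst es)) v + count (mset (map snd es)) v"
  by (simp only: valence_def count_mset)

lemma count_list_map_inj:
  "inj f \<Longrightarrow> count_list (map f xs) (f x) = count_list xs x"
  by (induction xs) (auto dest: injD)

lift_definition relabel :: "(nat \<Rightarrow> nat) \<Rightarrow> lgraph \<Rightarrow> lgraph" is
  "\<lambda>p (n, es). if p permutes {1..n} then (n, map (map_prod p p) es) else (n, es)"
proof -
  fix p :: "nat \<Rightarrow> nat" and X :: "nat \<times> (nat \<times> nat) list"
  obtain n es where X: "X = (n, es)" by fastforce
  assume "X \<in> {(n, es). (\<forall>e\<in>set es. fst e \<in> {1..n} \<and> snd e \<in> {1..n}) \<and>
      (\<forall>v\<in>{1..n}. 3 \<le> valence es v)}"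
  then have *: "\<forall>e\<in>set es. fst e \<in> {1..n} \<and> snd e \<in> {1..n}" "\<forall>v\<in>{1..n}. 3 \<le> valence es v"
    by (auto simp: X)
  have "3 \<le> valence (map (map_prod p p) es) v" if p: "p permutes {1..n}" and v: "v \<in> {1..n}" for v
  proof -
    obtain u where u: "v = p u" "u \<in> {1..n}"
      using p v by (metis permutes_image imageE)
    have "valence (map (map_prod p p) es) (p u) = valence es u"
      using count_list_map_inj[OF permutes_inj[OF p], of "map fst es" u]
        count_list_map_inj[OF permutes_inj[OF p], of "map snd es" u]
      by (simp add: valence_def comp_def)
    then show ?thesis using * u by simp
  qed
  moreover have "p u \<in> {1..n}" if "p permutes {1..n}" "u \<in> {1..n}" for u
    using that by (meson permutes_in_image)
  ultimately show "(case X of (n, es) \<Rightarrow>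
      if p permutes {1..n} then (n, map (map_prod p p) es) else (n, es))
      \<in> {(n, es). (\<forall>e\<in>set es. fst e \<in> {1..n} \<and> snd e \<in> {1..n}) \<and>
          (\<forall>v\<in>{1..n}. 3 \<le> valence es v)}"
    using * unfolding X by auto
qed

lift_definition reverse_arrow :: "nat \<Rightarrow> lgraph \<Rightarrow> lgraph" is
  "\<lambda>i (n, es). (n, if i < length es then es[i := prod.swap (es ! i)] else es)"
proof -
  fix i and X :: "nat \<times> (nat \<times> nat) list"
  obtain n es where X: "X = (n, es)" by fastforce
  assume "X \<in> {(n, es). (\<forall>e\<in>set es. fst e \<in> {1..n} \<and> snd e \<in> {1..n}) \<and>
      (\<forall>v\<in>{1..n}. 3 \<le> valence es v)}"
  then have *: "\<forall>e\<in>set es. fst e \<in> {1..n} \<and> snd e \<in> {1..n}" "\<forall>v\<in>{1..n}. 3 \<le> valence es v"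
    by (auto simp: X)
  have "valence (es[i := prod.swap (es ! i)]) v = valence es v" if i: "i < length es" for v
  proof -
    define r where "r = take i es @ drop (Suc i) es"
    have "mset (map f es) = add_mset (f (es ! i)) (mset (map f r))" for f :: "nat \<times> nat \<Rightarrow> nat"
      using i unfolding r_def by (subst id_take_nth_drop[OF i]) simp
    moreover have "mset (map f (es[i := e])) = add_mset (f e) (mset (map f r))"
      for f :: "nat \<times> nat \<Rightarrow> nat" and e
      using i unfolding r_def by (simp add: upd_conv_take_nth_drop)
    ultimately show ?thesis by (simp add: valence_mset)
  qed
  moreover have "\<forall>e\<in>set (es[i := prod.swap (es ! i)]). fst e \<in> {1..n} \<and> snd e \<in> {1..n}"
    if "i < length es"
    using * that set_update_subset_insert[of es i "prod.swap (es ! i)"] nth_mem[OF that] by auto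
  ultimately show "(case X of (n, es) \<Rightarrow>
      (n, if i < length es then es[i := prod.swap (es ! i)] else es))
      \<in> {(n, es). (\<forall>e\<in>set es. fst e \<in> {1..n} \<and> snd e \<in> {1..n}) \<and>
          (\<forall>v\<in>{1..n}. 3 \<le> valence es v)}"
    using * by (auto simp: X)
qed

text \<open>
  The generating identifications: isomorphic labelled graphs are equal (an isomorphism of labelled
  graphs fixes the numbered vertices, hence is a bijection of the edges preserving their ends and
  arrows); reversing an arrow or switching the numbers of two vertices changes the sign.
\<close>

instantiation lgraph :: signed_set
begin

definition srel_lgraph :: "lgraph \<Rightarrow> int \<Rightarrow> lgraph \<Rightarrow> bool" where
  "srel_lgraph X \<epsilon> Y \<longleftrightarrow>
     \<epsilon> = 1 \<and> nv X = nv Y \<and> mset (edges X) = mset (edges Y) \<or>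
     \<epsilon> = -1 \<and> (\<exists>i<length (edges X). Y = reverse_arrow i X) \<or>
     \<epsilon> = -1 \<and> (\<exists>u\<in>{1..nv X}. \<exists>v\<in>{1..nv X}. u \<noteq> v \<and> Y = relabel (transpose u v) X)"

instance ..

end

type_synonym 'k graph_space = "(lgraph, 'k) svec"
type_synonym 'k graph_space2 = "(lgraph \<times> lgraph, 'k) svec"


subsection \<open>Collapsing an edge\<close>

text \<open>The collapse of edge \<open>i\<close> when its initial vertex is 1 and its terminal vertex is 2.\<close>

lift_definition collapse12 :: "lgraph \<Rightarrow> nat \<Rightarrow> lgraph" is
  "\<lambda>(n, es) i. if i < length es \<and> es ! i = (1, 2)
     then let c = (\<lambda>w. if w \<le> 1 then w else w - 1)
          in (n - 1, map (map_prod c c) (take i es @ drop (Suc i) es))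
     else (n, es)"
proof -
  fix X :: "nat \<times> (nat \<times> nat) list" and i
  obtain n es where X: "X = (n, es)" by fastforce
  assume "X \<in> {(n, es). (\<forall>e\<in>set es. fst e \<in> {1..n} \<and> snd e \<in> {1..n}) \<and>
      (\<forall>v\<in>{1..n}. 3 \<le> valence es v)}"
  then have *: "\<And>e. e \<in> set es \<Longrightarrow> fst e \<in> {1..n} \<and> snd e \<in> {1..n}"
      "\<And>v. v \<in> {1..n} \<Longrightarrow> 3 \<le> valence es v"
    by (auto simp: X)
  define c :: "nat \<Rightarrow> nat" where "c = (\<lambda>w. if w \<le> 1 then w else w - 1)"
  define r where "r = take i es @ drop (Suc i) es"
  define es' where "es' = map (map_prod c c) r"
  have "(\<forall>e\<in>set es'. fst e \<in> {1..n - 1} \<and> snd e \<in> {1..n - 1}) \<and>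
      (\<forall>v\<in>{1..n - 1}. 3 \<le> valence es' v)" if i: "i < length es" "es ! i = (1, 2)"
  proof -
    have n: "2 \<le> n" using *(1)[OF nth_mem[OF i(1)]] i(2) by auto
    have r_sub: "set r \<subseteq> set es"
      unfolding r_def using set_take_subset[of i es] set_drop_subset[of "Suc i" es] by auto
    have c_in: "c u \<in> {1..n - 1}" if "u \<in> {1..n}" for u
      using that n by (auto simp: c_def)
    have es: "es = take i es @ (1, 2) # drop (Suc i) es"
      using id_take_nth_drop[OF i(1)] i(2) by simp
    have val: "valence es v = valence r v + (if v = 1 then 1 else 0) + (if v = 2 then 1 else 0)" for v
      by (subst es) (simp add: valence_def r_def)
    have cl1: "count_list (map c xs) 1 = count_list xs 1 + count_list xs 2" if "0 \<notin> set xs" for xs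
      using that by (induction xs) (auto simp: c_def)
    have cl2: "count_list (map c xs) v = count_list xs (Suc v)" if "v \<ge> 2" for xs v
      using that by (induction xs) (auto simp: c_def)
    have no0: "0 \<notin> fst ` set r" "0 \<notin> snd ` set r" using *(1) r_sub by fastforce+
    have "3 \<le> valence es' v" if v: "v \<in> {1..n - 1}" for v
    proof (cases "v = 1")
      case True
      have "valence es' 1 = valence r 1 + valence r 2"
        using cl1[of "map fst r"] cl1[of "map snd r"] no0 by (simp add: es'_def valence_def comp_def)
      moreover have "3 \<le> valence es 1" "3 \<le> valence es 2" using *(2) n by auto
      ultimately show ?thesis using True by (simp add: val)
    next
      case False
      then have "valence es' v = valence r (Suc v)"
        using cl2[of v "map fst r"] cl2[of v "map snd r"] v
        by (simp add: es'_def valence_def comp_def)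
      moreover have "3 \<le> valence es (Suc v)" using *(2)[of "Suc v"] v by auto
      ultimately show ?thesis using False v by (simp add: val)
    qed
    moreover have "\<forall>e\<in>set es'. fst e \<in> {1..n - 1} \<and> snd e \<in> {1..n - 1}"
    proof
      fix e assume "e \<in> set es'"
      then obtain e0 where "e0 \<in> set es" "e = map_prod c c e0" using r_sub by (auto simp: es'_def)
      with *(1)[of e0] show "fst e \<in> {1..n - 1} \<and> snd e \<in> {1..n - 1}"
        using c_in by simp
    qed
    ultimately show ?thesis by blast
  qed
  then show "(case X of (n, es) \<Rightarrow> \<lambda>i. if i < length es \<and> es ! i = (1, 2)
     then let c = (\<lambda>w. if w \<le> 1 then w else w - 1)
          in (n - 1, map (map_prod c c) (take i es @ drop (Suc i) es))
     else (n, es)) i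
      \<in> {(n, es). (\<forall>e\<in>set es. fst e \<in> {1..n} \<and> snd e \<in> {1..n}) \<and>
          (\<forall>v\<in>{1..n}. 3 \<le> valence es v)}"
    using * unfolding X Let_def es'_def r_def c_def by auto
qed

text \<open>A renumbering that takes \<open>u\<close> to 1 and \<open>v\<close> to 2, where \<open>u \<noteq> v\<close>.\<close>

definition front :: "nat \<Rightarrow> nat \<Rightarrow> nat \<Rightarrow> nat" where
  "front u v = transpose (transpose 1 u v) 2 \<circ> transpose 1 u"

lemma front: "u \<noteq> v \<Longrightarrow> front u v u = 1" "u \<noteq> v \<Longrightarrow> front u v v = 2"
  by (auto simp: front_def transpose_def)

lemma front_permutes:
  "u \<in> {1..n} \<Longrightarrow> v \<in> {1..n} \<Longrightarrow> u \<noteq> v \<Longrightarrow> front u v permutes {1..n}"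
  unfolding front_def
  by (intro permutes_compose permutes_swap_id) (auto simp: transpose_def)

definition collapse :: "lgraph \<Rightarrow> nat \<Rightarrow> 'k::field graph_space" where
  "collapse X i = (let p = front (fst (edges X ! i)) (snd (edges X ! i))
     in of_int (sign p) *\<^sub>v cls (collapse12 (relabel p X) i))"


subsection \<open>Half-edges and the operator \<open>\<partial>\<^sub>H\<close>\<close>

text \<open>\<open>(i, False)\<close> is the initial and \<open>(i, True)\<close> the terminal half-edge of the edge at position \<open>i\<close>.\<close>

type_synonym half_edge = "nat \<times> bool"

definition half_edges :: "lgraph \<Rightarrow> half_edge set" where
  "half_edges X = {..<length (edges X)} \<times> UNIV"

definition end_of :: "(nat \<times> nat) list \<Rightarrow> half_edge \<Rightarrow> nat" where
  "end_of es h = (if snd h then snd (es ! fst h) else fst (es ! fst h))"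

definition bar :: "half_edge \<Rightarrow> half_edge" where
  "bar h = (fst h, \<not> snd h)"

text \<open>
  \<open>X\<langle>hk\<rangle>\<close> up to sign: the edge \<open>h \<union> k\<close>, directed from \<open>h\<close> to \<open>k\<close>, takes the position of \<open>e(h)\<close>, and
  the edge of the complementary half-edges, directed from that of \<open>k\<close> to that of \<open>h\<close>, takes the
  position of \<open>e(k)\<close>.
\<close>

lift_definition cut_glue :: "lgraph \<Rightarrow> half_edge \<Rightarrow> half_edge \<Rightarrow> lgraph" is
  "\<lambda>(n, es) h k. if fst h < length es \<and> fst k < length es \<and> fst h \<noteq> fst k
     then (n, es[fst h := (end_of es h, end_of es k),
                 fst k := (end_of es (bar k), end_of es (bar h))])
     else (n, es)"
proof -
  fix X :: "nat \<times> (nat \<times> nat) list" and h k :: half_edge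
  obtain n es where X: "X = (n, es)" by fastforce
  assume "X \<in> {(n, es). (\<forall>e\<in>set es. fst e \<in> {1..n} \<and> snd e \<in> {1..n}) \<and>
      (\<forall>v\<in>{1..n}. 3 \<le> valence es v)}"
  then have *: "\<And>e. e \<in> set es \<Longrightarrow> fst e \<in> {1..n} \<and> snd e \<in> {1..n}"
      "\<And>v. v \<in> {1..n} \<Longrightarrow> 3 \<le> valence es v"
    by (auto simp: X)
  define es' where "es' = es[fst h := (end_of es h, end_of es k),
      fst k := (end_of es (bar k), end_of es (bar h))]"
  have "(\<forall>e\<in>set es'. fst e \<in> {1..n} \<and> snd e \<in> {1..n}) \<and> (\<forall>v\<in>{1..n}. 3 \<le> valence es' v)"
    if hk: "fst h < length es" "fst k < length es" "fst h \<noteq> fst k"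
  proof -
    have in_n: "end_of es g \<in> {1..n}" if "fst g < length es" for g
      using *(1)[OF nth_mem[OF that]] by (auto simp: end_of_def)
    have "set es' \<subseteq> insert (end_of es (bar k), end_of es (bar h))
        (insert (end_of es h, end_of es k) (set es))"
      unfolding es'_def
      by (meson insert_mono order_trans set_update_subset_insert)
    then have "\<forall>e\<in>set es'. fst e \<in> {1..n} \<and> snd e \<in> {1..n}"
      using *(1) in_n[of h] in_n[of k] in_n[of "bar h"] in_n[of "bar k"] hk
      by (auto simp: bar_def)
    moreover have "valence es' v = valence es v" for v
    proof -
      have upd: "count (mset (map f (xs[i := e]))) v + (if f (xs ! i) = v then 1 else 0)
          = count (mset (map f xs)) v + (if f e = v then 1 else 0)"
        if i: "i < length xs" for f :: "nat \<times> nat \<Rightarrow> nat" and xs i e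
      proof -
        have "mset (map f xs) = mset (map f (take i xs @ xs ! i # drop (Suc i) xs))"
          using id_take_nth_drop[OF i] by simp
        then show ?thesis using i by (simp add: upd_conv_take_nth_drop)
      qed
      let ?a = "(end_of es h, end_of es k)" and ?b = "(end_of es (bar k), end_of es (bar h))"
      have "valence es' v
          + (if fst (es ! fst h) = v then 1 else 0) + (if snd (es ! fst h) = v then 1 else 0)
          + (if fst (es ! fst k) = v then 1 else 0) + (if snd (es ! fst k) = v then 1 else 0)
        = valence es v + (if fst ?a = v then 1 else 0) + (if snd ?a = v then 1 else 0)
          + (if fst ?b = v then 1 else 0) + (if snd ?b = v then 1 else 0)"
        using upd[of "fst h" es fst ?a] upd[of "fst h" es snd ?a]
          upd[of "fst k" "es[fst h := ?a]" fst ?b] upd[of "fst k" "es[fst h := ?a]" snd ?b] hk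
        unfolding es'_def valence_mset by simp
      then show ?thesis
        by (cases "snd h"; cases "snd k") (simp_all add: end_of_def bar_def)
    qed
    ultimately show ?thesis using * by auto
  qed
  then show "(case X of (n, es) \<Rightarrow> \<lambda>h k. if fst h < length es \<and> fst k < length es \<and> fst h \<noteq> fst k
     then (n, es[fst h := (end_of es h, end_of es k),
                 fst k := (end_of es (bar k), end_of es (bar h))])
     else (n, es)) h k
      \<in> {(n, es). (\<forall>e\<in>set es. fst e \<in> {1..n} \<and> snd e \<in> {1..n}) \<and>
          (\<forall>v\<in>{1..n}. 3 \<le> valence es v)}"
    using * unfolding X es'_def by auto
qed

text \<open>
  The sign of changing the arrows of \<open>e(h)\<close> and \<open>e(k)\<close> so that \<open>h\<close> is initial and \<open>k\<close> is terminal.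
\<close>

definition cut_glue_sign :: "half_edge \<Rightarrow> half_edge \<Rightarrow> 'k::field" where
  "cut_glue_sign h k = (if snd h then -1 else 1) * (if snd k then 1 else -1)"

definition X_hk :: "lgraph \<Rightarrow> half_edge \<Rightarrow> half_edge \<Rightarrow> 'k::field graph_space" where
  "X_hk X h k =
     (if end_of (edges X) h \<noteq> end_of (edges X) k
      then cut_glue_sign h k *\<^sub>v collapse (cut_glue X h k) (fst h) else 0)"

text \<open>
  Distinct non-complementary half-edges lie on distinct edges, so each unordered pair of them is
  listed exactly once by requiring the edge of \<open>h\<close> to come first. The choice is immaterial, as
  \<open>X\<^sub>h\<^sub>k = X\<^sub>k\<^sub>h\<close> in the graph space.
\<close>

definition dH_graph :: "lgraph \<Rightarrow> 'k::field graph_space" where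
  "dH_graph X = (\<Sum>(h, k) \<in> {(h, k). h \<in> half_edges X \<and> k \<in> half_edges X \<and> fst h < fst k}. X_hk X h k)"

definition dH :: "'k::field graph_space \<Rightarrow> 'k graph_space" where
  "dH = lext dH_graph"

definition dH2 :: "'k::field graph_space2 \<Rightarrow> 'k graph_space2" where
  "dH2 = lext (\<lambda>(X, Y). dH (cls X) \<otimes> cls Y + (-1) ^ nv X *\<^sub>v (cls X \<otimes> dH (cls Y)))"


subsection \<open>Product, coproduct and cobracket\<close>

lift_definition empty_graph :: lgraph is "(0, [])"
  by simp

lift_definition disjoint_union :: "lgraph \<Rightarrow> lgraph \<Rightarrow> lgraph" is
  "\<lambda>(x, es) (y, fs). (x + y, es @ map (map_prod ((+) x) ((+) x)) fs)"
proof -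
  fix X Y :: "nat \<times> (nat \<times> nat) list"
  obtain x es y fs where XY: "X = (x, es)" "Y = (y, fs)" by fastforce
  assume "X \<in> {(n, es). (\<forall>e\<in>set es. fst e \<in> {1..n} \<and> snd e \<in> {1..n}) \<and>
      (\<forall>v\<in>{1..n}. 3 \<le> valence es v)}"
    "Y \<in> {(n, es). (\<forall>e\<in>set es. fst e \<in> {1..n} \<and> snd e \<in> {1..n}) \<and>
      (\<forall>v\<in>{1..n}. 3 \<le> valence es v)}"
  then have *: "\<And>e. e \<in> set es \<Longrightarrow> fst e \<in> {1..x} \<and> snd e \<in> {1..x}"
      "\<And>v. v \<in> {1..x} \<Longrightarrow> 3 \<le> valence es v"
      "\<And>e. e \<in> set fs \<Longrightarrow> fst e \<in> {1..y} \<and> snd e \<in> {1..y}"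
      "\<And>v. v \<in> {1..y} \<Longrightarrow> 3 \<le> valence fs v"
    by (auto simp: XY)
  define gs where "gs = map (map_prod ((+) x) ((+) x)) fs"
  have "valence gs (x + v) = valence fs v" for v
    using count_list_map_inj[of "(+) x" "map fst fs" v] count_list_map_inj[of "(+) x" "map snd fs" v]
    by (simp add: gs_def valence_def comp_def)
  then have "3 \<le> valence (es @ gs) v" if "v \<in> {1..x + y}" for v
  proof (cases "v \<le> x")
    case True
    then show ?thesis using *(2)[of v] that by (simp add: valence_def)
  next
    case False
    define w where "w = v - x"
    have "v = x + w" "w \<in> {1..y}"
      using False that by (auto simp: w_def)
    with *(4)[of w] \<open>\<And>v. valence gs (x + v) = valence fs v\<close>[of w] show ?thesis
      by (simp add: valence_def)
  qed
  moreover have "fst e \<in> {1..x + y} \<and> snd e \<in> {1..x + y}" if "e \<in> set (es @ gs)" for e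
    using that *(1,3) by (fastforce simp: gs_def)
  ultimately show "(case X of (x, es) \<Rightarrow> \<lambda>(y, fs).
        (x + y, es @ map (map_prod ((+) x) ((+) x)) fs)) Y
      \<in> {(n, es). (\<forall>e\<in>set es. fst e \<in> {1..n} \<and> snd e \<in> {1..n}) \<and>
          (\<forall>v\<in>{1..n}. 3 \<le> valence es v)}"
    unfolding XY gs_def by auto
qed

definition mult2 :: "'k::field graph_space2 \<Rightarrow> 'k graph_space2 \<Rightarrow> 'k graph_space2" where
  "mult2 s t = lext (\<lambda>(X, Y). lext (\<lambda>(Z, W).
     (-1) ^ (nv Y * nv Z) *\<^sub>v cls (disjoint_union X Z, disjoint_union Y W)) t) s"

definition connected_graph :: "lgraph \<Rightarrow> bool" where
  "connected_graph X \<longleftrightarrow> 1 \<le> nv X \<and>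
     (\<forall>u\<in>{1..nv X}. \<forall>v\<in>{1..nv X}. (u, v) \<in> (set (edges X) \<union> (set (edges X))\<inverse>)\<^sup>*)"

definition coproduct :: "'k::field graph_space \<Rightarrow> 'k graph_space2" where
  "coproduct = (THE D. Vector_Spaces.linear (*\<^sub>v) (*\<^sub>v) D \<and>
     D (cls empty_graph) = cls empty_graph \<otimes> cls empty_graph \<and>
     (\<forall>X. connected_graph X \<longrightarrow> D (cls X) = cls X \<otimes> cls empty_graph + cls empty_graph \<otimes> cls X) \<and>
     (\<forall>X Y. D (cls (disjoint_union X Y)) = mult2 (D (cls X)) (D (cls Y))))"

definition theta :: "'k::field graph_space \<Rightarrow> 'k graph_space2" where
  "theta v = coproduct (dH v) - dH2 (coproduct v)"

definition phi :: "'k::field graph_space2 \<Rightarrow> 'k graph_space2" where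
  "phi = lext (\<lambda>(A, B). (-1) ^ nv A *\<^sub>v (cls A \<otimes> cls B))"

definition theta_phi :: "'k::field graph_space \<Rightarrow> 'k graph_space2" where
  "theta_phi = phi \<circ> theta"

text \<open>
  The space of graphs with the degree shifted down by one has the same underlying vector space,
  and differs only in the degree function.
\<close>

definition shifted_degree :: "lgraph \<Rightarrow> int" where
  "shifted_degree X = int (nv X) - 1"

end

theory Submission
  imports Defs
begin

text \<open>
  Give the half-edges names that survive cutting, gluing and collapsing, and tensors of graphs a
  colouring of the vertices for which every edge is monochromatic. The coproduct then sums over
  all monochromatic 2-colourings, and \<open>\<partial>\<^sub>H\<close> sums the signed operators that cut and glue at two
  half-edges \<open>h, k\<close> and collapse the edge \<open>h \<union> k\<close>. In \<open>\<Delta> \<partial>\<^sub>H - \<partial>\<^sub>H \<Delta>\<close> the colourings that were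
  already monochromatic before cutting cancel, so the cobracket sums over \<open>h, k\<close> and 2-colourings
  that become monochromatic only by gluing at \<open>h, k\<close>.

  Co-antisymmetry comes from exchanging the colours. The left-hand side of the co-Jacobi identity
  is a sum over two successive operations, at \<open>h, k\<close> and at \<open>p, q\<close>, and over 3-colourings, where
  \<open>\<sigma>\<close> rotates the colours. The number of rotations of a colouring that contribute to the sum does
  not change when the two operations are exchanged, whereas the operations anticommute because the
  two collapses do.
\<close>

section \<open>Marked graphs\<close>

text \<open>In \<open>lgraph\<close> half-edges are positions in a list, and every operation shifts
  them; hence the permanent names. Two collapses anticommute because each deletes a vertex from an
  ordered list with the sign of its position, and deleting two vertices in the other order changes
  exactly one of the positions by one. The obstacle is a half-edge of the second pair lying on an
  edge cut by the first: the two orders can then leave the same edge with opposite arrows, in which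
  case the sign of a half-edge changes as well.

  The number of contributing rotations is 0 or 1. Let \<open>h, k, p, q\<close> lie on four edges
  with other ends \<open>a, b, c, d\<close>. In a contributing term \<open>h, k\<close> have one
  colour, and so do \<open>p, q\<close>, \<open>a, b\<close> and \<open>c, d\<close>. The number is
  1 exactly if \<open>h, a\<close> carry two colours, \<open>p, c\<close> carry two colours, and
  these two pairs of colours differ; this is symmetric in the two operations. If exactly one of
  \<open>p, q\<close> is the other end of \<open>h\<close> or \<open>k\<close>, three colours are
  left, and the condition is that they are pairwise different.\<close>

lemma lgraph_eqI: "nv X = nv Y \<Longrightarrow> edges X = edges Y \<Longrightarrow> X = Y"
  by transfer auto

lemma nv_relabel [simp]: "nv (relabel p X) = nv X"
  by transfer auto

lemma edges_relabel: "p permutes {1..nv X} \<Longrightarrow> edges (relabel p X) = map (map_prod p p) (edges X)"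
  by transfer auto

lemma nv_reverse_arrow [simp]: "nv (reverse_arrow i X) = nv X"
  by transfer auto

lemma edges_reverse_arrow:
  "i < length (edges X) \<Longrightarrow> edges (reverse_arrow i X) = (edges X)[i := prod.swap (edges X ! i)]"
  by transfer auto

lemma edges_in:
  assumes "e \<in> set (edges X)"
  shows "fst e \<in> {1..nv X}" "snd e \<in> {1..nv X}"
  using assms by (transfer, auto)+

lemma valence_ge: "x \<in> {1..nv X} \<Longrightarrow> 3 \<le> valence (edges X) x"
  by transfer auto

section \<open>Half-edge names and the marked graphs built on them\<close>

definition halves :: "('h \<times> 'h) list \<Rightarrow> 'h set" where
  "halves \<mu> = fst ` set \<mu> \<union> snd ` set \<mu>"

lemma halves_simps [simp]:
  "halves [] = {}" "halves (e # \<mu>) = {fst e, snd e} \<union> halves \<mu>"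
  "halves (\<mu> @ \<mu>') = halves \<mu> \<union> halves \<mu>'"
  by (auto simp: halves_def)

lemma finite_halves [simp]: "finite (halves \<mu>)"
  by (simp add: halves_def)

lemma halves_mset: "mset \<mu> = mset \<mu>' \<Longrightarrow> halves \<mu> = halves \<mu>'"
  by (metis halves_def mset_eq_setD)

lemma halvesI: "(a, b) \<in> set \<mu> \<Longrightarrow> a \<in> halves \<mu>" "(a, b) \<in> set \<mu> \<Longrightarrow> b \<in> halves \<mu>"
  by (force simp: halves_def)+

definition distinct_halves :: "('h \<times> 'h) list \<Rightarrow> bool" where
  "distinct_halves \<mu> \<longleftrightarrow> distinct (map fst \<mu> @ map snd \<mu>)"

lemma distinct_halves_simps [simp]:
  "distinct_halves []"
  "distinct_halves ((a, b) # \<mu>) \<longleftrightarrow> a \<noteq> b \<and> a \<notin> halves \<mu> \<and> b \<notin> halves \<mu> \<and> distinct_halves \<mu>"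
  by (auto simp: distinct_halves_def halves_def image_iff)

lemma distinct_halves_mset:
  assumes "mset \<mu> = mset \<mu>'"
  shows "distinct_halves \<mu> = distinct_halves \<mu>'"
proof -
  have "mset (map fst \<mu> @ map snd \<mu>) = mset (map fst \<mu>' @ map snd \<mu>')"
    using assms by simp
  then show ?thesis unfolding distinct_halves_def by (metis mset_eq_imp_distinct_iff)
qed

text \<open>
  A marked graph consists of an ordered list of vertex names, a list of edges given as ordered pairs
  of half-edge names, and the incidence map from half-edges to vertices. In contrast to the positions
  in \<^typ>\<open>lgraph\<close>, the names survive cutting, gluing and collapsing.
\<close>

definition ok :: "nat list \<Rightarrow> ('h \<Rightarrow> nat) \<Rightarrow> ('h \<times> 'h) list \<Rightarrow> bool" where
  "ok vs v \<mu> \<longleftrightarrow> distinct vs \<and> distinct_halves \<mu> \<and> v ` halves \<mu> \<subseteq> set vs \<and>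
     (\<forall>x\<in>set vs. 3 \<le> card {h \<in> halves \<mu>. v h = x})"

lemma ok_D:
  assumes "ok vs v \<mu>"
  shows "distinct vs" "distinct_halves \<mu>" "\<And>h. h \<in> halves \<mu> \<Longrightarrow> v h \<in> set vs"
    "\<And>x. x \<in> set vs \<Longrightarrow> 3 \<le> card {h \<in> halves \<mu>. v h = x}"
  using assms by (auto simp: ok_def)

lemma ok_cong:
  assumes "ok vs v \<mu>" "\<And>h. h \<in> halves \<mu> \<Longrightarrow> v h = v' h"
  shows "ok vs v' \<mu>"
proof -
  have "{h \<in> halves \<mu>. v h = x} = {h \<in> halves \<mu>. v' h = x}" for x using assms by auto
  then show ?thesis using assms by (auto simp: ok_def)
qed

lemma ok_perm: "ok vs v \<mu> \<Longrightarrow> distinct ws \<Longrightarrow> set ws = set vs \<Longrightarrow> ok ws v \<mu>"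
  by (simp add: ok_def)

lemma ok_mset: "ok vs v \<mu> \<Longrightarrow> mset \<mu> = mset \<mu>' \<Longrightarrow> ok vs v \<mu>'"
  using distinct_halves_mset[of \<mu> \<mu>'] halves_mset[of \<mu> \<mu>'] by (simp add: ok_def)

lemma ok_rev: "ok vs v ((a, b) # \<mu>) \<Longrightarrow> ok vs v ((b, a) # \<mu>)"
  by (simp add: ok_def insert_commute) blast

lemma ok_rename:
  assumes "ok vs v \<mu>" "inj_on \<rho> (set vs)"
  shows "ok (map \<rho> vs) (\<rho> \<circ> v) \<mu>"
proof -
  have "{h \<in> halves \<mu>. \<rho> (v h) = \<rho> x} = {h \<in> halves \<mu>. v h = x}" if "x \<in> set vs" for x
    using assms that by (auto simp: ok_def inj_on_eq_iff image_subset_iff)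
  then show ?thesis using assms
    by (auto simp: ok_def distinct_map)
qed

lemma distinct_halves_map:
  assumes "inj_on \<eta> (halves \<mu>)"
  shows "distinct_halves (map (map_prod \<eta> \<eta>) \<mu>) = distinct_halves \<mu>"
proof -
  have "map fst (map (map_prod \<eta> \<eta>) \<mu>) @ map snd (map (map_prod \<eta> \<eta>) \<mu>)
      = map \<eta> (map fst \<mu> @ map snd \<mu>)" by simp
  then show ?thesis using assms unfolding distinct_halves_def distinct_map
    by (metis distinct_map halves_def image_set set_append)
qed

lemma halves_map: "halves (map (map_prod \<eta> \<eta>) \<mu>) = \<eta> ` halves \<mu>"
  by (force simp: halves_def)

lemma ok_hrename:
  assumes "inj_on \<eta> (halves \<mu>)"
  shows "ok vs v (map (map_prod \<eta> \<eta>) \<mu>) = ok vs (v \<circ> \<eta>) \<mu>"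
proof -
  have "{h \<in> \<eta> ` halves \<mu>. v h = x} = \<eta> ` {h \<in> halves \<mu>. v (\<eta> h) = x}" for x by auto
  then have "card {h \<in> \<eta> ` halves \<mu>. v h = x} = card {h \<in> halves \<mu>. v (\<eta> h) = x}" for x
    using assms by (simp add: card_image inj_on_subset)
  then show ?thesis using distinct_halves_map[OF assms] by (auto simp: ok_def halves_map)
qed

section \<open>From marked graphs to labelled graphs\<close>

definition pos :: "'v list \<Rightarrow> 'v \<Rightarrow> nat" where
  "pos vs x = length (takeWhile ((\<noteq>) x) vs)"

lemma pos_simps [simp]: "pos [] x = 0" "pos (y # vs) x = (if x = y then 0 else Suc (pos vs x))"
  by (auto simp: pos_def)

lemma pos_less: "x \<in> set vs \<Longrightarrow> pos vs x < length vs"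
  by (induction vs) auto

lemma nth_pos: "x \<in> set vs \<Longrightarrow> vs ! pos vs x = x"
  by (induction vs) auto

lemma pos_nth: "distinct vs \<Longrightarrow> i < length vs \<Longrightarrow> pos vs (vs ! i) = i"
  by (induction vs arbitrary: i) (auto simp: nth_Cons split: nat.splits)

lemma pos_append: "pos (xs @ ys) x = (if x \<in> set xs then pos xs x else length xs + pos ys x)"
  by (induction xs) auto

lemma pos_inj: "x \<in> set vs \<Longrightarrow> y \<in> set vs \<Longrightarrow> pos vs x = pos vs y \<longleftrightarrow> x = y"
  by (metis nth_pos)

lemma pos_map: "inj_on \<rho> (insert x (set vs)) \<Longrightarrow> pos (map \<rho> vs) (\<rho> x) = pos vs x"
  by (induction vs) (auto simp: inj_on_def)

text \<open>Positions count from 0 and the vertices of an \<open>lgraph\<close> from 1, hence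
  \<open>Suc\<close>. Without \<open>ok\<close> the pair need not be a graph and
  \<open>Abs_lgraph\<close> is unspecified, so the facts about \<open>nv\<close> and
  \<open>edges\<close> of \<open>mk\<close> assume \<open>ok\<close>.\<close>

definition mk :: "nat list \<Rightarrow> ('h \<Rightarrow> nat) \<Rightarrow> ('h \<times> 'h) list \<Rightarrow> lgraph" where
  "mk vs v \<mu> = (let f = (\<lambda>h. Suc (pos vs (v h))) in Abs_lgraph (length vs, map (map_prod f f) \<mu>))"

definition gvec :: "nat list \<Rightarrow> ('h \<Rightarrow> nat) \<Rightarrow> ('h \<times> 'h) list \<Rightarrow> 'k::field graph_space" where
  "gvec vs v \<mu> = cls (mk vs v \<mu>)"

text \<open>\<open>valence\<close> counts with multiplicity. As every name occurs only once among
  all half-edges, counting occurrences is counting names, which matches the valence condition of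
  \<open>ok\<close> with that of \<open>lgraph\<close>.\<close>

lemma valence_map:
  assumes "distinct_halves \<mu>"
  shows "valence (map (map_prod f f) \<mu>) x = card {h \<in> halves \<mu>. f h = x}"
proof -
  define hs where "hs = map fst \<mu> @ map snd \<mu>"
  have "valence (map (map_prod f f) \<mu>) x = count_list (map f hs) x"
    by (simp add: valence_def hs_def comp_def)
  also have "\<dots> = length (filter (\<lambda>h. f h = x) hs)"
    by (induction hs) auto
  also have "\<dots> = card (set (filter (\<lambda>h. f h = x) hs))"
    using assms unfolding distinct_halves_def hs_def by (subst distinct_card) auto
  also have "set (filter (\<lambda>h. f h = x) hs) = {h \<in> halves \<mu>. f h = x}"
    by (auto simp: hs_def halves_def)
  finally show ?thesis .
qed

lemma mk:
  assumes "ok vs v \<mu>"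
  defines "f \<equiv> \<lambda>h. Suc (pos vs (v h))"
  shows nv_mk: "nv (mk vs v \<mu>) = length vs"
    and edges_mk: "edges (mk vs v \<mu>) = map (map_prod f f) \<mu>"
proof -
  note ok = ok_D[OF assms(1)]
  have "fst e \<in> {1..length vs} \<and> snd e \<in> {1..length vs}" if "e \<in> set (map (map_prod f f) \<mu>)" for e
  proof -
    obtain e0 where e0: "e0 \<in> set \<mu>" "e = map_prod f f e0" using \<open>e \<in> _\<close> by auto
    then have "v (fst e0) \<in> set vs" "v (snd e0) \<in> set vs"
      by (auto intro!: ok(3) simp: halves_def)
    from this[THEN pos_less] show ?thesis by (simp add: e0 f_def Suc_le_eq)
  qed
  moreover have "3 \<le> valence (map (map_prod f f) \<mu>) x" if "x \<in> {1..length vs}" for x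
  proof -
    have "{h \<in> halves \<mu>. f h = x} = {h \<in> halves \<mu>. v h = vs ! (x - 1)}"
      using that ok(1,3) by (auto simp: f_def nth_pos pos_nth)
    moreover have "vs ! (x - 1) \<in> set vs" using that by (intro nth_mem) auto
    ultimately show ?thesis using ok(2) ok(4)[of "vs ! (x - 1)"] by (simp add: valence_map)
  qed
  ultimately have *: "(length vs, map (map_prod f f) \<mu>) \<in> {(n, es).
    (\<forall>e\<in>set es. fst e \<in> {1..n} \<and> snd e \<in> {1..n}) \<and> (\<forall>v\<in>{1..n}. 3 \<le> valence es v)}" by blast
  show "nv (mk vs v \<mu>) = length vs" "edges (mk vs v \<mu>) = map (map_prod f f) \<mu>"
    using * by (simp_all add: mk_def Let_def flip: f_def)
      (simp_all add: nv.rep_eq edges.rep_eq Abs_lgraph_inverse)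
qed

text \<open>The names are those of \<open>half_edges\<close>, so \<open>end_of\<close> can serve as
  the incidence map. Every labelled graph thus has a marking from which \<open>mk\<close> recovers
  it (\<open>mk_canon\<close>).\<close>

definition std :: "nat \<Rightarrow> (half_edge \<times> half_edge) list" where
  "std m = map (\<lambda>i. ((i, False), (i, True))) [0..<m]"

lemma set_std: "set (std m) = {((i, False), (i, True)) | i. i < m}"
  by (auto simp: std_def)

lemma halves_std: "halves (std m) = {..<m} \<times> UNIV"
  by (force simp: halves_def set_std image_iff)

lemma distinct_halves_std: "distinct_halves (std m)"
  by (auto simp: distinct_halves_def std_def comp_def distinct_map inj_on_def)

lemma map_std: "map (map_prod (end_of es) (end_of es)) (std (length es)) = es"
  by (rule nth_equalityI) (auto simp: std_def end_of_def prod_eq_iff)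

abbreviation canon_vs :: "lgraph \<Rightarrow> nat list" where
  "canon_vs X \<equiv> [Suc 0..<Suc (nv X)]"

lemma ok_canon: "ok (canon_vs X) (end_of (edges X)) (std (length (edges X)))"
proof -
  let ?\<mu> = "std (length (edges X))"
  have "end_of (edges X) h \<in> {1..nv X}" if "h \<in> halves ?\<mu>" for h
  proof -
    have "edges X ! fst h \<in> set (edges X)" using that by (auto simp: halves_std)
    from edges_in[OF this] show ?thesis by (simp add: end_of_def)
  qed
  moreover have "3 \<le> card {h \<in> halves ?\<mu>. end_of (edges X) h = x}" if "x \<in> {1..nv X}" for x
    using valence_ge[OF that] valence_map[OF distinct_halves_std, of "end_of (edges X)" "length (edges X)" x]
    by (simp add: map_std)
  ultimately show ?thesis
    by (force simp: ok_def distinct_halves_std)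
qed

lemma pos_upt: "x \<in> {a..<b} \<Longrightarrow> pos [a..<b] x = x - a"
  using pos_nth[of "[a..<b]" "x - a"] by (simp del: pos_simps) (metis atLeastLessThan_iff diff_less_mono le_add_diff_inverse)

lemma mk_canon: "mk (canon_vs X) (end_of (edges X)) (std (length (edges X))) = X"
proof (rule lgraph_eqI)
  note ok = ok_canon[of X]
  show "nv (mk (canon_vs X) (end_of (edges X)) (std (length (edges X)))) = nv X"
    by (subst nv_mk[OF ok]) simp
  have "map (map_prod (\<lambda>h. Suc (pos (canon_vs X) (end_of (edges X) h)))
      (\<lambda>h. Suc (pos (canon_vs X) (end_of (edges X) h)))) (std (length (edges X)))
    = map (map_prod (end_of (edges X)) (end_of (edges X))) (std (length (edges X)))"
  proof (rule map_cong[OF refl])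
    fix e assume "e \<in> set (std (length (edges X)))"
    then have "fst e \<in> halves (std (length (edges X)))" "snd e \<in> halves (std (length (edges X)))"
      by (auto simp: halves_def)
    from this[THEN ok_D(3)[OF ok]]
    have "end_of (edges X) (fst e) \<in> {1..<Suc (nv X)}" "end_of (edges X) (snd e) \<in> {1..<Suc (nv X)}"
      by auto
    then show "map_prod (\<lambda>h. Suc (pos (canon_vs X) (end_of (edges X) h)))
      (\<lambda>h. Suc (pos (canon_vs X) (end_of (edges X) h))) e
      = map_prod (end_of (edges X)) (end_of (edges X)) e"
      by (cases e) (simp add: pos_upt del: upt_Suc)
  qed
  then show "edges (mk (canon_vs X) (end_of (edges X)) (std (length (edges X)))) = edges X"
    by (simp add: edges_mk[OF ok] map_std del: upt_Suc)
qed

lemma gvec_canon: "gvec (canon_vs X) (end_of (edges X)) (std (length (edges X))) = cls X"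
  by (simp add: gvec_def mk_canon del: upt_Suc)


subsection \<open>Alternating functions of marked graphs\<close>

text \<open>
  Invariance under renaming of vertices is only required for renamings that respect the sets in \<open>C\<close>,
  which will be the colour classes of a colouring of the vertices.
\<close>

definition good :: "nat set set \<Rightarrow> (nat list \<Rightarrow> ('h \<Rightarrow> nat) \<Rightarrow> ('h \<times> 'h) list \<Rightarrow> ('c::signed_set, 'k::field) svec) \<Rightarrow> bool"
  where "good C \<Phi> \<longleftrightarrow>
    (\<forall>vs v \<mu>. ok vs v \<mu> \<longrightarrow>
      (\<forall>v'. (\<forall>h\<in>halves \<mu>. v h = v' h) \<longrightarrow> \<Phi> vs v' \<mu> = \<Phi> vs v \<mu>) \<and>
      (\<forall>xs a b ys. vs = xs @ a # b # ys \<longrightarrow> \<Phi> (xs @ b # a # ys) v \<mu> = - \<Phi> vs v \<mu>) \<and>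
      (\<forall>\<mu>'. mset \<mu>' = mset \<mu> \<longrightarrow> \<Phi> vs v \<mu>' = \<Phi> vs v \<mu>) \<and>
      (\<forall>h k \<nu>. \<mu> = (h, k) # \<nu> \<longrightarrow> \<Phi> vs v ((k, h) # \<nu>) = - \<Phi> vs v \<mu>) \<and>
      (\<forall>\<rho>. inj_on \<rho> (set vs) \<and> (\<forall>S\<in>C. \<forall>x\<in>set vs. \<rho> x \<in> S \<longleftrightarrow> x \<in> S) \<longrightarrow>
        \<Phi> (map \<rho> vs) (\<rho> \<circ> v) \<mu> = \<Phi> vs v \<mu>))"

lemma goodD:
  assumes "good C \<Phi>" "ok vs v \<mu>"
  shows good_cong: "(\<And>h. h \<in> halves \<mu> \<Longrightarrow> v h = v' h) \<Longrightarrow> \<Phi> vs v' \<mu> = \<Phi> vs v \<mu>"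
    and good_swap: "vs = xs @ a # b # ys \<Longrightarrow> \<Phi> (xs @ b # a # ys) v \<mu> = - \<Phi> vs v \<mu>"
    and good_mset: "mset \<mu>' = mset \<mu> \<Longrightarrow> \<Phi> vs v \<mu>' = \<Phi> vs v \<mu>"
    and good_rev: "\<mu> = (h, k) # \<nu> \<Longrightarrow> \<Phi> vs v ((k, h) # \<nu>) = - \<Phi> vs v \<mu>"
    and good_rename: "inj_on \<rho> (set vs) \<Longrightarrow> (\<And>S x. S \<in> C \<Longrightarrow> x \<in> set vs \<Longrightarrow> \<rho> x \<in> S \<longleftrightarrow> x \<in> S) \<Longrightarrow>
        \<Phi> (map \<rho> vs) (\<rho> \<circ> v) \<mu> = \<Phi> vs v \<mu>"
proof -
  note * = assms(1)[unfolded good_def, rule_format, OF assms(2)]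
  show "(\<And>h. h \<in> halves \<mu> \<Longrightarrow> v h = v' h) \<Longrightarrow> \<Phi> vs v' \<mu> = \<Phi> vs v \<mu>"
    using *[THEN conjunct1] by blast
  show "vs = xs @ a # b # ys \<Longrightarrow> \<Phi> (xs @ b # a # ys) v \<mu> = - \<Phi> vs v \<mu>"
    using *[THEN conjunct2, THEN conjunct1] by blast
  show "mset \<mu>' = mset \<mu> \<Longrightarrow> \<Phi> vs v \<mu>' = \<Phi> vs v \<mu>"
    using *[THEN conjunct2, THEN conjunct2, THEN conjunct1] by blast
  show "\<mu> = (h, k) # \<nu> \<Longrightarrow> \<Phi> vs v ((k, h) # \<nu>) = - \<Phi> vs v \<mu>"
    using *[THEN conjunct2, THEN conjunct2, THEN conjunct2, THEN conjunct1] by blast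
  show "inj_on \<rho> (set vs) \<Longrightarrow> (\<And>S x. S \<in> C \<Longrightarrow> x \<in> set vs \<Longrightarrow> \<rho> x \<in> S \<longleftrightarrow> x \<in> S) \<Longrightarrow>
        \<Phi> (map \<rho> vs) (\<rho> \<circ> v) \<mu> = \<Phi> vs v \<mu>"
    using *[THEN conjunct2, THEN conjunct2, THEN conjunct2, THEN conjunct2] by blast
qed

lemma goodI:
  assumes "\<And>vs v \<mu> v'. ok vs v \<mu> \<Longrightarrow> (\<And>h. h \<in> halves \<mu> \<Longrightarrow> v h = v' h) \<Longrightarrow> \<Phi> vs v' \<mu> = \<Phi> vs v \<mu>"
    and "\<And>xs a b ys v \<mu>. ok (xs @ a # b # ys) v \<mu> \<Longrightarrow> \<Phi> (xs @ b # a # ys) v \<mu> = - \<Phi> (xs @ a # b # ys) v \<mu>"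
    and "\<And>vs v \<mu> \<mu>'. ok vs v \<mu> \<Longrightarrow> mset \<mu>' = mset \<mu> \<Longrightarrow> \<Phi> vs v \<mu>' = \<Phi> vs v \<mu>"
    and "\<And>vs v h k \<nu>. ok vs v ((h, k) # \<nu>) \<Longrightarrow> \<Phi> vs v ((k, h) # \<nu>) = - \<Phi> vs v ((h, k) # \<nu>)"
    and "\<And>vs v \<mu> \<rho>. ok vs v \<mu> \<Longrightarrow> inj_on \<rho> (set vs) \<Longrightarrow>
        (\<And>S x. S \<in> C \<Longrightarrow> x \<in> set vs \<Longrightarrow> \<rho> x \<in> S \<longleftrightarrow> x \<in> S) \<Longrightarrow>
        \<Phi> (map \<rho> vs) (\<rho> \<circ> v) \<mu> = \<Phi> vs v \<mu>"
  shows "good C \<Phi>"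
  unfolding good_def
proof (intro allI impI conjI)
  fix vs v and \<mu> :: "('a \<times> 'a) list" and v'
  assume "ok vs v \<mu>" "\<forall>h\<in>halves \<mu>. v h = v' h"
  then show "\<Phi> vs v' \<mu> = \<Phi> vs v \<mu>" using assms(1) by blast
next
  fix vs v and \<mu> :: "('a \<times> 'a) list" and \<rho>
  assume "ok vs v \<mu>" "inj_on \<rho> (set vs) \<and> (\<forall>S\<in>C. \<forall>x\<in>set vs. (\<rho> x \<in> S) = (x \<in> S))"
  then show "\<Phi> (map \<rho> vs) (\<rho> \<circ> v) \<mu> = \<Phi> vs v \<mu>" by (intro assms(5)) auto
next
  fix vs v and \<mu> :: "('a \<times> 'a) list" and xs a b ys
  assume "ok vs v \<mu>" "vs = xs @ a # b # ys"
  then show "\<Phi> (xs @ b # a # ys) v \<mu> = - \<Phi> vs v \<mu>" using assms(2) by blast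
next
  fix vs v and \<mu> :: "('a \<times> 'a) list" and \<mu>'
  assume "ok vs v \<mu>" "mset \<mu>' = mset \<mu>"
  then show "\<Phi> vs v \<mu>' = \<Phi> vs v \<mu>" by (rule assms(3))
next
  fix vs v and \<mu> :: "('a \<times> 'a) list" and h k \<nu>
  assume "ok vs v \<mu>" "\<mu> = (h, k) # \<nu>"
  then show "\<Phi> vs v ((k, h) # \<nu>) = - \<Phi> vs v \<mu>" using assms(4) by blast
qed

lemma cls_mset:
  assumes "nv X = nv Y" "mset (edges X) = mset (edges Y)"
  shows "(cls X :: (lgraph, 'k::field) svec) = cls Y"
proof -
  have "srel X 1 Y" using assms by (simp add: srel_lgraph_def)
  from srel_cls[OF this, where 'k = 'k] show ?thesis by simp
qed

lemma cls_reverse_arrow: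
  "i < length (edges X) \<Longrightarrow> (cls (reverse_arrow i X) :: (lgraph, 'k::field) svec) = - cls X"
proof -
  assume "i < length (edges X)"
  then have "srel X (-1) (reverse_arrow i X)" by (auto simp: srel_lgraph_def)
  from srel_cls[OF this] show "(cls (reverse_arrow i X) :: (lgraph, 'k) svec) = - cls X" by (metis minus_minus of_int_1 of_int_minus svec.scale_minus_left svec.scale_one)
qed

lemma cls_relabel_transpose:
  "u \<in> {1..nv X} \<Longrightarrow> w \<in> {1..nv X} \<Longrightarrow> u \<noteq> w \<Longrightarrow>
    (cls (relabel (transpose u w) X) :: (lgraph, 'k::field) svec) = - cls X"
proof -
  assume "u \<in> {1..nv X}" "w \<in> {1..nv X}" "u \<noteq> w"
  then have "srel X (-1) (relabel (transpose u w) X)" unfolding srel_lgraph_def by blast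
  from srel_cls[OF this] show "(cls (relabel (transpose u w) X) :: (lgraph, 'k) svec) = - cls X" by (metis minus_minus of_int_1 of_int_minus svec.scale_minus_left svec.scale_one)
qed

text \<open>With \<open>C\<close> empty every injective renaming is admissible: \<open>mk\<close>
  sees a vertex only through its position. Adjacent switches and a reversal at the head of the list
  are enough to ask for, since other transpositions and other edges are reached by
  reordering.\<close>

lemma good_gvec: "good {} (gvec :: _ \<Rightarrow> ('h \<Rightarrow> nat) \<Rightarrow> _ \<Rightarrow> 'k::field graph_space)"
proof (rule goodI)
  fix vs and v v' :: "'h \<Rightarrow> nat" and \<mu>
  assume "\<And>h. h \<in> halves \<mu> \<Longrightarrow> v h = v' h"
  then have "mk vs v' \<mu> = mk vs v \<mu>"
    by (auto simp: mk_def Let_def halvesI intro!: arg_cong[of _ _ Abs_lgraph])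
  then show "gvec vs v' \<mu> = (gvec vs v \<mu> :: 'k graph_space)" by (simp add: gvec_def)
next
  fix xs a b ys and v :: "'h \<Rightarrow> nat" and \<mu>
  assume ok: "ok (xs @ a # b # ys) v \<mu>"
  then have ok': "ok (xs @ b # a # ys) v \<mu>" by (rule ok_perm) (use ok_D(1)[OF ok] in auto)
  note d = ok_D(1)[OF ok]
  let ?t = "transpose (Suc (length xs)) (Suc (Suc (length xs)))"
  have p: "Suc (pos (xs @ b # a # ys) x) = ?t (Suc (pos (xs @ a # b # ys) x))"
    if "x \<in> set (xs @ a # b # ys)" for x
    using that d pos_less[of x xs] by (auto simp: pos_append transpose_def)
  have "mk (xs @ b # a # ys) v \<mu> = relabel ?t (mk (xs @ a # b # ys) v \<mu>)"
  proof (rule lgraph_eqI)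
    show "edges (mk (xs @ b # a # ys) v \<mu>) = edges (relabel ?t (mk (xs @ a # b # ys) v \<mu>))"
    proof (subst edges_relabel)
      show "edges (mk (xs @ b # a # ys) v \<mu>) = map (map_prod ?t ?t) (edges (mk (xs @ a # b # ys) v \<mu>))"
        using ok_D(3)[OF ok] p
        by (auto simp: edges_mk[OF ok] edges_mk[OF ok'] halvesI simp del: set_append)
    qed (auto simp: nv_mk[OF ok] intro!: permutes_swap_id)
  qed (simp_all add: nv_mk[OF ok] nv_mk[OF ok'])
  then show "gvec (xs @ b # a # ys) v \<mu> = (- gvec (xs @ a # b # ys) v \<mu> :: 'k graph_space)"
    unfolding gvec_def by (simp add: cls_relabel_transpose nv_mk[OF ok])
next
  fix vs and v :: "'h \<Rightarrow> nat" and \<mu> \<mu>'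
  assume ok: "ok vs v \<mu>" and m: "mset \<mu>' = mset \<mu>"
  then have ok': "ok vs v \<mu>'" by (auto intro: ok_mset)
  show "gvec vs v \<mu>' = (gvec vs v \<mu> :: 'k graph_space)"
    unfolding gvec_def by (rule cls_mset) (simp_all add: nv_mk[OF ok] nv_mk[OF ok'] edges_mk[OF ok] edges_mk[OF ok'] m)
next
  fix vs and v :: "'h \<Rightarrow> nat" and a b \<nu>
  assume ok: "ok vs v ((a, b) # \<nu>)"
  then have ok': "ok vs v ((b, a) # \<nu>)" by (rule ok_rev)
  have "mk vs v ((b, a) # \<nu>) = reverse_arrow 0 (mk vs v ((a, b) # \<nu>))"
    by (rule lgraph_eqI)
      (simp_all add: nv_mk[OF ok] nv_mk[OF ok'] edges_reverse_arrow edges_mk[OF ok] edges_mk[OF ok'])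
  then show "gvec vs v ((b, a) # \<nu>) = (- gvec vs v ((a, b) # \<nu>) :: 'k graph_space)"
    unfolding gvec_def by (simp add: cls_reverse_arrow edges_mk[OF ok])
next
  fix vs and v :: "'h \<Rightarrow> nat" and \<mu> and \<rho> :: "nat \<Rightarrow> nat"
  assume ok: "ok vs v \<mu>" and inj: "inj_on \<rho> (set vs)"
  have "pos (map \<rho> vs) (\<rho> (v h)) = pos vs (v h)" if "h \<in> halves \<mu>" for h
    using that ok_D(3)[OF ok that] inj by (simp add: pos_map insert_absorb)
  then have "mk (map \<rho> vs) (\<rho> \<circ> v) \<mu> = mk vs v \<mu>"
    by (auto simp: mk_def Let_def halvesI intro!: arg_cong[of _ _ Abs_lgraph])
  then show "gvec (map \<rho> vs) (\<rho> \<circ> v) \<mu> = (gvec vs v \<mu> :: 'k graph_space)" by (simp add: gvec_def)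
qed

lemma gvec_hrename: "gvec vs v (map (map_prod \<eta> \<eta>) \<mu>) = gvec vs (v \<circ> \<eta>) \<mu>"
  by (simp add: gvec_def mk_def Let_def comp_def map_prod_def case_prod_unfold)


subsection \<open>Reordering\<close>

text \<open>Exchanging two entries with \<open>n\<close> others between them takes
  \<open>2 * n + 1\<close> adjacent switches, an odd number. The induction peels off one entry
  \<open>y\<close>: \<open>c\<close> passes \<open>y\<close>, a shorter exchange takes place, and
  \<open>d\<close> passes \<open>y\<close>.\<close>

lemma good_transpose:
  assumes g: "good C \<Phi>" and ok: "ok vs v \<mu>" and ab: "a \<in> set vs" "b \<in> set vs" "a \<noteq> b"
  shows "\<Phi> (map (transpose a b) vs) v \<mu> = - \<Phi> vs v \<mu>"
proof -
  have main: "\<Phi> (xs @ c # ys @ d # zs) v \<mu> = - \<Phi> (xs @ d # ys @ c # zs) v \<mu>"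
    if "ok (xs @ c # ys @ d # zs) v \<mu>" for xs c ys d zs
    using that
  proof (induction ys arbitrary: xs)
    case Nil
    then show ?case using good_swap[OF g, of "xs @ c # d # zs" v \<mu> xs c d zs] by simp
  next
    case (Cons y ys)
    have d: "distinct (xs @ c # y # ys @ d # zs)" using ok_D(1)[OF Cons.prems] by simp
    have ok1: "ok ((xs @ [y]) @ c # ys @ d # zs) v \<mu>" and ok2: "ok (xs @ y # d # ys @ c # zs) v \<mu>"
      using Cons.prems by (rule ok_perm, use d in auto)+
    have "\<Phi> (xs @ y # c # ys @ d # zs) v \<mu> = - \<Phi> (xs @ c # (y # ys) @ d # zs) v \<mu>"
      using good_swap[OF g Cons.prems, of xs c y "ys @ d # zs"] by simp
    moreover have "\<Phi> (xs @ y # c # ys @ d # zs) v \<mu> = - \<Phi> (xs @ y # d # ys @ c # zs) v \<mu>"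
      using Cons.IH[OF ok1] by simp
    moreover have "\<Phi> (xs @ d # y # ys @ c # zs) v \<mu> = - \<Phi> (xs @ y # d # ys @ c # zs) v \<mu>"
      using good_swap[OF g ok2, of xs y d "ys @ c # zs"] by simp
    ultimately show ?case by (metis append_Cons minus_minus)
  qed
  have sym: "\<Phi> (map (transpose c d) vs) v \<mu> = - \<Phi> vs v \<mu>"
    if vs: "vs = xs @ c # ys @ d # zs" for c d xs ys zs
  proof -
    have "c \<noteq> d" "map (transpose c d) l = l" if "c \<notin> set l" "d \<notin> set l" for l
      using vs ok_D(1)[OF ok] that by (auto simp: transpose_def intro!: map_idI)
    then have "map (transpose c d) vs = xs @ d # ys @ c # zs"
      using ok_D(1)[OF ok] by (auto simp: vs)
    then show ?thesis using main[of xs c ys d zs] ok by (simp add: vs)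
  qed
  obtain xs ys where vs: "vs = xs @ a # ys" using ab(1) by (auto dest: split_list)
  then consider "b \<in> set xs" | "b \<in> set ys" using ab by auto
  then show ?thesis
  proof cases
    case 1
    then obtain us ws where "xs = us @ b # ws" by (auto dest: split_list)
    then show ?thesis using sym[of us b ws a ys] vs by (simp add: transpose_commute)
  next
    case 2
    then obtain us ws where "ys = us @ b # ws" by (auto dest: split_list)
    then show ?thesis using sym[of xs a us b ws] vs by simp
  qed
qed

lemma good_permute:
  assumes g: "good C \<Phi>" and ok: "ok vs v \<mu>" and "p permutes set vs"
  shows "\<Phi> (map p vs) v \<mu> = of_int (sign p) *\<^sub>v \<Phi> vs v \<mu>"
  using assms(3) finite_set
proof (induction rule: permutes_induct)
  case id
  then show ?case by (simp add: sign_id)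
next
  case (swap a b p)
  have ok': "ok (map p vs) v \<mu>" using ok
    by (rule ok_perm) (use swap.hyps(4) ok_D(1)[OF ok] in
      \<open>auto simp: distinct_map permutes_inj_on permutes_image\<close>)
  have s: "set (map p vs) = set vs" using swap.hyps(4) by (simp add: permutes_image)
  have "\<Phi> (map (transpose a b \<circ> p) vs) v \<mu> = - \<Phi> (map p vs) v \<mu>"
    using good_transpose[OF g ok', of a b] swap.hyps s by simp
  moreover have "sign (transpose a b \<circ> p) = - sign p"
    using sign_compose[OF permutation_swap_id permutes_imp_permutation[OF finite_set swap.hyps(4)], of a b]
      swap.hyps(3) by (simp add: sign_swap_id)
  ultimately show ?case using swap.IH by (metis of_int_minus svec.scale_minus_left)
qed

lemma good_scale:
  assumes "good C \<Phi>"
  shows "good C (\<lambda>vs v \<mu>. c *\<^sub>v \<Phi> vs v \<mu>)"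
proof (rule goodI, goal_cases)
  case 1 show ?case using good_cong[OF assms 1] by simp
next
  case 2 show ?case using good_swap[OF assms 2 refl] by (simp add: svec.scale_minus_right)
next
  case 3 show ?case using good_mset[OF assms 3] by simp
next
  case 4 show ?case using good_rev[OF assms 4 refl] by (simp add: svec.scale_minus_right)
next
  case 5 show ?case using good_rename[OF assms 5] by simp
qed

lemma good_uminus: "good C \<Phi> \<Longrightarrow> good C (\<lambda>vs v \<mu>. - \<Phi> vs v \<mu>)"
  using good_scale[of C \<Phi> "-1"] by (simp add: svec.scale_minus_left)

lemma list_permutation:
  assumes "distinct vs" "distinct ws" "set vs = set ws"
  obtains p where "p permutes set vs" "map p vs = ws"
proof -
  have len: "length vs = length ws" using assms by (metis distinct_card)
  define p where "p x = (if x \<in> set vs then ws ! pos vs x else x)" for x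
  have m: "map p vs = ws"
    using assms(1) len by (intro nth_equalityI) (auto simp: p_def pos_nth)
  have "bij_betw p (set vs) (set vs)"
    unfolding bij_betw_def
  proof
    show "inj_on p (set vs)" using m assms(1,2) by (metis distinct_map)
    show "p ` set vs = set vs" using m assms(3) by (metis set_map)
  qed
  then have "p permutes set vs" by (rule bij_imp_permutes) (simp add: p_def)
  with m that show ?thesis by blast
qed

text \<open>Both functions change by the same invertible sign. Identities between alternating
  functions can therefore be checked with the relevant vertices at the front of the list, where
  positions are explicit numbers.\<close>

lemma good_eq_perm:
  assumes "good C \<Phi>" "good D \<Psi>" and ok: "ok vs v \<mu>"
    and ws: "distinct ws" "set ws = set vs" and eq: "\<Phi> ws v \<mu> = \<Psi> ws v \<mu>"
  shows "\<Phi> vs v \<mu> = \<Psi> vs v \<mu>"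
proof -
  obtain p where p: "p permutes set vs" "map p vs = ws"
    using list_permutation[of vs ws] ok_D(1)[OF ok] ws by metis
  have "sign p = 1 \<or> sign p = -1" by (simp add: sign_def)
  then show ?thesis
    using good_permute[OF assms(1) ok p(1)] good_permute[OF assms(2) ok p(1)] eq p(2)
    by (auto simp: svec.scale_minus_left)
qed


subsection \<open>Cutting, gluing and collapsing marked graphs\<close>

text \<open>\<open>par\<close> is the complementary half-edge; \<open>sg\<close> records whether a
  half-edge is initial or terminal, so that adjusting arrows becomes multiplying signs.\<close>

primrec par :: "('h \<times> 'h) list \<Rightarrow> 'h \<Rightarrow> 'h" where
  "par [] h = h"
| "par (e # \<mu>) h = (if h = fst e then snd e else if h = snd e then fst e else par \<mu> h)"

primrec sg :: "('h \<times> 'h) list \<Rightarrow> 'h \<Rightarrow> 'k::field" where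
  "sg [] h = 0"
| "sg (e # \<mu>) h = (if h = fst e then 1 else if h = snd e then -1 else sg \<mu> h)"

definition untouched :: "'h \<Rightarrow> 'h \<Rightarrow> 'h \<times> 'h \<Rightarrow> bool" where
  "untouched h k e \<longleftrightarrow> fst e \<noteq> h \<and> fst e \<noteq> k \<and> snd e \<noteq> h \<and> snd e \<noteq> k"

text \<open>The edges after the collapse: the new edge made of \<open>h\<close> and \<open>k\<close>
  has disappeared, and the other new edge runs from the complement of \<open>k\<close> to that of
  \<open>h\<close>, as the orientation rule demands. The change of the incidence map is left to
  \<open>merge\<close>.\<close>

definition rewire :: "('h \<times> 'h) list \<Rightarrow> 'h \<Rightarrow> 'h \<Rightarrow> ('h \<times> 'h) list" where
  "rewire \<mu> h k = (par \<mu> k, par \<mu> h) # filter (untouched h k) \<mu>"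

lemma par_notin: "h \<notin> halves \<mu> \<Longrightarrow> par \<mu> h = h"
  by (induction \<mu>) auto

lemma sg_notin: "h \<notin> halves \<mu> \<Longrightarrow> sg \<mu> h = 0"
  by (induction \<mu>) auto

lemma par_sg_in:
  assumes "distinct_halves \<mu>" "(a, b) \<in> set \<mu>"
  shows "par \<mu> a = b" "par \<mu> b = a" "sg \<mu> a = 1" "sg \<mu> b = -1"
proof -
  have "par \<mu> a = b \<and> par \<mu> b = a \<and> sg \<mu> a = 1 \<and> sg \<mu> b = -1" using assms
  proof (induction \<mu>)
    case (Cons e \<mu>)
    obtain c d where e: "e = (c, d)" by fastforce
    show ?case
    proof (cases "(a, b) = e")
      case True
      then show ?thesis using Cons.prems(1) by (auto simp: e)
    next
      case False
      then have ab: "(a, b) \<in> set \<mu>" using Cons.prems by auto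
      then have "a \<in> halves \<mu>" "b \<in> halves \<mu>" by (auto intro: halvesI)
      then show ?thesis using Cons.IH ab Cons.prems(1) by (auto simp: e)
    qed
  qed simp
  then show "par \<mu> a = b" "par \<mu> b = a" "sg \<mu> a = 1" "sg \<mu> b = -1" by auto
qed

lemma halvesE:
  assumes "h \<in> halves \<mu>"
  obtains a where "(h, a) \<in> set \<mu>" | a where "(a, h) \<in> set \<mu>"
  using assms by (auto simp: halves_def)

lemma par_sg_mset:
  assumes "distinct_halves \<mu>" "mset \<mu> = mset \<mu>'"
  shows "par \<mu>' h = par \<mu> h" "sg \<mu>' h = sg \<mu> h"
proof -
  have d': "distinct_halves \<mu>'" using assms distinct_halves_mset by blast
  have s: "set \<mu>' = set \<mu>" "halves \<mu>' = halves \<mu>" using assms(2) by (metis mset_eq_setD, metis halves_mset)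
  have "par \<mu>' h = par \<mu> h \<and> sg \<mu>' h = sg \<mu> h"
  proof (cases "h \<in> halves \<mu>")
    case True
    then show ?thesis
      by (rule halvesE) (use par_sg_in[OF assms(1)] par_sg_in[OF d'] s in metis)+
  next
    case False
    then show ?thesis using s by (simp add: par_notin sg_notin)
  qed
  then show "par \<mu>' h = par \<mu> h" "sg \<mu>' h = sg \<mu> h" by auto
qed

lemma par_in: "h \<in> halves \<mu> \<Longrightarrow> par \<mu> h \<in> halves \<mu>"
  by (induction \<mu>) auto

lemma par_par:
  assumes "distinct_halves \<mu>"
  shows "par \<mu> (par \<mu> h) = h"
proof (cases "h \<in> halves \<mu>")
  case True
  then show ?thesis by (rule halvesE) (simp_all add: par_sg_in[OF assms])
qed (simp add: par_notin)

lemma rewire_mset: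
  assumes "distinct_halves \<mu>" "mset \<mu> = mset \<mu>'"
  shows "mset (rewire \<mu>' h k) = mset (rewire \<mu> h k)"
  by (simp add: rewire_def par_sg_mset(1)[OF assms] assms(2))

text \<open>Reordering brings the edge of \<open>h\<close> to the head, and a reversal makes
  \<open>h\<close> initial. Together with \<open>two_front\<close> this replaces case distinctions
  over where \<open>h\<close> sits and which way its edge points.\<close>

lemma one_front:
  assumes "h \<in> halves \<mu>"
    and perm: "\<And>\<mu> \<mu>'. mset \<mu> = mset \<mu>' \<Longrightarrow> P \<mu> \<Longrightarrow> P \<mu>'"
    and rev: "\<And>a b \<mu>. P ((a, b) # \<mu>) \<Longrightarrow> P ((b, a) # \<mu>)"
    and main: "\<And>a R. mset \<mu> = mset ((h, a) # R) \<or> mset \<mu> = mset ((a, h) # R) \<Longrightarrow> P ((h, a) # R)"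
  shows "P \<mu>"
  using assms(1)
proof (rule halvesE)
  fix a assume "(h, a) \<in> set \<mu>"
  then have m: "mset ((h, a) # remove1 (h, a) \<mu>) = mset \<mu>" by simp
  show ?thesis by (rule perm[OF m main]) (use m in simp)
next
  fix a assume "(a, h) \<in> set \<mu>"
  then have m: "mset ((a, h) # remove1 (a, h) \<mu>) = mset \<mu>" by simp
  show ?thesis by (rule perm[OF m rev[OF main]]) (use m in simp)
qed

text \<open>\<open>h\<close> comes out initial and \<open>k\<close> terminal, the convention under
  which cutting and gluing costs no sign. The second edge is treated by \<open>one_front\<close> on
  the tail, which contains \<open>k\<close> because \<open>k\<close> is neither \<open>h\<close> nor
  its complement.\<close>

lemma two_front:
  assumes d: "distinct_halves \<mu>" and hk: "h \<in> halves \<mu>" "k \<in> halves \<mu>" "h \<noteq> k" "par \<mu> h \<noteq> k"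
    and perm: "\<And>\<mu> \<mu>'. mset \<mu> = mset \<mu>' \<Longrightarrow> P \<mu> \<Longrightarrow> P \<mu>'"
    and rev: "\<And>a b \<mu>. P ((a, b) # \<mu>) \<Longrightarrow> P ((b, a) # \<mu>)"
    and main: "\<And>a b R. distinct_halves ((h, a) # (b, k) # R) \<Longrightarrow>
      halves ((h, a) # (b, k) # R) = halves \<mu> \<Longrightarrow> P ((h, a) # (b, k) # R)"
  shows "P \<mu>"
  using hk(1) perm rev
proof (rule one_front)
  fix a R assume m: "mset \<mu> = mset ((h, a) # R) \<or> mset \<mu> = mset ((a, h) # R)"
  have da: "distinct_halves ((h, a) # R) \<and> halves ((h, a) # R) = halves \<mu> \<and> par \<mu> h = a"
  proof (use m in \<open>elim disjE\<close>)
    assume m: "mset \<mu> = mset ((h, a) # R)"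
    show ?thesis using distinct_halves_mset[OF m] halves_mset[OF m] par_sg_mset(1)[OF d m, of h] d by simp
  next
    assume m: "mset \<mu> = mset ((a, h) # R)"
    show ?thesis using distinct_halves_mset[OF m] halves_mset[OF m] par_sg_mset(1)[OF d m, of h] d
      by (simp add: insert_commute split: if_splits)
  qed
  have "k \<in> halves R" using hk da by auto
  then show "P ((h, a) # R)"
  proof (rule one_front)
    fix \<nu> \<nu>' :: "('a \<times> 'a) list" assume "mset \<nu> = mset \<nu>'" "P ((h, a) # \<nu>)"
    then show "P ((h, a) # \<nu>')" using perm[of "(h, a) # \<nu>" "(h, a) # \<nu>'"] by simp
  next
    fix c b \<nu> assume "P ((h, a) # (c, b) # \<nu>)"
    then have "P ((c, b) # (h, a) # \<nu>)" using perm[of "(h, a) # (c, b) # \<nu>" "(c, b) # (h, a) # \<nu>"] by simp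
    from rev[OF this] show "P ((h, a) # (b, c) # \<nu>)"
      using perm[of "(b, c) # (h, a) # \<nu>" "(h, a) # (b, c) # \<nu>"] by simp
  next
    fix b R' assume "mset R = mset ((k, b) # R') \<or> mset R = mset ((b, k) # R')"
    then have db: "distinct_halves ((b, k) # R') \<and> halves ((b, k) # R') = halves R"
    proof (elim disjE)
      assume m: "mset R = mset ((k, b) # R')"
      show ?thesis using distinct_halves_mset[OF m] halves_mset[OF m] da by (auto simp: insert_commute)
    next
      assume m: "mset R = mset ((b, k) # R')"
      show ?thesis using distinct_halves_mset[OF m] halves_mset[OF m] da by auto
    qed
    with da have "P ((h, a) # (b, k) # R')" by (intro main) auto
    then have "P ((b, k) # (h, a) # R')"
      using perm[of "(h, a) # (b, k) # R'" "(b, k) # (h, a) # R'"] by simp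
    from rev[OF this] show "P ((h, a) # (k, b) # R')"
      using perm[of "(k, b) # (h, a) # R'" "(h, a) # (k, b) # R'"] by simp
  qed
qed

text \<open>An edge either is cut, and then its arrow leaves no trace in the new list, or survives
  with its arrow.\<close>

lemma rewire_rev:
  assumes "distinct_halves ((a, b) # \<mu>)"
  shows "a = h \<or> a = k \<or> b = h \<or> b = k \<Longrightarrow> rewire ((b, a) # \<mu>) h k = rewire ((a, b) # \<mu>) h k"
    and "\<not> (a = h \<or> a = k \<or> b = h \<or> b = k) \<Longrightarrow>
      rewire ((a, b) # \<mu>) h k = (par \<mu> k, par \<mu> h) # (a, b) # filter (untouched h k) \<mu> \<and>
      rewire ((b, a) # \<mu>) h k = (par \<mu> k, par \<mu> h) # (b, a) # filter (untouched h k) \<mu>"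
  using assms by (auto simp: rewire_def untouched_def)

lemma filter_untouched: "h \<notin> halves \<mu> \<Longrightarrow> k \<notin> halves \<mu> \<Longrightarrow> filter (untouched h k) \<mu> = \<mu>"
  by (auto simp: untouched_def halves_def filter_id_conv)

lemma distinct_halves_rewire:
  assumes "distinct_halves \<mu>" "h \<in> halves \<mu>" "k \<in> halves \<mu>" "h \<noteq> k" "par \<mu> h \<noteq> k"
  shows "distinct_halves (rewire \<mu> h k)" "halves (rewire \<mu> h k) = halves \<mu> - {h, k}"
proof -
  have "distinct_halves \<mu> \<longrightarrow> distinct_halves (rewire \<mu> h k) \<and> halves (rewire \<mu> h k) = halves \<mu> - {h, k}"
    using assms
  proof (rule two_front)
    fix \<nu> \<nu>' :: "('a \<times> 'a) list" assume m: "mset \<nu> = mset \<nu>'"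
      and P: "distinct_halves \<nu> \<longrightarrow> distinct_halves (rewire \<nu> h k) \<and> halves (rewire \<nu> h k) = halves \<nu> - {h, k}"
    show "distinct_halves \<nu>' \<longrightarrow> distinct_halves (rewire \<nu>' h k) \<and> halves (rewire \<nu>' h k) = halves \<nu>' - {h, k}"
      using P distinct_halves_mset[OF m] halves_mset[OF m] distinct_halves_mset[OF rewire_mset[OF _ m, of h k]]
        halves_mset[OF rewire_mset[OF _ m, of h k]] by auto
  next
    fix a b and \<nu> :: "('a \<times> 'a) list"
    assume P: "distinct_halves ((a, b) # \<nu>) \<longrightarrow> distinct_halves (rewire ((a, b) # \<nu>) h k)
        \<and> halves (rewire ((a, b) # \<nu>) h k) = halves ((a, b) # \<nu>) - {h, k}"
    show "distinct_halves ((b, a) # \<nu>) \<longrightarrow> distinct_halves (rewire ((b, a) # \<nu>) h k)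
        \<and> halves (rewire ((b, a) # \<nu>) h k) = halves ((b, a) # \<nu>) - {h, k}"
    proof
      assume "distinct_halves ((b, a) # \<nu>)"
      then have d: "distinct_halves ((a, b) # \<nu>)" by auto
      show "distinct_halves (rewire ((b, a) # \<nu>) h k)
        \<and> halves (rewire ((b, a) # \<nu>) h k) = halves ((b, a) # \<nu>) - {h, k}"
      proof (cases "a = h \<or> a = k \<or> b = h \<or> b = k")
        case True
        then show ?thesis using P rewire_rev(1)[OF d True] d by (simp add: insert_commute)
      next
        case False
        show ?thesis using P d unfolding rewire_rev(2)[OF d False, THEN conjunct1] rewire_rev(2)[OF d False, THEN conjunct2]
          by (auto simp: insert_commute)
      qed
    qed
  next
    fix a b R assume "distinct_halves ((h, a) # (b, k) # R)"
    then show "distinct_halves ((h, a) # (b, k) # R) \<longrightarrow> distinct_halves (rewire ((h, a) # (b, k) # R) h k) \<and>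
       halves (rewire ((h, a) # (b, k) # R) h k) = halves ((h, a) # (b, k) # R) - {h, k}"
      by (auto simp: rewire_def untouched_def filter_untouched)
  qed
  then show "distinct_halves (rewire \<mu> h k)" "halves (rewire \<mu> h k) = halves \<mu> - {h, k}" using assms(1) by auto
qed

definition merge :: "nat \<Rightarrow> nat \<Rightarrow> nat \<Rightarrow> nat" where
  "merge x y z = (if z = y then x else z)"

text \<open>These are the pairs for which \<open>X\<^sub>h\<^sub>k\<close> can be non-zero;
  \<open>v h \<noteq> v k\<close> also rules out \<open>h = k\<close>.\<close>

definition cuttable :: "('h \<Rightarrow> nat) \<Rightarrow> ('h \<times> 'h) list \<Rightarrow> 'h \<Rightarrow> 'h \<Rightarrow> bool" where
  "cuttable v \<mu> h k \<longleftrightarrow> h \<in> halves \<mu> \<and> k \<in> halves \<mu> \<and> v h \<noteq> v k \<and> par \<mu> h \<noteq> k"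

text \<open>
  Making \<open>h\<close> initial and \<open>k\<close> terminal costs the sign \<open>- sg \<mu> h * sg \<mu> k\<close>. Collapsing an edge from \<open>x\<close>
  to \<open>y\<close> turns the vertex ordering \<open>x, y, \<dots>\<close> into \<open>x, \<dots>\<close>, so deleting \<open>y\<close> from position \<open>i\<close>,
  counted from 0, costs \<open>- (-1)\<^sup>i\<close>.
\<close>

definition glue ::
    "'h \<Rightarrow> 'h \<Rightarrow> (nat list \<Rightarrow> ('h \<Rightarrow> nat) \<Rightarrow> ('h \<times> 'h) list \<Rightarrow> ('c::signed_set, 'k::field) svec)
      \<Rightarrow> nat list \<Rightarrow> ('h \<Rightarrow> nat) \<Rightarrow> ('h \<times> 'h) list \<Rightarrow> ('c, 'k) svec" where
  "glue h k \<Phi> vs v \<mu> =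
     (if cuttable v \<mu> h k
      then (sg \<mu> h * sg \<mu> k * (-1) ^ pos vs (v k)) *\<^sub>v
        \<Phi> (remove1 (v k) vs) (merge (v h) (v k) \<circ> v) (rewire \<mu> h k)
      else 0)"

text \<open>The delicate point is the valence of the merged vertex: each of the two old vertices has
  at least 3 half-edges, and only \<open>h\<close> and \<open>k\<close> disappear, so at least 4
  remain.\<close>

lemma ok_glue:
  assumes ok: "ok vs v \<mu>" and c: "cuttable v \<mu> h k"
  shows "ok (remove1 (v k) vs) (merge (v h) (v k) \<circ> v) (rewire \<mu> h k)"
proof -
  note d = ok_D[OF ok]
  have hk: "h \<in> halves \<mu>" "k \<in> halves \<mu>" "v h \<noteq> v k" "h \<noteq> k" "par \<mu> h \<noteq> k"
    using c by (auto simp: cuttable_def)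
  note rewire = distinct_halves_rewire[OF d(2) hk(1,2,4,5)]
  have "3 \<le> card {g \<in> halves \<mu> - {h, k}. merge (v h) (v k) (v g) = z}" if z: "z \<in> set vs" "z \<noteq> v k" for z
  proof (cases "z = v h")
    case False
    then have "{g \<in> halves \<mu> - {h, k}. merge (v h) (v k) (v g) = z} = {g \<in> halves \<mu>. v g = z}"
      using z by (auto simp: merge_def)
    then show ?thesis using d(4)[OF z(1)] by simp
  next
    case True
    let ?A = "{g \<in> halves \<mu>. v g = v h}" and ?B = "{g \<in> halves \<mu>. v g = v k}"
    have "{g \<in> halves \<mu> - {h, k}. merge (v h) (v k) (v g) = z} = (?A \<union> ?B) - {h, k}"
      using True z by (auto simp: merge_def)
    moreover have "card (?A \<union> ?B) = card ?A + card ?B"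
      using hk by (intro card_Un_disjoint) auto
    moreover have "card (?A \<union> ?B) - card {h, k} \<le> card ((?A \<union> ?B) - {h, k})"
      by (rule diff_card_le_card_Diff) simp
    ultimately show ?thesis using d(4)[OF d(3)[OF hk(1)]] d(4)[OF d(3)[OF hk(2)]] hk(4) by simp
  qed
  moreover have "(merge (v h) (v k) \<circ> v) ` (halves \<mu> - {h, k}) \<subseteq> set vs - {v k}"
    using d(3) hk by (auto simp: merge_def)
  ultimately show ?thesis using d(1) rewire by (auto simp: ok_def set_remove1_eq)
qed

lemma cuttable_cong:
  "(\<And>g. g \<in> halves \<mu> \<Longrightarrow> v g = v' g) \<Longrightarrow> cuttable v' \<mu> h k = cuttable v \<mu> h k"
  by (auto simp: cuttable_def)

lemma cuttable_mset:
  "distinct_halves \<mu> \<Longrightarrow> mset \<mu>' = mset \<mu> \<Longrightarrow> cuttable v \<mu>' h k = cuttable v \<mu> h k"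
  using halves_mset[of \<mu> \<mu>'] par_sg_mset(1)[of \<mu> \<mu>'] by (auto simp: cuttable_def)

lemma cuttable_rev:
  "distinct_halves ((a, b) # \<mu>) \<Longrightarrow> cuttable v ((b, a) # \<mu>) h k = cuttable v ((a, b) # \<mu>) h k"
  by (auto simp: cuttable_def)

text \<open>Each change of sign is produced either by the coefficient or by \<open>\<Phi>\<close>,
  never by both. Switching two vertices changes the position of the deleted vertex if it is one of
  them, and otherwise switches entries of the remaining list. Reversing an edge changes a factor
  \<open>sg\<close> if the edge is cut, and otherwise reverses a surviving edge.\<close>

lemma good_glue:
  fixes \<Phi> :: "nat list \<Rightarrow> ('h \<Rightarrow> nat) \<Rightarrow> ('h \<times> 'h) list \<Rightarrow> ('c::signed_set, 'k::field) svec"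
  assumes g: "good C \<Phi>"
  shows "good C (glue h k \<Phi>)"
proof (rule goodI)
  fix vs and v v' :: "'h \<Rightarrow> nat" and \<mu>
  assume ok: "ok vs v \<mu>" and eq: "\<And>h. h \<in> halves \<mu> \<Longrightarrow> v h = v' h"
  show "glue h k \<Phi> vs v' \<mu> = glue h k \<Phi> vs v \<mu>"
  proof (cases "cuttable v \<mu> h k")
    case True
    then have hk: "v' h = v h" "v' k = v k" using eq by (auto simp: cuttable_def)
    have "halves (rewire \<mu> h k) \<subseteq> halves \<mu>"
      using True by (subst distinct_halves_rewire(2)[OF ok_D(2)[OF ok]]) (auto simp: cuttable_def)
    then have "\<Phi> (remove1 (v k) vs) (merge (v h) (v k) \<circ> v') (rewire \<mu> h k)
       = \<Phi> (remove1 (v k) vs) (merge (v h) (v k) \<circ> v) (rewire \<mu> h k)"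
      using eq by (intro good_cong[OF g ok_glue[OF ok True]]) auto
    then show ?thesis using cuttable_cong[of \<mu> v v' h k] eq hk by (simp add: glue_def)
  qed (simp add: glue_def cuttable_cong[OF eq])
next
  fix xs a b ys and v :: "'h \<Rightarrow> nat" and \<mu>
  assume ok: "ok (xs @ a # b # ys) v \<mu>"
  note d = ok_D(1)[OF ok]
  show "glue h k \<Phi> (xs @ b # a # ys) v \<mu> = - glue h k \<Phi> (xs @ a # b # ys) v \<mu>"
  proof (cases "cuttable v \<mu> h k")
    case True
    note ok' = ok_glue[OF ok True]
    have k: "v k \<in> set (xs @ a # b # ys)" using True ok_D(3)[OF ok, of k] by (simp add: cuttable_def)
    then consider "v k = a" | "v k = b" | us ws where "xs = us @ v k # ws" | us ws where "ys = us @ v k # ws"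
      by (auto dest: split_list)
    then show ?thesis
    proof cases
      case (3 us ws)
      then have n: "v k \<notin> set us" "v k \<noteq> a" "v k \<noteq> b" using d by auto
      show ?thesis
        using True good_swap[OF g ok', of "us @ ws" a b ys] n
        by (simp add: glue_def 3 pos_append remove1_append svec.scale_minus_right)
    next
      case (4 us ws)
      then have n: "v k \<notin> set us" "v k \<notin> set xs" "v k \<noteq> a" "v k \<noteq> b" using d by auto
      show ?thesis
        using True good_swap[OF g ok', of xs a b "us @ ws"] n
        by (simp add: glue_def 4 pos_append remove1_append svec.scale_minus_right)
    qed (use True d in \<open>auto simp: glue_def pos_append remove1_append svec.scale_minus_left\<close>)
  qed (simp add: glue_def)
next
  fix vs and v :: "'h \<Rightarrow> nat" and \<mu> \<mu>'
  assume ok: "ok vs v \<mu>" and m: "mset \<mu>' = mset \<mu>"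
  note d = ok_D(2)[OF ok]
  show "glue h k \<Phi> vs v \<mu>' = glue h k \<Phi> vs v \<mu>"
  proof (cases "cuttable v \<mu> h k")
    case True
    have "\<Phi> (remove1 (v k) vs) (merge (v h) (v k) \<circ> v) (rewire \<mu>' h k)
        = \<Phi> (remove1 (v k) vs) (merge (v h) (v k) \<circ> v) (rewire \<mu> h k)"
      by (rule good_mset[OF g ok_glue[OF ok True] rewire_mset[OF d m[symmetric]]])
    then show ?thesis by (simp add: glue_def cuttable_mset[OF d m] par_sg_mset(2)[OF d m[symmetric]])
  qed (simp add: glue_def cuttable_mset[OF d m])
next
  fix vs and v :: "'h \<Rightarrow> nat" and a b \<nu>
  assume ok: "ok vs v ((a, b) # \<nu>)"
  note d = ok_D(2)[OF ok]
  show "glue h k \<Phi> vs v ((b, a) # \<nu>) = - glue h k \<Phi> vs v ((a, b) # \<nu>)"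
  proof (cases "cuttable v ((a, b) # \<nu>) h k")
    case T: True
    note ok' = ok_glue[OF ok T]
    show ?thesis
    proof (cases "a = h \<or> a = k \<or> b = h \<or> b = k")
      case True
      \<comment> \<open>Exactly one of \<open>h, k\<close> lies on this edge, because
        \<open>cuttable\<close> excludes complementary half-edges; so exactly one factor changes
        sign.\<close>
      have "(sg ((b, a) # \<nu>) h * sg ((b, a) # \<nu>) k :: 'k) = - (sg ((a, b) # \<nu>) h * sg ((a, b) # \<nu>) k)"
        using True T d by (auto simp: cuttable_def)
      then show ?thesis
        using cuttable_rev[OF d, of v h k] rewire_rev(1)[OF d True] by (simp add: glue_def svec.scale_minus_left del: sg.simps)
    next
      case False
      have m: "mset ((a, b) # (par \<nu> k, par \<nu> h) # filter (untouched h k) \<nu>) = mset (rewire ((a, b) # \<nu>) h k)"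
        and m': "mset (rewire ((b, a) # \<nu>) h k) = mset ((b, a) # (par \<nu> k, par \<nu> h) # filter (untouched h k) \<nu>)"
        using rewire_rev(2)[OF d False] by auto
      note ok'' = ok_mset[OF ok' m[symmetric]]
      have "\<Phi> (remove1 (v k) vs) (merge (v h) (v k) \<circ> v) (rewire ((b, a) # \<nu>) h k)
         = - \<Phi> (remove1 (v k) vs) (merge (v h) (v k) \<circ> v) (rewire ((a, b) # \<nu>) h k)"
        using good_mset[OF g ok' m] good_rev[OF g ok'' refl] good_mset[OF g ok_rev[OF ok''] m'] by simp
      moreover have "(sg ((b, a) # \<nu>) h * sg ((b, a) # \<nu>) k :: 'k) = sg ((a, b) # \<nu>) h * sg ((a, b) # \<nu>) k"
        using False by auto
      ultimately show ?thesis
        using cuttable_rev[OF d, of v h k] by (simp add: glue_def svec.scale_minus_right del: sg.simps)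
    qed
  qed (simp add: glue_def cuttable_rev[OF d])
next
  fix vs and v :: "'h \<Rightarrow> nat" and \<mu> and \<rho> :: "nat \<Rightarrow> nat"
  assume ok: "ok vs v \<mu>" and inj: "inj_on \<rho> (set vs)"
    and C: "\<And>S x. S \<in> C \<Longrightarrow> x \<in> set vs \<Longrightarrow> \<rho> x \<in> S \<longleftrightarrow> x \<in> S"
  note d = ok_D[OF ok]
  have c: "cuttable (\<rho> \<circ> v) \<mu> h k = cuttable v \<mu> h k"
    using d(3) inj by (auto simp: cuttable_def inj_on_eq_iff)
  show "glue h k \<Phi> (map \<rho> vs) (\<rho> \<circ> v) \<mu> = glue h k \<Phi> vs v \<mu>"
  proof (cases "cuttable v \<mu> h k")
    case True
    note ok' = ok_glue[OF ok True]
    have hk: "v h \<in> set vs" "v k \<in> set vs" using True d(3) by (auto simp: cuttable_def)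
    have r: "remove1 (\<rho> (v k)) (map \<rho> vs) = map \<rho> (remove1 (v k) vs)"
      using inj hk(2) d(1)
    proof (induction vs)
      case (Cons x vs) then show ?case by (auto simp: inj_on_def remove1_idem image_iff)
    qed simp
    have "\<Phi> (map \<rho> (remove1 (v k) vs)) (\<rho> \<circ> (merge (v h) (v k) \<circ> v)) (rewire \<mu> h k)
      = \<Phi> (remove1 (v k) vs) (merge (v h) (v k) \<circ> v) (rewire \<mu> h k)"
      using C inj d(1) by (intro good_rename[OF g ok']) (auto intro: inj_on_subset)
    moreover have "\<Phi> (map \<rho> (remove1 (v k) vs)) (merge (\<rho> (v h)) (\<rho> (v k)) \<circ> (\<rho> \<circ> v)) (rewire \<mu> h k)
      = \<Phi> (map \<rho> (remove1 (v k) vs)) (\<rho> \<circ> (merge (v h) (v k) \<circ> v)) (rewire \<mu> h k)"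
    proof (rule good_cong[OF g ok_rename[OF ok']])
      show "inj_on \<rho> (set (remove1 (v k) vs))" using inj d(1) by (auto intro: inj_on_subset)
      fix g assume "g \<in> halves (rewire \<mu> h k)"
      then have "g \<in> halves \<mu>"
        using True by (subst (asm) distinct_halves_rewire(2)[OF d(2)]) (auto simp: cuttable_def)
      then show "(\<rho> \<circ> (merge (v h) (v k) \<circ> v)) g = (merge (\<rho> (v h)) (\<rho> (v k)) \<circ> (\<rho> \<circ> v)) g"
        using inj hk d(3) by (auto simp: merge_def inj_on_eq_iff)
    qed
    moreover have "pos (map \<rho> vs) (\<rho> (v k)) = pos vs (v k)"
      using inj hk by (simp add: pos_map insert_absorb)
    ultimately show ?thesis using c r True by (simp add: glue_def)
  qed (simp add: glue_def c)
qed

text \<open>Two signs cancel. With the two vertices in front, deleting the vertex of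
  \<open>h\<close> instead of that of \<open>k\<close> changes the position by one; and the
  surviving new edge is reversed. The hypothesis on \<open>C\<close> makes renaming the surviving
  vertex admissible.\<close>

lemma glue_sym:
  assumes g: "good C \<Phi>" and ok: "ok vs v \<mu>"
    and C: "\<And>S. S \<in> C \<Longrightarrow> v h \<in> S \<longleftrightarrow> v k \<in> S"
  shows "glue h k \<Phi> vs v \<mu> = glue k h \<Phi> vs v \<mu>"
proof -
  note d = ok_D[OF ok]
  have c: "cuttable v \<mu> h k = cuttable v \<mu> k h"
    using par_par[OF d(2)] by (auto simp: cuttable_def)
  show ?thesis
  proof (cases "cuttable v \<mu> h k")
    case True
    then have hk: "v h \<in> set vs" "v k \<in> set vs" "v h \<noteq> v k" using d(3) by (auto simp: cuttable_def)
    define zs where "zs = filter (\<lambda>x. x \<noteq> v h \<and> x \<noteq> v k) vs"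
    define ws where "ws = v h # v k # zs"
    have ws: "distinct ws" "set ws = set vs" using hk d(1) by (auto simp: ws_def zs_def)
    note okw = ok_perm[OF ok ws]
    show ?thesis
    proof (rule good_eq_perm[OF good_glue[OF g] good_glue[OF g] ok ws])
      have T': "cuttable v \<mu> k h" using True c by simp
      note ok1 = ok_glue[OF okw True] and ok2 = ok_glue[OF okw T']
      have r: "remove1 (v k) ws = v h # zs" "remove1 (v h) ws = v k # zs"
        using hk by (auto simp: ws_def)
      have rk: "rewire \<mu> k h = (par \<mu> h, par \<mu> k) # filter (untouched h k) \<mu>"
      proof -
        have "untouched k h = untouched h k" by (auto simp: untouched_def)
        then show ?thesis by (simp add: rewire_def)
      qed
      \<comment> \<open>Read as a renaming, \<open>merge (v h) (v k)\<close> carries the survivor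
        \<open>v k\<close> of one gluing to the survivor \<open>v h\<close> of the other.\<close>
      have m: "map (merge (v h) (v k)) (v k # zs) = v h # zs"
        by (auto simp: merge_def zs_def intro!: map_idI)
      have "\<Phi> (v k # zs) (merge (v k) (v h) \<circ> v) (rewire \<mu> k h)
          = \<Phi> (map (merge (v h) (v k)) (v k # zs)) (merge (v h) (v k) \<circ> (merge (v k) (v h) \<circ> v)) (rewire \<mu> k h)"
        by (rule good_rename[OF g ok2[unfolded r], symmetric])
          (use C in \<open>auto simp: merge_def inj_on_def zs_def\<close>)
      also have "merge (v h) (v k) \<circ> (merge (v k) (v h) \<circ> v) = merge (v h) (v k) \<circ> v"
        by (auto simp: merge_def)
      also have "\<Phi> (map (merge (v h) (v k)) (v k # zs)) (merge (v h) (v k) \<circ> v) (rewire \<mu> k h)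
          = - \<Phi> (v h # zs) (merge (v h) (v k) \<circ> v) (rewire \<mu> h k)"
        using good_rev[OF g ok1, of "par \<mu> k" "par \<mu> h"] unfolding m r rk by (simp add: rewire_def)
      finally have "\<Phi> (v k # zs) (merge (v k) (v h) \<circ> v) (rewire \<mu> k h)
          = - \<Phi> (v h # zs) (merge (v h) (v k) \<circ> v) (rewire \<mu> h k)" .
      moreover have "pos ws (v k) = 1" "pos ws (v h) = 0" using hk by (auto simp: ws_def)
      ultimately show "glue h k \<Phi> ws v \<mu> = glue k h \<Phi> ws v \<mu>"
        using True T' r by (simp add: glue_def mult.commute svec.scale_minus_left svec.scale_minus_right)
    qed
  qed (use c in \<open>simp add: glue_def\<close>)
qed

section \<open>Anticommutation of two gluings\<close>

lemma merge_neq [simp]: "z \<noteq> y \<Longrightarrow> merge x y z = z"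
  by (simp add: merge_def)

text \<open>The deleted vertices \<open>v k\<close> and \<open>v q\<close> each belong to only one
  of the two pairs, so either can be deleted first. From the front of the list they are deleted at
  positions 0, 0 in one order and 1, 0 in the other; this is the minus sign. What remains is to
  compare half-edge signs and resulting edges, which depends on the edges common to both
  pairs.\<close>

lemma glue_glue_front:
  assumes g: "good C \<Phi>" and ok: "ok (v k # v q # zs) v \<mu>"
    and leaf: "v k \<noteq> v h" "v k \<noteq> v p" "v q \<noteq> v p" "v q \<noteq> v h"
    and mu: "h \<in> halves \<mu>" "k \<in> halves \<mu>" "par \<mu> h \<noteq> k" "p \<in> halves \<mu>" "q \<in> halves \<mu>" "par \<mu> p \<noteq> q"
    and ph: "p \<noteq> h"
  shows "glue h k (glue p q \<Phi>) (v k # v q # zs) v \<mu> = - glue p q (glue h k \<Phi>) (v k # v q # zs) v \<mu>"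
proof -
  define vs where "vs = v k # v q # zs"
  note okv = ok[folded vs_def]
  have kq: "v k \<noteq> v q" using ok_D(1)[OF ok] by simp
  define w where "w = merge (v h) (v k) \<circ> (merge (v p) (v q) \<circ> v)"
  have w': "merge (v p) (v q) \<circ> (merge (v h) (v k) \<circ> v) = w"
    using leaf kq by (auto simp: w_def merge_def)
  have ne: "h \<noteq> k" "h \<noteq> p" "h \<noteq> q" "k \<noteq> p" "k \<noteq> q" "p \<noteq> q" using leaf kq ph by auto
  \<comment> \<open>Closed forms of the two sides: after both merges the vertices are
    \<open>zs\<close> and the incidence map is \<open>w\<close>, whichever operation comes
    first.\<close>
  have L: "glue h k (glue p q \<Phi>) vs v \<nu>
      = (if p \<in> halves (rewire \<nu> h k) \<and> q \<in> halves (rewire \<nu> h k) \<and> par (rewire \<nu> h k) p \<noteq> q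
         then (sg \<nu> h * sg \<nu> k * sg (rewire \<nu> h k) p * sg (rewire \<nu> h k) q) *\<^sub>v
           \<Phi> zs w (rewire (rewire \<nu> h k) p q) else 0)"
    if "h \<in> halves \<nu>" "k \<in> halves \<nu>" "par \<nu> h \<noteq> k" for \<nu>
    using that leaf kq w' by (simp add: glue_def cuttable_def vs_def mult.assoc)
  have R: "glue p q (glue h k \<Phi>) vs v \<nu>
      = (if h \<in> halves (rewire \<nu> p q) \<and> k \<in> halves (rewire \<nu> p q) \<and> par (rewire \<nu> p q) h \<noteq> k
         then - ((sg \<nu> p * sg \<nu> q * sg (rewire \<nu> p q) h * sg (rewire \<nu> p q) k) *\<^sub>v
           \<Phi> zs w (rewire (rewire \<nu> p q) h k)) else 0)"
    if "p \<in> halves \<nu>" "q \<in> halves \<nu>" "par \<nu> p \<noteq> q" for \<nu>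
    using that leaf kq by (simp add: glue_def cuttable_def vs_def mult.assoc svec.scale_minus_left flip: w_def)
  have ok': "ok zs w (rewire (rewire \<nu> h k) p q)"
    if "ok vs v \<nu>" "h \<in> halves \<nu>" "k \<in> halves \<nu>" "par \<nu> h \<noteq> k"
      "p \<in> halves (rewire \<nu> h k)" "q \<in> halves (rewire \<nu> h k)" "par (rewire \<nu> h k) p \<noteq> q" for \<nu>
  proof -
    have "cuttable v \<nu> h k" using that leaf by (simp add: cuttable_def)
    from ok_glue[OF that(1) this] have "ok (v q # zs) (merge (v h) (v k) \<circ> v) (rewire \<nu> h k)"
      by (simp add: vs_def)
    from ok_glue[OF this, of p q] show ?thesis using that leaf kq w' by (simp add: cuttable_def)
  qed
  \<comment> \<open>Stated for every edge list, so that \<open>two_front\<close> can fix the edges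
    of \<open>h, k\<close> and then act once more on the tail for \<open>p, q\<close>.\<close>
  define G where "G \<nu> \<longleftrightarrow> (ok vs v \<nu> \<longrightarrow> par \<nu> p \<noteq> q \<longrightarrow>
    glue h k (glue p q \<Phi>) vs v \<nu> = - glue p q (glue h k \<Phi>) vs v \<nu>)" for \<nu>
  have perm: "G \<nu>'" if m: "mset \<nu> = mset \<nu>'" and G: "G \<nu>" for \<nu> \<nu>'
    unfolding G_def
  proof (intro impI)
    assume "ok vs v \<nu>'" and pq: "par \<nu>' p \<noteq> q"
    note ok' = ok_mset[OF this(1) m[symmetric]]
    show "glue h k (glue p q \<Phi>) vs v \<nu>' = - glue p q (glue h k \<Phi>) vs v \<nu>'"
      using good_mset[OF good_glue[OF good_glue[OF g]] ok' m[symmetric]] G ok' pq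
        par_sg_mset(1)[OF ok_D(2)[OF ok'] m] by (simp add: G_def)
  qed
  have rev: "G ((b, a) # \<nu>)" if G: "G ((a, b) # \<nu>)" for a b \<nu>
    unfolding G_def
  proof (intro impI)
    assume "ok vs v ((b, a) # \<nu>)" and pq: "par ((b, a) # \<nu>) p \<noteq> q"
    note ok' = ok_rev[OF this(1)]
    show "glue h k (glue p q \<Phi>) vs v ((b, a) # \<nu>) = - glue p q (glue h k \<Phi>) vs v ((b, a) # \<nu>)"
      using good_rev[OF good_glue[OF good_glue[OF g]] ok' refl] G ok' pq ok_D(2)[OF ok']
      by (simp add: G_def split: if_splits)
  qed
  have "G \<mu>" using ok_D(2)[OF ok] mu(1,2) ne(1) mu(3) perm rev
  proof (rule two_front)
    fix a b R
    assume D: "distinct_halves ((h, a) # (b, k) # R)" and H: "halves ((h, a) # (b, k) # R) = halves \<mu>"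
    let ?\<nu> = "(h, a) # (b, k) # R"
    have perm2: "G ((h, a) # (b, k) # \<nu>')" if "mset \<nu> = mset \<nu>'" "G ((h, a) # (b, k) # \<nu>)" for \<nu> \<nu>'
      using perm[OF _ that(2), of "(h, a) # (b, k) # \<nu>'"] that(1) by simp
    have rev2: "G ((h, a) # (b, k) # (d, c) # \<nu>)" if "G ((h, a) # (b, k) # (c, d) # \<nu>)" for c d \<nu>
    proof -
      have "G ((c, d) # (h, a) # (b, k) # \<nu>)" by (rule perm[OF _ that]) simp
      from rev[OF this] show ?thesis by (rule perm[rotated]) simp
    qed
    have pR: "p = a \<or> p = b \<or> p \<in> halves R" and qR: "q = a \<or> q = b \<or> q \<in> halves R"
      using H mu(4,5) ne by auto
    note simps = rewire_def untouched_def filter_untouched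
    \<comment> \<open>Here \<open>p\<close> is complementary to \<open>h\<close> or
      \<open>k\<close>. For \<open>p = a\<close> the surviving edge is \<open>(d, b)\<close> in one
      order and \<open>(b, d)\<close> in the other, but in the second order \<open>h\<close> has
      become terminal, and the two signs cancel. For \<open>p = b\<close> both orders give
      \<open>(d, a)\<close> with the same half-edge signs.\<close>
    have special: "G ((h, a) # (b, k) # (q, d) # R')" if "p = a \<or> p = b" for d R'
      unfolding G_def
    proof (intro impI)
      let ?\<mu> = "(h, a) # (b, k) # (q, d) # R'"
      assume o: "ok vs v ?\<mu>"
      note D' = ok_D(2)[OF o]
      show "glue h k (glue p q \<Phi>) vs v ?\<mu> = - glue p q (glue h k \<Phi>) vs v ?\<mu>"
      proof (cases "p = a")
        case True
        have "ok zs w ((d, b) # R')" using ok'[OF o] D' ne True by (auto simp: simps)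
        note sgn = good_rev[OF g this refl]
        have c: "h \<in> halves ?\<mu>" "k \<in> halves ?\<mu>" "par ?\<mu> h \<noteq> k" "p \<in> halves ?\<mu>" "q \<in> halves ?\<mu>" "par ?\<mu> p \<noteq> q"
          using D' ne True by auto
        show ?thesis
          unfolding L[OF c(1-3)] R[OF c(4-6)] using sgn D' ne unfolding True by (auto simp: simps)
      next
        case False
        then have p: "p = b" using that by simp
        have "ok zs w ((d, a) # R')" using ok'[OF o] D' ne p by (auto simp: simps)
        note sgn = good_rev[OF g this refl]
        have c: "h \<in> halves ?\<mu>" "k \<in> halves ?\<mu>" "par ?\<mu> h \<noteq> k" "p \<in> halves ?\<mu>" "q \<in> halves ?\<mu>" "par ?\<mu> p \<noteq> q"
          using D' ne p by auto
        show ?thesis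
          unfolding L[OF c(1-3)] R[OF c(4-6)] using sgn D' ne unfolding p by (auto simp: simps)
      qed
    qed
    have special': "G ((h, a) # (b, k) # (p, d) # R')" if "q = a \<or> q = b" for d R'
      unfolding G_def
    proof (intro impI)
      let ?\<mu> = "(h, a) # (b, k) # (p, d) # R'"
      assume o: "ok vs v ?\<mu>"
      note D' = ok_D(2)[OF o]
      show "glue h k (glue p q \<Phi>) vs v ?\<mu> = - glue p q (glue h k \<Phi>) vs v ?\<mu>"
      proof (cases "q = a")
        case True
        have "ok zs w ((b, d) # R')" using ok'[OF o] D' ne True by (auto simp: simps)
        note sgn = good_rev[OF g this refl]
        have c: "h \<in> halves ?\<mu>" "k \<in> halves ?\<mu>" "par ?\<mu> h \<noteq> k" "p \<in> halves ?\<mu>" "q \<in> halves ?\<mu>" "par ?\<mu> p \<noteq> q"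
          using D' ne True by auto
        show ?thesis
          unfolding L[OF c(1-3)] R[OF c(4-6)] using sgn D' ne unfolding True by (auto simp: simps)
      next
        case False
        then have q: "q = b" using that by simp
        have "ok zs w ((a, d) # R')" using ok'[OF o] D' ne q by (auto simp: simps)
        note sgn = good_rev[OF g this refl]
        have c: "h \<in> halves ?\<mu>" "k \<in> halves ?\<mu>" "par ?\<mu> h \<noteq> k" "p \<in> halves ?\<mu>" "q \<in> halves ?\<mu>" "par ?\<mu> p \<noteq> q"
          using D' ne q by auto
        show ?thesis
          unfolding L[OF c(1-3)] R[OF c(4-6)] using sgn D' ne unfolding q by (auto simp: simps)
      qed
    qed
    have generic: "G ((h, a) # (b, k) # (p, c) # (d, q) # R')" for c d R'
      unfolding G_def
    proof (intro impI)
      let ?\<mu> = "(h, a) # (b, k) # (p, c) # (d, q) # R'"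
      assume o: "ok vs v ?\<mu>" and "par ?\<mu> p \<noteq> q"
      note D' = ok_D(2)[OF o]
      have c: "h \<in> halves ?\<mu>" "k \<in> halves ?\<mu>" "par ?\<mu> h \<noteq> k" "p \<in> halves ?\<mu>" "q \<in> halves ?\<mu>" "par ?\<mu> p \<noteq> q"
        using D' ne  by auto
      have rw: "rewire ?\<mu> h k = (b, a) # (p, c) # (d, q) # R'"
        "rewire ((b, a) # (p, c) # (d, q) # R') p q = (d, c) # (b, a) # R'"
        "rewire ?\<mu> p q = (d, c) # (h, a) # (b, k) # R'"
        "rewire ((d, c) # (h, a) # (b, k) # R') h k = (b, a) # (d, c) # R'"
        using D' ne by (auto simp: simps)
      have h: "sg ?\<mu> h = (1::'c)" "sg ?\<mu> k = (-1::'c)" "sg ((b, a) # (p, c) # (d, q) # R') p = (1::'c)"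
        "sg ((b, a) # (p, c) # (d, q) # R') q = (-1::'c)" "sg ?\<mu> p = (1::'c)" "sg ?\<mu> q = (-1::'c)"
        "sg ((d, c) # (h, a) # (b, k) # R') h = (1::'c)" "sg ((d, c) # (h, a) # (b, k) # R') k = (-1::'c)"
        "p \<in> halves ((b, a) # (p, c) # (d, q) # R') \<and> q \<in> halves ((b, a) # (p, c) # (d, q) # R')
          \<and> par ((b, a) # (p, c) # (d, q) # R') p \<noteq> q"
        "h \<in> halves ((d, c) # (h, a) # (b, k) # R') \<and> k \<in> halves ((d, c) # (h, a) # (b, k) # R')
          \<and> par ((d, c) # (h, a) # (b, k) # R') h \<noteq> k"
        using D' ne by auto
      have "ok zs w ((d, c) # (b, a) # R')" using ok'[OF o] c(1-3) unfolding rw using h by blast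
      from good_mset[OF g this, of "(b, a) # (d, c) # R'"]
      have sgn: "\<Phi> zs w ((b, a) # (d, c) # R') = \<Phi> zs w ((d, c) # (b, a) # R')" by simp
      show "glue h k (glue p q \<Phi>) vs v ?\<mu> = - glue p q (glue h k \<Phi>) vs v ?\<mu>"
        by (simp only: L[OF c(1-3)] R[OF c(4-6)] rw h if_True simp_thms) (simp add: sgn)
    qed
    consider "p = a \<and> q = b \<or> p = b \<and> q = a" | "p = a \<or> p = b" "q \<in> halves R" | "q = a \<or> q = b" "p \<in> halves R"
      | "p \<in> halves R" "q \<in> halves R" using pR qR ne by blast
    then show "G ?\<nu>"
    proof cases
      case 1
      have c: "h \<in> halves ?\<nu>" "k \<in> halves ?\<nu>" "par ?\<nu> h \<noteq> k" "p \<in> halves ?\<nu>" "q \<in> halves ?\<nu>" "par ?\<nu> p \<noteq> q"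
        using D ne 1 by auto
      \<comment> \<open>Each operation makes the other pair complementary, so both sides
        vanish.\<close>
      have "par (rewire ?\<nu> h k) p = q" "par (rewire ?\<nu> p q) h = k"
        using 1 D ne by (auto simp: simps)
      then show ?thesis
        unfolding G_def L[OF c(1-3)] R[OF c(4-6)] by (simp only: simp_thms if_False minus_zero)
    next
      case 2
      show ?thesis by (rule one_front[where P = "\<lambda>\<nu>. G ((h, a) # (b, k) # \<nu>)", OF 2(2) perm2 rev2 special[OF 2(1)]])
    next
      case 3
      show ?thesis by (rule one_front[where P = "\<lambda>\<nu>. G ((h, a) # (b, k) # \<nu>)", OF 3(2) perm2 rev2 special'[OF 3(1)]])
    next
      case 4
      show ?thesis
      proof (cases "par R p = q")
        case True
        then have "par ?\<nu> p = q" using 4 D by auto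
        then show ?thesis by (simp add: G_def)
      next
        case False
        have dR: "distinct_halves R" using D by simp
        show ?thesis
          by (rule two_front[where P = "\<lambda>\<nu>. G ((h, a) # (b, k) # \<nu>)", OF dR 4 ne(6) False perm2 rev2 generic])
      qed
    qed
  qed
  moreover have "par \<mu> p \<noteq> q" using mu by simp
  ultimately show ?thesis using okv by (simp add: G_def vs_def)
qed

text \<open>View \<open>{v h, v k}\<close> and \<open>{v p, v q}\<close> as two edges on the
  vertices. If they are distinct and not loops, each has an end that is not on the other;
  \<open>glue_sym\<close> lets this end be the deleted vertex, and \<open>glue_glue_front\<close>
  applies. In the other cases both sides vanish. The hypotheses on \<open>C\<close> are those that
  \<open>glue_sym\<close> demands.\<close>

theorem glue_glue:
  assumes g: "good C \<Phi>" and ok: "ok vs v \<mu>"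
    and C: "\<And>S. S \<in> C \<Longrightarrow> v h \<in> S \<longleftrightarrow> v k \<in> S" "\<And>S. S \<in> C \<Longrightarrow> v p \<in> S \<longleftrightarrow> v q \<in> S"
  shows "glue h k (glue p q \<Phi>) vs v \<mu> = - glue p q (glue h k \<Phi>) vs v \<mu>"
proof -
  note d = ok_D[OF ok]
  \<comment> \<open>In each of these cases the first gluing is not \<open>cuttable\<close>, or
    afterwards \<open>p, q\<close> are not both present, lie at one vertex, or are still
    complementary.\<close>
  have zero: "glue h k (glue p q \<Phi>) vs v \<mu> = 0"
    if "\<not> (h \<in> halves \<mu> \<and> k \<in> halves \<mu> \<and> par \<mu> h \<noteq> k \<and> p \<in> halves \<mu> \<and> q \<in> halves \<mu> \<and> par \<mu> p \<noteq> q
        \<and> p \<noteq> h) \<or> v h = v k \<or> v p = v q \<or> {v h, v k} = {v p, v q}" for h k p q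
  proof (cases "cuttable v \<mu> h k")
    case True
    note hk = True[unfolded cuttable_def]
    have "h \<noteq> k" using hk by auto
    note rw = distinct_halves_rewire[OF d(2), of h k] hk this
    have "\<not> cuttable (merge (v h) (v k) \<circ> v) (rewire \<mu> h k) p q"
    proof
      assume c: "cuttable (merge (v h) (v k) \<circ> v) (rewire \<mu> h k) p q"
      then have pq: "p \<in> halves \<mu>" "q \<in> halves \<mu>" "p \<noteq> h" "p \<noteq> k" "q \<noteq> h" "q \<noteq> k"
        using rw by (auto simp: cuttable_def)
      moreover have "par \<mu> p \<noteq> q"
      proof
        assume pq': "par \<mu> p = q"
        from pq(1) have "par (rewire \<mu> h k) p = q"
        proof (rule halvesE)
          fix a assume a: "(p, a) \<in> set \<mu>"
          then have "a = q" using par_sg_in(1)[OF d(2) a] pq' by simp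
          then have "(p, q) \<in> set (rewire \<mu> h k)" using a pq by (simp add: rewire_def untouched_def)
          then show ?thesis using par_sg_in(1)[of "rewire \<mu> h k" p q] rw by blast
        next
          fix a assume a: "(a, p) \<in> set \<mu>"
          then have "a = q" using par_sg_in(2)[OF d(2) a] pq' by simp
          then have "(q, p) \<in> set (rewire \<mu> h k)" using a pq by (simp add: rewire_def untouched_def)
          then show ?thesis using par_sg_in(2)[of "rewire \<mu> h k" q p] rw by blast
        qed
        then show False using c by (simp add: cuttable_def)
      qed
      ultimately show False using c hk that by (auto simp: cuttable_def merge_def doubleton_eq_iff split: if_splits)
    qed
    then show ?thesis by (simp add: glue_def)
  qed (simp add: glue_def)
  let ?L = "\<lambda>h k p q. glue h k (glue p q \<Phi>) vs v \<mu>"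
  have flip1: "?L h k p q = ?L k h p q" if "\<And>S. S \<in> C \<Longrightarrow> v h \<in> S \<longleftrightarrow> v k \<in> S" for h k p q
    by (rule glue_sym[OF good_glue[OF g] ok that])
  have flip2: "?L h k p q = ?L h k q p"
    if "\<And>S. S \<in> C \<Longrightarrow> v h \<in> S \<longleftrightarrow> v k \<in> S" "\<And>S. S \<in> C \<Longrightarrow> v p \<in> S \<longleftrightarrow> v q \<in> S" for h k p q
  proof (cases "cuttable v \<mu> h k")
    case True
    have "glue p q \<Phi> (remove1 (v k) vs) (merge (v h) (v k) \<circ> v) (rewire \<mu> h k)
        = glue q p \<Phi> (remove1 (v k) vs) (merge (v h) (v k) \<circ> v) (rewire \<mu> h k)"
      by (rule glue_sym[OF g ok_glue[OF ok True]]) (use that in \<open>auto simp: merge_def\<close>)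
    then show ?thesis by (simp add: glue_def)
  qed (simp add: glue_def)
  have leaf: "?L h k p q = - ?L p q h k"
    if "v k \<noteq> v h" "v k \<noteq> v p" "v q \<noteq> v p" "v q \<noteq> v h" "v k \<noteq> v q" for h k p q
  proof (cases "h \<in> halves \<mu> \<and> k \<in> halves \<mu> \<and> par \<mu> h \<noteq> k \<and> p \<in> halves \<mu> \<and> q \<in> halves \<mu> \<and> par \<mu> p \<noteq> q \<and> p \<noteq> h")
    case True
    define zs where "zs = filter (\<lambda>x. x \<noteq> v k \<and> x \<noteq> v q) vs"
    have ws: "distinct (v k # v q # zs)" "set (v k # v q # zs) = set vs"
      using True d(1) d(3)[of k] d(3)[of q] that by (auto simp: zs_def)
    show ?thesis
      by (rule good_eq_perm[OF good_glue[OF good_glue[OF g]] good_uminus[OF good_glue[OF good_glue[OF g]]] ok ws])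
        (use glue_glue_front[OF g ok_perm[OF ok ws]] that True in blast)
  next
    case False
    then have "?L h k p q = 0" "?L p q h k = 0" by (rule_tac zero; blast)+
    then show ?thesis by simp
  qed
  consider "v h = v k \<or> v p = v q \<or> {v h, v k} = {v p, v q}"
    | "v k \<noteq> v h" "v k \<noteq> v p" "v q \<noteq> v p" "v q \<noteq> v h" "v k \<noteq> v q"
    | "v h \<noteq> v k" "v h \<noteq> v p" "v q \<noteq> v p" "v q \<noteq> v k" "v h \<noteq> v q"
    | "v k \<noteq> v h" "v k \<noteq> v q" "v p \<noteq> v q" "v p \<noteq> v h" "v k \<noteq> v p"
    | "v h \<noteq> v k" "v h \<noteq> v q" "v p \<noteq> v q" "v p \<noteq> v k" "v h \<noteq> v p"
    unfolding doubleton_eq_iff by (smt (verit))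
  then show ?thesis
  proof cases
    case 1
    then have "?L h k p q = 0" "?L p q h k = 0" by (rule_tac zero; blast)+
    then show ?thesis by simp
  next
    case 2 show ?thesis by (rule leaf[OF 2])
  next
    case 3
    have "?L h k p q = ?L k h p q" by (rule flip1[OF C(1)])
    also have "\<dots> = - ?L p q k h" by (rule leaf[OF 3])
    also have "?L p q k h = ?L p q h k" by (rule flip2[OF C(2) C(1)[symmetric]])
    finally show ?thesis .
  next
    case 4
    have "?L h k p q = ?L h k q p" by (rule flip2[OF C(1) C(2)])
    also have "\<dots> = - ?L q p h k" by (rule leaf[OF 4])
    also have "?L q p h k = ?L p q h k" by (rule flip1[OF C(2)[symmetric]])
    finally show ?thesis .
  next
    case 5
    have "?L h k p q = ?L k h p q" by (rule flip1[OF C(1)])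
    also have "\<dots> = ?L k h q p" by (rule flip2[OF C(1)[symmetric] C(2)])
    also have "\<dots> = - ?L q p k h" by (rule leaf[OF 5])
    also have "?L q p k h = ?L p q k h" by (rule flip1[OF C(2)[symmetric]])
    also have "\<dots> = ?L p q h k" by (rule flip2[OF C(2) C(1)[symmetric]])
    finally show ?thesis .
  qed
qed

section \<open>The operator \<open>\<partial>\<^sub>H\<close> on marked graphs\<close>

text \<open>Ordered pairs avoid choosing an order on the names, but count each unordered pair twice.
  This is the origin of the factors 1/2 below and of the 1/4 in the co-Jacobi identity.\<close>

definition glue_sum ::
    "(nat list \<Rightarrow> ('h \<Rightarrow> nat) \<Rightarrow> ('h \<times> 'h) list \<Rightarrow> ('c::signed_set, 'k::field) svec)
      \<Rightarrow> nat list \<Rightarrow> ('h \<Rightarrow> nat) \<Rightarrow> ('h \<times> 'h) list \<Rightarrow> ('c, 'k) svec" where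
  "glue_sum \<Phi> vs v \<mu> = (\<Sum>h\<in>halves \<mu>. \<Sum>k\<in>halves \<mu>. glue h k \<Phi> vs v \<mu>)"

lemma good_glue_sum:
  assumes "good C \<Phi>"
  shows "good C (glue_sum \<Phi>)"
proof (rule goodI, goal_cases)
  case 1 then show ?case
    unfolding glue_sum_def by (intro sum.cong refl good_cong[OF good_glue[OF assms]])
next
  case 2 then show ?case
    unfolding glue_sum_def sum_negf[symmetric]
    by (intro sum.cong refl good_swap[OF good_glue[OF assms] _ refl])
next
  case (3 vs v \<mu> \<mu>') then show ?case
    unfolding glue_sum_def halves_mset[OF 3(2)]
    by (intro sum.cong refl good_mset[OF good_glue[OF assms]])
next
  case (4 vs v h k \<nu>)
  have "halves ((k, h) # \<nu>) = halves ((h, k) # \<nu>)" by auto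
  then show ?case
    unfolding glue_sum_def sum_negf[symmetric]
    by (intro sum.cong good_rev[OF good_glue[OF assms] 4 refl])
next
  case 5 then show ?case
    unfolding glue_sum_def by (intro sum.cong refl good_rename[OF good_glue[OF assms]])
qed

section \<open>Naturality under renaming of half-edges\<close>

lemma map_halves_cong:
  "(\<And>h. h \<in> halves \<mu> \<Longrightarrow> f h = g h) \<Longrightarrow> map (map_prod f f) \<mu> = map (map_prod g g) \<mu>"
  by (auto simp: halvesI)

lemma par_map:
  assumes "inj_on \<eta> (halves \<mu>)" "h \<in> halves \<mu>"
  shows "par (map (map_prod \<eta> \<eta>) \<mu>) (\<eta> h) = \<eta> (par \<mu> h)"
    and "sg (map (map_prod \<eta> \<eta>) \<mu>) (\<eta> h) = (sg \<mu> h :: 'k::field)"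
proof -
  have "par (map (map_prod \<eta> \<eta>) \<nu>) (\<eta> h) = \<eta> (par \<nu> h) \<and> sg (map (map_prod \<eta> \<eta>) \<nu>) (\<eta> h) = (sg \<nu> h :: 'k)"
    if "inj_on \<eta> (insert h (halves \<nu>))" for \<nu>
    using that
  proof (induction \<nu>)
    case (Cons e \<nu>)
    have "inj_on \<eta> (insert h (halves \<nu>))" using Cons.prems by (rule inj_on_subset) auto
    note IH = Cons.IH[OF this]
    have "(\<eta> h = \<eta> (fst e)) = (h = fst e)" "(\<eta> h = \<eta> (snd e)) = (h = snd e)"
      by (simp_all add: inj_on_eq_iff[OF Cons.prems])
    with IH show ?case by (simp only: list.map par.simps sg.simps fst_map_prod snd_map_prod if_distrib[of \<eta>])
  qed simp
  from this[of \<mu>] show "par (map (map_prod \<eta> \<eta>) \<mu>) (\<eta> h) = \<eta> (par \<mu> h)"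
    "sg (map (map_prod \<eta> \<eta>) \<mu>) (\<eta> h) = (sg \<mu> h :: 'k)"
    using assms by (simp_all add: insert_absorb)
qed

lemma rewire_map:
  assumes "inj_on \<eta> (halves \<mu>)" "h \<in> halves \<mu>" "k \<in> halves \<mu>"
  shows "rewire (map (map_prod \<eta> \<eta>) \<mu>) (\<eta> h) (\<eta> k) = map (map_prod \<eta> \<eta>) (rewire \<mu> h k)"
proof -
  have "untouched (\<eta> h) (\<eta> k) (map_prod \<eta> \<eta> e) = untouched h k e" if "e \<in> set \<mu>" for e
  proof -
    have "fst e \<in> halves \<mu>" "snd e \<in> halves \<mu>" using that by (auto simp: halves_def)
    then show ?thesis using assms(2,3) by (simp add: untouched_def inj_on_eq_iff[OF assms(1)])
  qed
  then have "filter (untouched (\<eta> h) (\<eta> k)) (map (map_prod \<eta> \<eta>) \<mu>)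
      = map (map_prod \<eta> \<eta>) (filter (untouched h k) \<mu>)"
    unfolding filter_map comp_def by (intro arg_cong[of _ _ "map _"] filter_cong refl) simp
  then show ?thesis
    using par_map(1)[OF assms(1)] assms(2,3) by (simp add: rewire_def)
qed

text \<open>The renaming may change the type of names, so one polymorphic function appears as two,
  \<open>\<Phi>'\<close> and \<open>\<Phi>\<close>.\<close>

lemma glue_hrename:
  assumes nat: "\<And>vs v \<mu>. ok vs (v \<circ> \<eta>) \<mu> \<Longrightarrow> inj_on \<eta> (halves \<mu>) \<Longrightarrow>
      \<Phi>' vs v (map (map_prod \<eta> \<eta>) \<mu>) = \<Phi> vs (v \<circ> \<eta>) \<mu>"
    and inj: "inj_on \<eta> (halves \<mu>)" and hk: "h \<in> halves \<mu>" "k \<in> halves \<mu>"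
    and ok: "ok vs (v \<circ> \<eta>) \<mu>"
  shows "glue (\<eta> h) (\<eta> k) \<Phi>' vs v (map (map_prod \<eta> \<eta>) \<mu>) = glue h k \<Phi> vs (v \<circ> \<eta>) \<mu>"
proof -
  have c: "cuttable v (map (map_prod \<eta> \<eta>) \<mu>) (\<eta> h) (\<eta> k) = cuttable (v \<circ> \<eta>) \<mu> h k"
    using par_map(1)[OF inj hk(1)] hk inj par_in[OF hk(1)]
    by (simp add: cuttable_def halves_map inj_on_eq_iff)
  show ?thesis
  proof (cases "cuttable (v \<circ> \<eta>) \<mu> h k")
    case True
    note ok' = ok_glue[OF ok True]
    have "inj_on \<eta> (halves (rewire \<mu> h k))"
      using inj by (rule inj_on_subset) (use True distinct_halves_rewire(2)[OF ok_D(2)[OF ok], of h k] in \<open>auto simp: cuttable_def\<close>)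
    then have "\<Phi>' (remove1 (v (\<eta> k)) vs) (merge (v (\<eta> h)) (v (\<eta> k)) \<circ> v) (map (map_prod \<eta> \<eta>) (rewire \<mu> h k))
      = \<Phi> (remove1 (v (\<eta> k)) vs) (merge (v (\<eta> h)) (v (\<eta> k)) \<circ> v \<circ> \<eta>) (rewire \<mu> h k)"
      using ok' by (intro nat) (simp_all add: comp_def)
    then show ?thesis using c True
      by (simp add: glue_def par_map(2)[OF inj] hk rewire_map[OF inj hk] comp_assoc)
  qed (simp add: glue_def c)
qed

lemma glue_sum_hrename:
  assumes nat: "\<And>vs v \<mu>. ok vs (v \<circ> \<eta>) \<mu> \<Longrightarrow> inj_on \<eta> (halves \<mu>) \<Longrightarrow>
      \<Phi>' vs v (map (map_prod \<eta> \<eta>) \<mu>) = \<Phi> vs (v \<circ> \<eta>) \<mu>"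
    and inj: "inj_on \<eta> (halves \<mu>)" and ok: "ok vs (v \<circ> \<eta>) \<mu>"
  shows "glue_sum \<Phi>' vs v (map (map_prod \<eta> \<eta>) \<mu>) = glue_sum \<Phi> vs (v \<circ> \<eta>) \<mu>"
  unfolding glue_sum_def halves_map sum.reindex[OF inj]
  by (intro sum.cong refl) (simp add: glue_hrename[of \<eta> \<Phi>' \<Phi> \<mu> _ _ vs v, OF nat inj _ _ ok])

text \<open>The canonical marking of \<open>mk vs v \<mu>\<close> arises from the given one by
  renaming vertices to their positions and half-edges to their places in the list, and both
  renamings leave the value unchanged.\<close>

lemma canonize:
  assumes g: "good {} \<Phi>'"
    and gc: "good {} \<Phi>"
    and nat: "\<And>vs v \<eta> \<mu>. ok vs (v \<circ> \<eta>) \<mu> \<Longrightarrow> inj_on \<eta> (halves \<mu>) \<Longrightarrow>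
      \<Phi>' vs v (map (map_prod \<eta> \<eta>) \<mu>) = \<Phi> vs (v \<circ> \<eta>) \<mu>"
    and ok: "ok vs v \<mu>"
  shows "\<Phi> (canon_vs (mk vs v \<mu>)) (end_of (edges (mk vs v \<mu>))) (std (length (edges (mk vs v \<mu>))))
    = \<Phi>' vs v \<mu>"
proof -
  note d = ok_D[OF ok]
  define X where "X = mk vs v \<mu>"
  define m where "m = length \<mu>"
  define \<rho> where "\<rho> x = Suc (pos vs x)" for x
  define \<eta> where "\<eta> h = (if snd h then snd (\<mu> ! fst h) else fst (\<mu> ! fst h))" for h :: half_edge
  have X: "nv X = length vs" "edges X = map (map_prod (\<rho> \<circ> v) (\<rho> \<circ> v)) \<mu>"
    using nv_mk[OF ok] edges_mk[OF ok] by (simp_all add: X_def \<rho>_def comp_def)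
  have inj: "inj_on \<rho> (set vs)" by (auto simp: \<rho>_def inj_on_def pos_inj)
  have vs: "map \<rho> vs = canon_vs X"
    using d(1) by (intro nth_equalityI) (auto simp: X \<rho>_def pos_nth simp del: upt_Suc)
  have mu: "map (map_prod \<eta> \<eta>) (std m) = \<mu>"
    by (rule nth_equalityI) (auto simp: std_def m_def \<eta>_def prod_eq_iff)
  have "map \<eta> (map fst (std m) @ map snd (std m)) = map fst \<mu> @ map snd \<mu>"
  proof -
    have "map fst \<mu> @ map snd \<mu>
        = map fst (map (map_prod \<eta> \<eta>) (std m)) @ map snd (map (map_prod \<eta> \<eta>) (std m))"
      by (simp only: mu)
    then show ?thesis by simp
  qed
  then have inj\<eta>: "inj_on \<eta> (halves (std m))"
    using d(2) unfolding distinct_halves_def halves_def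
    by (metis distinct_map image_set set_append)
  have eq: "end_of (edges X) h = (\<rho> \<circ> v \<circ> \<eta>) h" if "h \<in> halves (std m)" for h
    using that by (auto simp: halves_std X end_of_def \<eta>_def m_def)
  have ok1: "ok (canon_vs X) (\<rho> \<circ> v) (map (map_prod \<eta> \<eta>) (std m))"
    using ok_rename[OF ok inj] by (simp add: vs mu)
  then have ok2: "ok (canon_vs X) (\<rho> \<circ> v \<circ> \<eta>) (std m)" by (simp add: ok_hrename[OF inj\<eta>])
  have "\<Phi>' vs v \<mu> = \<Phi>' (canon_vs X) (\<rho> \<circ> v) \<mu>"
    using good_rename[OF g ok inj] by (simp add: vs)
  also have "\<dots> = \<Phi> (canon_vs X) (\<rho> \<circ> v \<circ> \<eta>) (std m)"
    using nat[OF ok2 inj\<eta>] by (simp add: mu)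
  also have "\<dots> = \<Phi> (canon_vs X) (end_of (edges X)) (std m)"
    by (rule good_cong[OF gc ok2, symmetric]) (use eq in auto)
  finally show ?thesis by (simp add: X_def m_def edges_mk[OF ok] del: upt_Suc)
qed

text \<open>This makes alternating functions that are natural in the names descend to the graph
  space. For each of the three identifications, \<open>Y\<close> is \<open>mk\<close> of a modified
  canonical marking of \<open>X\<close>: permuted edges, one reversed edge, or two switched
  vertices.\<close>

lemma good_srel:
  fixes \<Phi> :: "nat list \<Rightarrow> (half_edge \<Rightarrow> nat) \<Rightarrow> _ \<Rightarrow> ('c::signed_set, 'k::field) svec"
  assumes g: "good {} \<Phi>"
    and nat: "\<And>vs v \<eta> \<mu>. ok vs (v \<circ> \<eta>) \<mu> \<Longrightarrow> inj_on \<eta> (halves \<mu>) \<Longrightarrow>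
      \<Phi> vs v (map (map_prod \<eta> \<eta>) \<mu>) = \<Phi> vs (v \<circ> \<eta>) \<mu>"
    and "srel X \<epsilon> Y"
  defines "F \<equiv> \<lambda>X. \<Phi> (canon_vs X) (end_of (edges X)) (std (length (edges X)))"
  shows "F X = of_int \<epsilon> *\<^sub>v F Y"
proof -
  let ?vs = "canon_vs X" and ?v = "end_of (edges X)" and ?\<mu> = "std (length (edges X))"
  note ok = ok_canon[of X]
  have F: "F (mk ws v \<mu>) = \<Phi> ws v \<mu>" if "ok ws v \<mu>" for ws v \<mu>
    unfolding F_def by (rule canonize[OF g g nat that])
  have pv: "Suc (pos ?vs (?v h)) = ?v h" if "h \<in> halves ?\<mu>" for h
    using ok_D(3)[OF ok that] by (subst pos_upt) (auto simp del: upt_Suc)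
  have e: "map (map_prod ?v ?v) ?\<mu> = edges X" by (rule map_std)
  from assms(3) consider "\<epsilon> = 1" "nv X = nv Y" "mset (edges X) = mset (edges Y)"
    | i where "\<epsilon> = -1" "i < length (edges X)" "Y = reverse_arrow i X"
    | u w where "\<epsilon> = -1" "u \<in> {1..nv X}" "w \<in> {1..nv X}" "u \<noteq> w" "Y = relabel (transpose u w) X"
    unfolding srel_lgraph_def by blast
  then show ?thesis
  proof cases
    case 1
    obtain p where p: "p permutes {..<length (edges X)}" "permute_list p (edges X) = edges Y"
      using mset_eq_permutation[OF 1(3)[symmetric]] by metis
    define \<nu> where "\<nu> = permute_list p ?\<mu>"
    have len: "length ?\<mu> = length (edges X)" by (simp add: std_def)
    have m: "mset \<nu> = mset ?\<mu>" using p(1) len by (simp add: \<nu>_def)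
    then have ok': "ok ?vs ?v \<nu>" using ok_mset[OF ok] by simp
    have "mk ?vs ?v \<nu> = Y"
    proof (rule lgraph_eqI)
      show "nv (mk ?vs ?v \<nu>) = nv Y" using 1(2) nv_mk[OF ok'] by (simp del: upt_Suc)
      have "edges (mk ?vs ?v \<nu>) = map (map_prod ?v ?v) \<nu>"
        unfolding edges_mk[OF ok'] by (rule map_halves_cong) (simp add: pv halves_mset[OF m] del: upt_Suc)
      also have "\<dots> = permute_list p (map (map_prod ?v ?v) ?\<mu>)"
        using p(1) len by (simp add: \<nu>_def permute_list_map)
      finally show "edges (mk ?vs ?v \<nu>) = edges Y" by (simp add: e p)
    qed
    then have "F Y = \<Phi> ?vs ?v \<nu>" using F[OF ok'] by simp
    then show ?thesis using good_mset[OF g ok m] 1 by (simp add: F_def)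
  next
    case (2 i)
    define r where "r = take i ?\<mu> @ drop (Suc i) ?\<mu>"
    have i: "i < length ?\<mu>" using 2 by (simp add: std_def)
    have mi: "?\<mu> ! i = ((i, False), (i, True))" using 2 by (simp add: std_def)
    define \<nu> where "\<nu> = ?\<mu>[i := ((i, True), (i, False))]"
    have m1: "mset (((i, False), (i, True)) # r) = mset ?\<mu>"
      using id_take_nth_drop[OF i] mi by (metis r_def mset_append mset.simps(2) union_mset_add_mset_right)
    have m2: "mset \<nu> = mset (((i, True), (i, False)) # r)"
      using i by (simp add: \<nu>_def r_def upd_conv_take_nth_drop)
    note ok1 = ok_mset[OF ok m1[symmetric]]
    note ok2 = ok_mset[OF ok_rev[OF ok1] m2[symmetric]]
    have "mk ?vs ?v \<nu> = Y"
    proof (rule lgraph_eqI)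
      show "nv (mk ?vs ?v \<nu>) = nv Y" using 2 by (simp add: nv_mk[OF ok2] del: upt_Suc)
      have h: "halves \<nu> = halves ?\<mu>" using halves_mset[OF m1] halves_mset[OF m2] by auto
      have "edges (mk ?vs ?v \<nu>) = map (map_prod ?v ?v) \<nu>"
        unfolding edges_mk[OF ok2] by (rule map_halves_cong) (simp add: pv h del: upt_Suc)
      also have "\<dots> = (edges X)[i := (?v (i, True), ?v (i, False))]"
        by (simp add: \<nu>_def map_update e)
      also have "\<dots> = edges Y"
        using 2 by (simp add: edges_reverse_arrow end_of_def prod.swap_def)
      finally show "edges (mk ?vs ?v \<nu>) = edges Y" .
    qed
    then have "F Y = \<Phi> ?vs ?v \<nu>" using F[OF ok2] by simp
    also have "\<dots> = - \<Phi> ?vs ?v ?\<mu>"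
      using good_mset[OF g ok_rev[OF ok1] m2] good_rev[OF g ok1 refl] good_mset[OF g ok m1] by simp
    finally show ?thesis using 2 by (simp add: F_def)
  next
    case (3 u w)
    let ?t = "transpose u w"
    have p: "?t permutes {1..nv X}" using 3 by (intro permutes_swap_id) auto
    have s: "set ?vs = {1..nv X}" by auto
    have ok': "ok (map ?t ?vs) ?v ?\<mu>"
      by (rule ok_perm[OF ok])
        (use p s in \<open>auto simp: distinct_map permutes_inj_on permutes_image simp del: upt_Suc\<close>)
    have "mk (map ?t ?vs) ?v ?\<mu> = Y"
    proof (rule lgraph_eqI)
      show "nv (mk (map ?t ?vs) ?v ?\<mu>) = nv Y" using 3 by (simp add: nv_mk[OF ok'] del: upt_Suc)
      have "Suc (pos (map ?t ?vs) (?v h)) = ?t (?v h)" if "h \<in> halves ?\<mu>" for h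
      proof -
        have "pos (map ?t ?vs) (?t (?t (?v h))) = pos ?vs (?t (?v h))"
          by (intro pos_map permutes_inj_on[OF p])
        moreover have "?t (?v h) \<in> {1..nv X}"
          using ok_D(3)[OF ok that] permutes_in_image[OF p] by (simp del: upt_Suc)
        ultimately show ?thesis by (simp add: pos_upt del: upt_Suc)
      qed
      then have "edges (mk (map ?t ?vs) ?v ?\<mu>) = map (map_prod (?t \<circ> ?v) (?t \<circ> ?v)) ?\<mu>"
        unfolding edges_mk[OF ok'] by (intro map_halves_cong) simp
      then have "edges (mk (map ?t ?vs) ?v ?\<mu>) = map (map_prod ?t ?t) (map (map_prod ?v ?v) ?\<mu>)"
        by (simp only: map_map map_prod_compose)
      then show "edges (mk (map ?t ?vs) ?v ?\<mu>) = edges Y"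
        using 3 p by (simp add: e edges_relabel)
    qed
    then have "F Y = \<Phi> (map ?t ?vs) ?v ?\<mu>" using F[OF ok'] by simp
    also have "\<dots> = - \<Phi> ?vs ?v ?\<mu>"
      using 3 s by (intro good_transpose[OF g ok]) auto
    finally show ?thesis using 3 by (simp add: F_def)
  qed
qed

subsection \<open>Comparison with the positional definition\<close>

lemma nv_cut_glue [simp]: "nv (cut_glue X h k) = nv X"
  by transfer auto

lemma edges_cut_glue:
  assumes "fst h < length (edges X)" "fst k < length (edges X)" "fst h \<noteq> fst k"
  shows "edges (cut_glue X h k) = (edges X)[fst h := (end_of (edges X) h, end_of (edges X) k),
      fst k := (end_of (edges X) (bar k), end_of (edges X) (bar h))]"
  using assms by transfer auto

lemma collapse12:
  assumes "i < length (edges X)" "edges X ! i = (1, 2)"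
  shows nv_collapse12: "nv (collapse12 X i) = nv X - 1"
    and edges_collapse12: "edges (collapse12 X i) = (let c = \<lambda>w. if w \<le> 1 then w else w - 1
      in map (map_prod c c) (take i (edges X) @ drop (Suc i) (edges X)))"
  using assms by (transfer, auto simp: Let_def)+

text \<open>\<open>collapse\<close> renumbers the vertices by \<open>front\<close> and pays with its
  sign. Equivalently the vertex list is reordered by the inverse permutation, which has the same
  sign and puts \<open>u, w\<close> first. Then \<open>glue\<close> deletes position 1, and the
  resulting -1 turns \<open>sg \<mu> h * sg \<mu> k\<close> into
  \<open>cut_glue_sign h k\<close>.\<close>

lemma X_hk_glue:
  fixes X :: lgraph
  assumes hk: "h \<in> half_edges X" "k \<in> half_edges X" "fst h \<noteq> fst k"
  shows "(X_hk X h k :: 'k::field graph_space)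
    = glue h k gvec (canon_vs X) (end_of (edges X)) (std (length (edges X)))"
proof -
  define es where "es = edges X"
  define m where "m = length es"
  define v where "v = end_of es"
  define \<mu> where "\<mu> = std m"
  define n where "n = nv X"
  define vs where "vs = canon_vs X"
  have ok: "ok vs v \<mu>" using ok_canon[of X] by (simp add: vs_def v_def \<mu>_def m_def es_def)
  note d = ok_D[OF ok]
  obtain i b where h: "h = (i, b)" by fastforce
  obtain j b' where k: "k = (j, b')" by fastforce
  have ij: "i < m" "j < m" "i \<noteq> j" using hk by (auto simp: half_edges_def h k m_def es_def)
  have hm: "h \<in> halves \<mu>" "k \<in> halves \<mu>" using ij by (auto simp: \<mu>_def halves_std h k)
  have inm: "((l, False), (l, True)) \<in> set \<mu>" if "l < m" for l using that by (auto simp: \<mu>_def set_std)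
  have par: "par \<mu> g = bar g" "sg \<mu> g = (if snd g then -1 else 1 :: 'k)" if "fst g < m" for g
    using par_sg_in[OF d(2) inm[OF that]] by (cases g; cases "snd g"; simp add: bar_def)+
  have ne: "par \<mu> h \<noteq> k" using par(1)[of h] ij by (auto simp: h k bar_def)
  show ?thesis
  proof (cases "v h = v k")
    case True
    then show ?thesis by (simp add: X_hk_def glue_def cuttable_def v_def es_def)
  next
    case False
    define u where "u = v h"
    define w where "w = v k"
    have uw: "u \<noteq> w" using False by (simp add: u_def w_def)
    have c: "cuttable v \<mu> h k" using hm ne False by (simp add: cuttable_def)
    have uw_in: "u \<in> {1..n}" "w \<in> {1..n}"
      using d(3)[OF hm(1)] d(3)[OF hm(2)] by (auto simp: u_def w_def vs_def n_def)
    define Y where "Y = cut_glue X h k"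
    define f where "f l = (if l = i then (u, w) else if l = j then (v (bar k), v (bar h)) else es ! l)" for l
    have eY: "edges Y = map f [0..<m]"
      using ij by (intro nth_equalityI)
        (auto simp: Y_def edges_cut_glue h k m_def es_def f_def nth_list_update u_def w_def v_def)
    define p where "p = front u w"
    have p: "p permutes {1..n}" "p u = 1" "p w = 2"
      using front_permutes[OF uw_in uw] front[OF uw] by (simp_all add: p_def)
    define Z where "Z = relabel p Y"
    have nY: "nv Y = n" by (simp add: Y_def n_def)
    have eZ: "edges Z = map (map_prod p p \<circ> f) [0..<m]"
      using p(1) by (simp add: Z_def edges_relabel nY eY)
    have Zi: "i < length (edges Z)" "edges Z ! i = (1, 2)" using ij p by (auto simp: eZ f_def)
    define c' where "c' x = (if x \<le> 1 then x else x - 1)" for x :: nat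
    have Xhk: "(X_hk X h k :: 'k graph_space)
        = (cut_glue_sign h k * of_int (sign p)) *\<^sub>v cls (collapse12 Z i)"
    proof -
      have Yi: "edges Y ! i = (u, w)" using ij by (simp add: eY f_def)
      have hi: "fst h = i" by (simp add: h)
      have "collapse Y i = of_int (sign p) *\<^sub>v (cls (collapse12 Z i) :: 'k graph_space)"
        by (simp add: collapse_def Let_def Yi Z_def p_def)
      moreover have "X_hk X h k = cut_glue_sign h k *\<^sub>v (collapse Y i :: 'k graph_space)"
        using False by (simp add: X_hk_def Y_def v_def es_def hi)
      ultimately show ?thesis by simp
    qed
    define q where "q = inv p"
    have q: "q permutes {1..n}" "q 1 = u" "q 2 = w"
      using permutes_inv[OF p(1)] permutes_inv_eq[OF p(1)] p(2,3) by (auto simp: q_def)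
    have n2: "2 \<le> n" using uw uw_in by auto
    have vs: "vs = 1 # 2 # [3..<Suc n]"
      using n2 by (simp add: vs_def n_def upt_conv_Cons numeral_3_eq_3 numeral_2_eq_2 del: upt_Suc)
    define ws where "ws = map q (1 # [3..<Suc n])"
    have mq: "map q vs = u # w # map q [3..<Suc n]" using q by (simp add: vs)
    have sv: "set vs = {1..n}" by (auto simp: vs_def n_def)
    have okq: "ok (map q vs) v \<mu>"
      by (rule ok_perm[OF ok]) (use q(1) d(1) sv in \<open>auto simp: distinct_map permutes_inj_on permutes_image\<close>)
    have w_ws: "remove1 w (map q vs) = ws" using uw q by (simp add: mq ws_def)
    have "glue h k gvec (map q vs) v \<mu> = of_int (sign q) *\<^sub>v (glue h k gvec vs v \<mu> :: 'k graph_space)"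
      using q(1) sv by (intro good_permute[OF good_glue[OF good_gvec] ok]) simp
    moreover have "sign q = sign p" using p(1) by (simp add: q_def sign_inverse permutes_imp_permutation[of "{1..n}"])
    moreover have "of_int (sign p) * of_int (sign p) = (1::'k)" by (simp add: sign_def)
    ultimately have g1: "glue h k gvec vs v \<mu> = of_int (sign p) *\<^sub>v (glue h k gvec (map q vs) v \<mu> :: 'k graph_space)"
      by simp
    have "pos (map q vs) w = 1" using uw by (simp add: mq)
    then have g2: "glue h k gvec (map q vs) v \<mu> = (- (sg \<mu> h * sg \<mu> k)) *\<^sub>v
        (gvec ws (merge u w \<circ> v) (rewire \<mu> h k) :: 'k graph_space)"
      using c w_ws by (simp add: glue_def flip: u_def w_def)
    have okw: "ok ws (merge u w \<circ> v) (rewire \<mu> h k)"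
      using ok_glue[OF okq c] w_ws by (simp flip: u_def w_def)
    have main: "gvec ws (merge u w \<circ> v) (rewire \<mu> h k) = (cls (collapse12 Z i) :: 'k graph_space)"
      unfolding gvec_def
    proof (rule cls_mset)
      show "nv (mk ws (merge u w \<circ> v) (rewire \<mu> h k)) = nv (collapse12 Z i)"
        unfolding nv_mk[OF okw] nv_collapse12[OF Zi] using n2 by (simp add: ws_def Z_def nY del: upt_Suc)
      \<comment> \<open>Positions in \<open>ws\<close> reproduce the renumbering \<open>c'\<close>
        of \<open>collapse12\<close>; both ends of the collapsed edge get the number 1.\<close>
      have posw: "Suc (pos ws (merge u w x)) = c' (p x)" if x: "x \<in> {1..n}" for x
      proof (cases "x = u \<or> x = w")
        case True
        then show ?thesis using p q by (auto simp: merge_def ws_def c'_def)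
      next
        case False
        have px: "p x \<in> {1..n}" using permutes_in_image[OF p(1)] x by simp
        have "p x \<noteq> 1" "p x \<noteq> 2" using False p permutes_inj[OF p(1)] by (metis injD)+
        then have px3: "p x \<in> {3..<Suc n}" using px by auto
        have qp: "q (p x) = x" using p(1) by (simp add: q_def permutes_inverses)
        have "pos ws (q (p x)) = pos (1 # [3..<Suc n]) (p x)"
          unfolding ws_def by (rule pos_map) (rule permutes_inj_on[OF q(1)])
        then have "pos ws x = p x - 2" using px3 qp pos_upt[OF px3] by (auto simp del: upt_Suc)
        then show ?thesis using False px3 by (auto simp: c'_def)
      qed
      have hin: "v g \<in> {1..n}" if "g \<in> halves (rewire \<mu> h k)" for g
        using that d(3)[of g] distinct_halves_rewire(2)[OF d(2) hm _ ne] ij sv by (auto simp: h k)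
      have L: "edges (mk ws (merge u w \<circ> v) (rewire \<mu> h k))
          = map (map_prod (c' \<circ> p) (c' \<circ> p)) (map (map_prod v v) (rewire \<mu> h k))"
        unfolding edges_mk[OF okw] map_map
        by (intro map_cong refl) (use posw hin in \<open>auto simp: halvesI simp del: halves_simps\<close>)
      \<comment> \<open>\<open>rewire\<close> lists the new edge first, whereas the positional
        version leaves it at position \<open>j\<close>; hence the two edge lists are compared as
        multisets.\<close>
      define I where "I = filter (\<lambda>l. l \<noteq> i \<and> l \<noteq> j) [0..<m]"
      have split: "[0..<m] = [0..<i] @ i # [Suc i..<m]"
        using ij by (metis upt_add_eq_append upt_conv_Cons le0 less_imp_le_nat le_add_diff_inverse)
      have "take i [0..<m] @ drop (Suc i) [0..<m] = [0..<i] @ [Suc i..<m]" using ij by simp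
      also have "\<dots> = filter (\<lambda>l. l \<noteq> i) [0..<m]" unfolding split by simp
      finally have tk: "take i [0..<m] @ drop (Suc i) [0..<m] = filter (\<lambda>l. l \<noteq> i) [0..<m]" .
      have "mset (filter (\<lambda>l. l \<noteq> i) [0..<m]) = mset_set ({..<m} - {i})"
        by (subst mset_set_set[symmetric]) (auto intro!: arg_cong[of _ _ mset_set])
      also have "{..<m} - {i} = insert j ({..<m} - {i, j})" using ij by auto
      also have "mset_set \<dots> = add_mset j (mset_set ({..<m} - {i, j}))" by simp
      also have "mset_set ({..<m} - {i, j}) = mset I"
        unfolding I_def by (subst mset_set_set[symmetric]) (auto intro!: arg_cong[of _ _ mset_set])
      finally have mI: "mset (filter (\<lambda>l. l \<noteq> i) [0..<m]) = add_mset j (mset I)" .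
      have "edges (collapse12 Z i) = map (map_prod c' c' \<circ> (map_prod p p \<circ> f)) (take i [0..<m] @ drop (Suc i) [0..<m])"
        using edges_collapse12[OF Zi] unfolding Let_def eZ take_map drop_map map_append map_map c'_def .
      then have R: "mset (edges (collapse12 Z i))
          = image_mset (map_prod c' c' \<circ> (map_prod p p \<circ> f)) (add_mset j (mset I))"
        unfolding tk by (simp only: mset_map mI)
      have fI: "filter (untouched h k) \<mu> = map (\<lambda>l. ((l, False), (l, True))) I"
        by (auto simp: \<mu>_def std_def I_def filter_map comp_def untouched_def h k intro!: filter_cong arg_cong[of _ _ "map _"])
      have "map (map_prod v v) (rewire \<mu> h k) = f j # map f I"
        unfolding rewire_def fI using ij by (auto simp: par h k f_def I_def v_def end_of_def)
      then show "mset (edges (mk ws (merge u w \<circ> v) (rewire \<mu> h k))) = mset (edges (collapse12 Z i))"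
        unfolding L R map_prod_compose by (simp add: multiset.map_comp comp_assoc)
    qed
    have "cut_glue_sign h k = - (sg \<mu> h * sg \<mu> k :: 'k)"
      using par(2)[of h] par(2)[of k] ij by (simp add: cut_glue_sign_def h k)
    then show ?thesis
      using Xhk g1 g2 main by (simp add: vs_def v_def \<mu>_def m_def es_def mult.commute)
  qed
qed

text \<open>\<open>glue_sym\<close> folds the pairs with \<open>fst k < fst h\<close> onto those
  with \<open>fst h < fst k\<close>; two half-edges of one edge are equal or complementary and
  contribute 0.\<close>

lemma dH_graph_glue_sum:
  "glue_sum gvec (canon_vs X) (end_of (edges X)) (std (length (edges X)))
    = (2 *\<^sub>v dH_graph X :: 'k::field graph_space)"
proof -
  let ?vs = "canon_vs X" and ?v = "end_of (edges X)" and ?\<mu> = "std (length (edges X))"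
  let ?g = "\<lambda>h k. glue h k gvec ?vs ?v ?\<mu> :: 'k graph_space"
  let ?H = "half_edges X"
  note ok = ok_canon[of X]
  have H: "halves ?\<mu> = ?H" by (simp add: halves_std half_edges_def)
  have finH: "finite ?H" by (simp add: half_edges_def)
  define A where "A = {(h, k). h \<in> ?H \<and> k \<in> ?H \<and> fst h < fst k}"
  define B where "B = {(h, k). h \<in> ?H \<and> k \<in> ?H \<and> fst k < fst h}"
  define C where "C = {(h, k). h \<in> ?H \<and> k \<in> ?H \<and> fst h = fst k}"
  have sub: "A \<subseteq> ?H \<times> ?H" "B \<subseteq> ?H \<times> ?H" "C \<subseteq> ?H \<times> ?H"
    by (auto simp: A_def B_def C_def)
  then have fin: "finite A" "finite B" "finite C" using finH by (meson finite_SigmaI finite_subset)+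
  have U: "?H \<times> ?H = A \<union> B \<union> C" by (auto simp: A_def B_def C_def)
  have z: "?g h k = 0" if hkC: "(h, k) \<in> C" for h k
  proof -
    obtain i b b' where hk: "h = (i, b)" "k = (i, b')" "i < length (edges X)"
      using hkC by (cases h; cases k) (auto simp: C_def half_edges_def)
    have "((i, False), (i, True)) \<in> set ?\<mu>" using hk by (auto simp: set_std)
    note p = par_sg_in(1,2)[OF ok_D(2)[OF ok] this]
    have "h = k \<or> par ?\<mu> h = k" using p hk by (cases b; cases b') auto
    then show ?thesis by (auto simp: glue_def cuttable_def)
  qed
  have "glue_sum gvec ?vs ?v ?\<mu> = (\<Sum>(h, k)\<in>?H \<times> ?H. ?g h k)"
    unfolding glue_sum_def H by (rule sum.cartesian_product)
  also have "\<dots> = (\<Sum>(h, k)\<in>A. ?g h k) + (\<Sum>(h, k)\<in>B. ?g h k) + (\<Sum>(h, k)\<in>C. ?g h k)"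
  proof -
    have "A \<inter> B = {}" "(A \<union> B) \<inter> C = {}" by (auto simp: A_def B_def C_def)
    then show ?thesis unfolding U using fin by (simp add: sum.union_disjoint)
  qed
  also have "(\<Sum>(h, k)\<in>C. ?g h k) = 0" using z by (auto intro!: sum.neutral)
  also have "(\<Sum>(h, k)\<in>B. ?g h k) = (\<Sum>(h, k)\<in>A. ?g k h)"
    by (rule sum.reindex_bij_witness[of _ prod.swap prod.swap]) (auto simp: A_def B_def)
  also have "\<dots> = (\<Sum>(h, k)\<in>A. ?g h k)"
    using glue_sym[OF good_gvec ok] by (intro sum.cong refl) auto
  also have "(\<Sum>(h, k)\<in>A. ?g h k) = dH_graph X"
    unfolding dH_graph_def A_def[symmetric] by (intro sum.cong refl) (auto simp: A_def X_hk_glue)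
  finally show ?thesis by (metis add.right_neutral one_add_one svec.scale_left_distrib svec.scale_one)
qed

lemma glue_sum_gvec_nat:
  "ok vs (v \<circ> \<eta>) \<mu> \<Longrightarrow> inj_on \<eta> (halves \<mu>) \<Longrightarrow>
    glue_sum gvec vs v (map (map_prod \<eta> \<eta>) \<mu>) = glue_sum gvec vs (v \<circ> \<eta>) \<mu>"
  by (rule glue_sum_hrename) (simp_all add: gvec_hrename)

text \<open>\<open>good_srel\<close> gives the identity for twice the operator; dividing by 2 is
  where characteristic zero enters.\<close>

lemma dH_graph_srel:
  assumes "srel X \<epsilon> Y"
  shows "dH_graph X = of_int \<epsilon> *\<^sub>v (dH_graph Y :: 'k::field_char_0 graph_space)"
proof -
  have "2 *\<^sub>v dH_graph X = of_int \<epsilon> *\<^sub>v (2 *\<^sub>v dH_graph Y :: 'k graph_space)"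
    unfolding dH_graph_glue_sum[symmetric]
    by (rule good_srel[OF good_glue_sum[OF good_gvec] glue_sum_gvec_nat assms])
  then have "(1 / 2) *\<^sub>v 2 *\<^sub>v dH_graph X = (1 / 2) *\<^sub>v of_int \<epsilon> *\<^sub>v (2 *\<^sub>v dH_graph Y :: 'k graph_space)"
    by simp
  then show ?thesis by (simp add: mult.commute)
qed

lemma linear_dH: "Vector_Spaces.linear (*\<^sub>v) (*\<^sub>v) (dH :: 'k::field_char_0 graph_space \<Rightarrow> _)"
  and dH_cls: "dH (cls X) = (dH_graph X :: 'k::field_char_0 graph_space)"
  unfolding dH_def by (rule lext_cls; rule dH_graph_srel; assumption)+

lemma dH_gvec:
  assumes "ok vs v \<mu>"
  shows "dH (gvec vs v \<mu>) = (1 / 2) *\<^sub>v (glue_sum gvec vs v \<mu> :: 'k::field_char_0 graph_space)"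
proof -
  have "glue_sum gvec vs v \<mu> = (2 *\<^sub>v dH_graph (mk vs v \<mu>) :: 'k graph_space)"
    unfolding dH_graph_glue_sum[symmetric]
    by (rule canonize[OF good_glue_sum[OF good_gvec] good_glue_sum[OF good_gvec]
          glue_sum_gvec_nat assms, symmetric])
  then show ?thesis by (simp add: gvec_def[of vs v] dH_cls)
qed

section \<open>Colourings and tensors of marked graphs\<close>

lemma tens_simps:
  fixes a a' :: "('a::signed_set, 'k::field) svec" and b b' :: "('b::signed_set, 'k) svec"
  shows tens_add_left: "(a + a') \<otimes> b = a \<otimes> b + a' \<otimes> b"
    and tens_add_right: "a \<otimes> (b + b') = a \<otimes> b + a \<otimes> b'"
    and tens_scale_left: "(c *\<^sub>v a) \<otimes> b = c *\<^sub>v (a \<otimes> b)"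
    and tens_scale_right: "a \<otimes> (c *\<^sub>v b) = c *\<^sub>v (a \<otimes> b)"
  using tens_linear_left[of b] tens_linear_right[of a] by (auto simp: Vector_Spaces.linear_iff)

lemma tens_zero [simp]:
  fixes a :: "('a::signed_set, 'k::field) svec" and b :: "('b::signed_set, 'k) svec"
  shows "(0 :: ('a, 'k) svec) \<otimes> b = 0" "a \<otimes> (0 :: ('b, 'k) svec) = 0"
  using tens_scale_left[of 0 0 b] tens_scale_right[of a 0 0] by simp_all

lemma tens_minus:
  fixes a :: "('a::signed_set, 'k::field) svec" and b :: "('b::signed_set, 'k) svec"
  shows "(- a) \<otimes> b = - (a \<otimes> b)" "a \<otimes> (- b) = - (a \<otimes> b)"
  using tens_scale_left[of "-1" a b] tens_scale_right[of a "-1" b] by (simp_all add: svec.scale_minus_left)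

lemma tens_sum: "(\<Sum>i\<in>I. f i) \<otimes> b = (\<Sum>i\<in>I. f i \<otimes> b)" "a' \<otimes> (\<Sum>i\<in>I. g i) = (\<Sum>i\<in>I. a' \<otimes> g i)"
  by (induction I rule: infinite_finite_induct) (simp_all add: tens_add_left tens_add_right)

definition vpart :: "nat set \<Rightarrow> nat list \<Rightarrow> nat list" where
  "vpart S vs = filter (\<lambda>x. x \<in> S) vs"

text \<open>An edge is assigned by its initial half-edge, an unbiased choice exactly when both ends
  have the same colour, as in a \<open>monochrome\<close> colouring.\<close>

definition epart :: "nat set \<Rightarrow> ('h \<Rightarrow> nat) \<Rightarrow> ('h \<times> 'h) list \<Rightarrow> ('h \<times> 'h) list" where
  "epart S v \<mu> = filter (\<lambda>e. v (fst e) \<in> S) \<mu>"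

definition monochrome :: "nat set \<Rightarrow> ('h \<Rightarrow> nat) \<Rightarrow> ('h \<times> 'h) list \<Rightarrow> bool" where
  "monochrome S v \<mu> \<longleftrightarrow> (\<forall>e\<in>set \<mu>. v (fst e) \<in> S \<longleftrightarrow> v (snd e) \<in> S)"

text \<open>The sign of sorting the vertices in \<open>S\<close> to the front.\<close>

primrec ksign :: "nat set \<Rightarrow> nat list \<Rightarrow> 'k::field" where
  "ksign S [] = 1"
| "ksign S (x # xs) = (if x \<in> S then 1 else (-1) ^ length (vpart S xs)) * ksign S xs"

text \<open>The factors are arbitrary functions, so that the construction can be iterated to three
  colours. The value 0 off the monochrome colourings lets sums run over all subsets.\<close>

definition tensor ::
    "nat set \<Rightarrow> (nat list \<Rightarrow> ('h \<Rightarrow> nat) \<Rightarrow> ('h \<times> 'h) list \<Rightarrow> ('b::signed_set, 'k::field) svec)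
      \<Rightarrow> (nat list \<Rightarrow> ('h \<Rightarrow> nat) \<Rightarrow> ('h \<times> 'h) list \<Rightarrow> ('c::signed_set, 'k) svec)
      \<Rightarrow> nat list \<Rightarrow> ('h \<Rightarrow> nat) \<Rightarrow> ('h \<times> 'h) list \<Rightarrow> ('b \<times> 'c, 'k) svec" where
  "tensor S \<Phi> \<Psi> vs v \<mu> =
     (if monochrome S v \<mu>
      then ksign S vs *\<^sub>v (\<Phi> (vpart S vs) v (epart S v \<mu>) \<otimes> \<Psi> (vpart (- S) vs) v (epart (- S) v \<mu>))
      else 0)"

lemma vpart_simps [simp]:
  "vpart S [] = []" "vpart S (x # xs) = (if x \<in> S then x # vpart S xs else vpart S xs)"
  "vpart S (xs @ ys) = vpart S xs @ vpart S ys"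
  "set (vpart S xs) = set xs \<inter> S"
  by (auto simp: vpart_def)

lemma epart_simps [simp]:
  "epart S v [] = []" "epart S v (e # \<mu>) = (if v (fst e) \<in> S then e # epart S v \<mu> else epart S v \<mu>)"
  "epart S v (\<mu> @ \<nu>) = epart S v \<mu> @ epart S v \<nu>"
  by (auto simp: epart_def)

lemma distinct_vpart: "distinct vs \<Longrightarrow> distinct (vpart S vs)"
  by (simp add: vpart_def)

lemma monochrome_compl [simp]: "monochrome (- S) v \<mu> = monochrome S v \<mu>"
  by (auto simp: monochrome_def)

lemma monochrome_halves: "monochrome S v \<mu> \<Longrightarrow> (a, b) \<in> set \<mu> \<Longrightarrow> v a \<in> S \<longleftrightarrow> v b \<in> S"
  by (auto simp: monochrome_def)

lemma halves_epart:
  assumes "monochrome S v \<mu>"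
  shows "halves (epart S v \<mu>) = {h \<in> halves \<mu>. v h \<in> S}"
proof -
  have "halves (epart S v \<mu>) = {h \<in> halves \<mu>. v h \<in> S}" if "\<forall>e\<in>set \<mu>. v (fst e) \<in> S \<longleftrightarrow> v (snd e) \<in> S"
    using that by (induction \<mu>) auto
  then show ?thesis using assms by (simp add: monochrome_def)
qed

lemma distinct_halves_filter: "distinct_halves \<mu> \<Longrightarrow> distinct_halves (filter P \<mu>)"
  by (induction \<mu>) (auto simp: halves_def)

lemma ok_part:
  assumes ok: "ok vs v \<mu>" and m: "monochrome S v \<mu>"
  shows "ok (vpart S vs) v (epart S v \<mu>)"
proof -
  have "{h \<in> halves (epart S v \<mu>). v h = x} = {h \<in> halves \<mu>. v h = x}" if "x \<in> S" for x
    using that by (auto simp: halves_epart[OF m])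
  then show ?thesis
    using ok_D[OF ok] distinct_halves_filter[of \<mu> "\<lambda>e. v (fst e) \<in> S"]
    by (auto simp: ok_def distinct_vpart halves_epart[OF m] simp flip: epart_def)
qed

lemma monochrome_cong: "(\<And>h. h \<in> halves \<mu> \<Longrightarrow> v h \<in> S \<longleftrightarrow> v' h \<in> S') \<Longrightarrow> monochrome S v \<mu> = monochrome S' v' \<mu>"
  unfolding monochrome_def by (intro ball_cong refl) (simp add: halves_def)

lemma epart_cong: "(\<And>h. h \<in> halves \<mu> \<Longrightarrow> v h \<in> S \<longleftrightarrow> v' h \<in> S') \<Longrightarrow> epart S v \<mu> = epart S' v' \<mu>"
  unfolding epart_def by (intro filter_cong refl) (simp add: halves_def)

lemma monochrome_mset: "mset \<mu> = mset \<mu>' \<Longrightarrow> monochrome S v \<mu> = monochrome S v \<mu>'"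
  unfolding monochrome_def by (metis mset_eq_setD)

lemma epart_mset: "mset \<mu> = mset \<mu>' \<Longrightarrow> mset (epart S v \<mu>) = mset (epart S v \<mu>')"
  by (simp add: epart_def)

lemma ksign_swap:
  "ksign S (xs @ b # a # ys) = (if a \<in> S \<longleftrightarrow> b \<in> S then 1 else -1) * ksign S (xs @ a # b # ys)"
  by (induction xs) auto

lemma length_vpart_map:
  "(\<And>x. x \<in> set vs \<Longrightarrow> \<rho> x \<in> S' \<longleftrightarrow> x \<in> S) \<Longrightarrow> vpart S' (map \<rho> vs) = map \<rho> (vpart S vs)"
  by (induction vs) auto

lemma ksign_map:
  "(\<And>x. x \<in> set vs \<Longrightarrow> \<rho> x \<in> S' \<longleftrightarrow> x \<in> S) \<Longrightarrow> ksign S' (map \<rho> vs) = ksign S vs"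
  by (induction vs) (auto simp: length_vpart_map)

text \<open>The colour class may move along with the renaming, which is what reindexing the sum in
  \<open>good_cop\<close> requires; \<open>good_tensor\<close> uses the case
  \<open>S' = S\<close>.\<close>

lemma tensor_rename:
  assumes g: "good C \<Phi>" "good D \<Psi>" and ok: "ok vs v \<mu>" and inj: "inj_on \<rho> (set vs)"
    and C: "\<And>T x. T \<in> C \<union> D \<Longrightarrow> x \<in> set vs \<Longrightarrow> \<rho> x \<in> T \<longleftrightarrow> x \<in> T"
    and S: "\<And>x. x \<in> set vs \<Longrightarrow> \<rho> x \<in> S' \<longleftrightarrow> x \<in> S"
  shows "tensor S' \<Phi> \<Psi> (map \<rho> vs) (\<rho> \<circ> v) \<mu> = tensor S \<Phi> \<Psi> vs v \<mu>"
proof -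
  note d = ok_D[OF ok]
  have m: "monochrome S' (\<rho> \<circ> v) \<mu> = monochrome S v \<mu>" by (rule monochrome_cong) (use d S in auto)
  have e: "epart S' (\<rho> \<circ> v) \<mu> = epart S v \<mu>" "epart (- S') (\<rho> \<circ> v) \<mu> = epart (- S) v \<mu>"
    by (rule epart_cong; use d S in auto)+
  have vp: "vpart S' (map \<rho> vs) = map \<rho> (vpart S vs)" "vpart (- S') (map \<rho> vs) = map \<rho> (vpart (- S) vs)"
    by (rule length_vpart_map; use S in auto)+
  show ?thesis
  proof (cases "monochrome S v \<mu>")
    case True
    have "\<Phi> (map \<rho> (vpart S vs)) (\<rho> \<circ> v) (epart S v \<mu>) = \<Phi> (vpart S vs) v (epart S v \<mu>)"
      by (rule good_rename[OF g(1) ok_part[OF ok True]]) (use C inj in \<open>auto intro: inj_on_subset\<close>)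
    moreover have "\<Psi> (map \<rho> (vpart (- S) vs)) (\<rho> \<circ> v) (epart (- S) v \<mu>) = \<Psi> (vpart (- S) vs) v (epart (- S) v \<mu>)"
      by (rule good_rename[OF g(2) ok_part[OF ok]]) (use C inj True in \<open>auto intro: inj_on_subset\<close>)
    ultimately show ?thesis using True by (simp add: tensor_def m e vp ksign_map[OF S])
  qed (simp add: tensor_def m)
qed

lemma good_tensor:
  assumes g: "good C \<Phi>" "good D \<Psi>"
  shows "good (insert S (C \<union> D)) (tensor S \<Phi> \<Psi>)"
proof (rule goodI, goal_cases)
  case (1 vs v \<mu> v')
  have m: "monochrome S v' \<mu> = monochrome S v \<mu>" by (rule monochrome_cong) (simp add: 1)
  have e: "epart T v' \<mu> = epart T v \<mu>" for T by (rule epart_cong) (simp add: 1)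
  show ?case
  proof (cases "monochrome S v \<mu>")
    case True
    have "\<Phi> (vpart S vs) v' (epart S v \<mu>) = \<Phi> (vpart S vs) v (epart S v \<mu>)"
      by (rule good_cong[OF g(1) ok_part[OF 1(1) True]]) (use 1 True in \<open>auto simp: halves_epart\<close>)
    moreover have "\<Psi> (vpart (- S) vs) v' (epart (- S) v \<mu>) = \<Psi> (vpart (- S) vs) v (epart (- S) v \<mu>)"
      by (rule good_cong[OF g(2) ok_part[OF 1(1)]]) (use 1 True in \<open>auto simp: halves_epart\<close>)
    ultimately show ?thesis using True by (simp add: tensor_def m e)
  qed (simp add: tensor_def m)
next
  case (2 xs a b ys v \<mu>)
  show ?case
  proof (cases "monochrome S v \<mu>")
    case True
    have ok1: "ok (vpart S xs @ vpart S (a # b # ys)) v (epart S v \<mu>)"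
      using ok_part[OF 2 True] by simp
    have ok2: "ok (vpart (- S) xs @ vpart (- S) (a # b # ys)) v (epart (- S) v \<mu>)"
      using ok_part[OF 2, of "- S"] True by simp
    \<comment> \<open>The sign comes from \<open>\<Phi>\<close> or \<open>\<Psi>\<close> if
      \<open>a\<close> and \<open>b\<close> have the same colour, and from \<open>ksign\<close>
      otherwise.\<close>
    show ?thesis
      using True good_swap[OF g(1) ok1, of "vpart S xs" a b "vpart S ys"]
        good_swap[OF g(2) ok2, of "vpart (- S) xs" a b "vpart (- S) ys"]
      by (cases "a \<in> S"; cases "b \<in> S")
        (simp_all add: tensor_def ksign_swap[of S xs b a] tens_minus svec.scale_minus_right svec.scale_minus_left)
  qed (simp add: tensor_def)
next
  case (3 vs v \<mu> \<mu>')
  show ?case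
  proof (cases "monochrome S v \<mu>")
    case True
    have "\<Phi> (vpart S vs) v (epart S v \<mu>') = \<Phi> (vpart S vs) v (epart S v \<mu>)"
      by (rule good_mset[OF g(1) ok_part[OF 3(1) True] epart_mset[OF 3(2)]])
    moreover have "\<Psi> (vpart (- S) vs) v (epart (- S) v \<mu>') = \<Psi> (vpart (- S) vs) v (epart (- S) v \<mu>)"
      by (rule good_mset[OF g(2) ok_part[OF 3(1)] epart_mset[OF 3(2)]]) (simp add: True)
    ultimately show ?thesis by (simp add: tensor_def monochrome_mset[OF 3(2)])
  qed (simp add: tensor_def monochrome_mset[OF 3(2)])
next
  case (4 vs v h k \<nu>)
  have m: "monochrome S v ((k, h) # \<nu>) = monochrome S v ((h, k) # \<nu>)" by (auto simp: monochrome_def)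
  show ?case
  proof (cases "monochrome S v ((h, k) # \<nu>)")
    case True
    note ok1 = ok_part[OF 4 True]
    have ok2: "ok (vpart (- S) vs) v (epart (- S) v ((h, k) # \<nu>))" using ok_part[OF 4, of "- S"] True by simp
    have hk: "v h \<in> S \<longleftrightarrow> v k \<in> S" using True by (simp add: monochrome_def)
    show ?thesis
      using True m hk good_rev[OF g(1) ok1, of h k "epart S v \<nu>"] good_rev[OF g(2) ok2, of h k "epart (- S) v \<nu>"]
      by (cases "v h \<in> S") (simp_all add: tensor_def tens_minus svec.scale_minus_right)
  qed (simp add: tensor_def m)
next
  case (5 vs v \<mu> \<rho>)
  then show ?case by (intro tensor_rename[OF g]) auto
qed


subsection \<open>Gluing within one tensor factor\<close>

text \<open>Both sides of the first identity are the sign of bringing \<open>w\<close> to the front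
  with the rest sorted behind it: the left side moves \<open>w\<close> before sorting, the right
  side after.\<close>

lemma ksign_remove1:
  assumes "distinct vs" "w \<in> set vs" "w \<in> S"
  shows "(-1) ^ pos vs w * ksign S (remove1 w vs) = (ksign S vs * (-1) ^ pos (vpart S vs) w :: 'k::field)"
    and "length (vpart S vs) = Suc (length (vpart S (remove1 w vs)))"
proof -
  have "(-1) ^ pos vs w * ksign S (remove1 w vs) = (ksign S vs * (-1) ^ pos (vpart S vs) w :: 'k::field)
    \<and> length (vpart S vs) = Suc (length (vpart S (remove1 w vs)))"
    using assms by (induction vs) (auto simp: algebra_simps)
  then show "(-1) ^ pos vs w * ksign S (remove1 w vs) = (ksign S vs * (-1) ^ pos (vpart S vs) w :: 'k::field)"
    "length (vpart S vs) = Suc (length (vpart S (remove1 w vs)))" by auto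
qed

text \<open>Here \<open>w\<close> must in addition pass all vertices in \<open>S\<close> once the
  list is sorted. The extra factor will become the sign \<open>(-1) ^ nv X\<close> in
  \<open>dH2\<close>.\<close>

lemma ksign_remove1':
  assumes "distinct vs" "w \<in> set vs" "w \<notin> S"
  shows "(-1) ^ pos vs w * ksign S (remove1 w vs)
    = ((-1) ^ length (vpart S vs) * ksign S vs * (-1) ^ pos (vpart (- S) vs) w :: 'k::field)"
    and "vpart S (remove1 w vs) = vpart S vs"
proof -
  have "(-1) ^ pos vs w * ksign S (remove1 w vs)
    = ((-1) ^ length (vpart S vs) * ksign S vs * (-1) ^ pos (vpart (- S) vs) w :: 'k::field)
    \<and> vpart S (remove1 w vs) = vpart S vs"
    using assms
  proof (induction vs)
    case (Cons a vs)
    show ?case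
    proof (cases "w = a \<or> a \<in> S")
      case True
      then show ?thesis using Cons by (auto simp: mult_ac)
    next
      case False
      then have IH: "(-1) ^ pos vs w * ksign S (remove1 w vs)
        = ((-1) ^ length (vpart S vs) * ksign S vs * (-1) ^ pos (vpart (- S) vs) w :: 'k)"
        "vpart S (remove1 w vs) = vpart S vs"
        using Cons by auto
      have "(-1) ^ pos (a # vs) w * ksign S (remove1 w (a # vs))
          = - ((-1) ^ length (vpart S vs) * ((-1) ^ pos vs w * ksign S (remove1 w vs)) :: 'k)"
        using False IH(2) by simp
      also have "\<dots> = (-1) ^ length (vpart S (a # vs)) * ksign S (a # vs) * (-1) ^ pos (vpart (- S) (a # vs)) w"
        unfolding IH(1) using False by simp
      finally show ?thesis using False IH(2) by auto
    qed
  qed simp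
  then show "(-1) ^ pos vs w * ksign S (remove1 w vs)
    = ((-1) ^ length (vpart S vs) * ksign S vs * (-1) ^ pos (vpart (- S) vs) w :: 'k::field)"
    "vpart S (remove1 w vs) = vpart S vs" by auto
qed

lemma vpart_remove1: "w \<in> S \<Longrightarrow> vpart S (remove1 w vs) = remove1 w (vpart S vs)"
  by (induction vs) (auto simp: remove1_idem)

lemma par_epart:
  assumes d: "distinct_halves \<mu>" and m: "monochrome S v \<mu>" and h: "h \<in> halves \<mu>" "v h \<in> S"
  shows "par (epart S v \<mu>) h = par \<mu> h" "sg (epart S v \<mu>) h = (sg \<mu> h :: 'k::field)" "v (par \<mu> h) \<in> S"
proof -
  have d': "distinct_halves (epart S v \<mu>)" unfolding epart_def by (rule distinct_halves_filter[OF d])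
  have "par (epart S v \<mu>) h = par \<mu> h \<and> sg (epart S v \<mu>) h = (sg \<mu> h :: 'k) \<and> v (par \<mu> h) \<in> S"
    using h(1)
  proof (rule halvesE)
    fix a assume a: "(h, a) \<in> set \<mu>"
    then have "(h, a) \<in> set (epart S v \<mu>)" using h by (simp add: epart_def)
    then show ?thesis using monochrome_halves[OF m a] h by (simp add: par_sg_in[OF d a] par_sg_in[OF d' \<open>_ \<in> set (epart S v \<mu>)\<close>])
  next
    fix a assume a: "(a, h) \<in> set \<mu>"
    then have "(a, h) \<in> set (epart S v \<mu>)" using h monochrome_halves[OF m a] by (simp add: epart_def)
    then show ?thesis using monochrome_halves[OF m a] h by (simp add: par_sg_in[OF d a] par_sg_in[OF d' \<open>_ \<in> set (epart S v \<mu>)\<close>])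
  qed
  then show "par (epart S v \<mu>) h = par \<mu> h" "sg (epart S v \<mu>) h = (sg \<mu> h :: 'k)" "v (par \<mu> h) \<in> S" by auto
qed

lemma merge_mem: "x \<in> S \<longleftrightarrow> y \<in> S \<Longrightarrow> merge x y z \<in> S \<longleftrightarrow> z \<in> S"
  by (auto simp: merge_def)

text \<open>Gluing inside a colour class moves no edge between classes: the new edge joins the
  complements of \<open>h\<close> and \<open>k\<close>, which have the same colour as
  \<open>h\<close> and \<open>k\<close>.\<close>

lemma part_rewire:
  assumes d: "distinct_halves \<mu>" and m: "monochrome S v \<mu>"
    and h: "h \<in> halves \<mu>" "v h \<in> S" and k: "k \<in> halves \<mu>" "v k \<in> S"
  shows "monochrome S (merge (v h) (v k) \<circ> v) (rewire \<mu> h k)"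
    and "epart S (merge (v h) (v k) \<circ> v) (rewire \<mu> h k) = rewire (epart S v \<mu>) h k"
    and "epart (- S) (merge (v h) (v k) \<circ> v) (rewire \<mu> h k) = epart (- S) v \<mu>"
proof -
  let ?v = "merge (v h) (v k) \<circ> v"
  have S: "?v g \<in> S \<longleftrightarrow> v g \<in> S" for g using h(2) k(2) by (simp add: merge_mem)
  note ph = par_epart(1,3)[OF d m h] and pk = par_epart(1,3)[OF d m k]
  show "monochrome S ?v (rewire \<mu> h k)"
    using m ph pk S unfolding monochrome_def rewire_def by auto
  have "epart S ?v (rewire \<mu> h k) = epart S v (rewire \<mu> h k)"
    using S by (intro epart_cong) simp
  also have "\<dots> = rewire (epart S v \<mu>) h k"
    using ph pk by (simp add: rewire_def epart_def conj_commute)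
  finally show "epart S ?v (rewire \<mu> h k) = rewire (epart S v \<mu>) h k" .
  have "epart (- S) ?v (rewire \<mu> h k) = epart (- S) v (rewire \<mu> h k)"
    using S by (intro epart_cong) simp
  also have "\<dots> = filter (\<lambda>e. untouched h k e \<and> v (fst e) \<notin> S) \<mu>"
    using pk by (simp add: rewire_def epart_def conj_commute)
  also have "\<dots> = epart (- S) v \<mu>"
    unfolding epart_def using h k m by (intro filter_cong refl) (auto simp: untouched_def monochrome_def)
  finally show "epart (- S) ?v (rewire \<mu> h k) = epart (- S) v \<mu>" .
qed

lemma cuttable_epart:
  assumes "distinct_halves \<mu>" "monochrome S v \<mu>" "h \<in> halves \<mu>" "k \<in> halves \<mu>" "v h \<in> S" "v k \<in> S"
  shows "cuttable v (epart S v \<mu>) h k = cuttable v \<mu> h k"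
  using par_epart(1)[OF assms(1,2,3,5)] assms by (simp add: cuttable_def halves_epart)

text \<open>\<open>\<Psi>\<close> sees the incidence map only at half-edges outside
  \<open>S\<close>, where merging \<open>v k\<close> into \<open>v h\<close> changes nothing. The
  sign is that of \<open>ksign_remove1\<close>.\<close>

lemma glue_tensor_left:
  fixes \<Phi> :: "nat list \<Rightarrow> ('h \<Rightarrow> nat) \<Rightarrow> ('h \<times> 'h) list \<Rightarrow> ('b::signed_set, 'k::field) svec"
    and \<Psi> :: "nat list \<Rightarrow> ('h \<Rightarrow> nat) \<Rightarrow> ('h \<times> 'h) list \<Rightarrow> ('c::signed_set, 'k) svec"
  assumes \<Psi>: "good D \<Psi>" and ok: "ok vs v \<mu>" and m: "monochrome S v \<mu>"
    and h: "h \<in> halves \<mu>" "v h \<in> S" and k: "k \<in> halves \<mu>" "v k \<in> S"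
  shows "glue h k (tensor S \<Phi> \<Psi>) vs v \<mu> = ksign S vs *\<^sub>v
    (glue h k \<Phi> (vpart S vs) v (epart S v \<mu>) \<otimes> \<Psi> (vpart (- S) vs) v (epart (- S) v \<mu>))"
proof -
  note d = ok_D[OF ok]
  note c = cuttable_epart[OF d(2) m h(1) k(1) h(2) k(2)]
  show ?thesis
  proof (cases "cuttable v \<mu> h k")
    case True
    note p = part_rewire[OF d(2) m h k]
    have vk: "v k \<in> set vs" "v k \<notin> - S" using d(3)[OF k(1)] k(2) by auto
    have "\<Psi> (vpart (- S) vs) (merge (v h) (v k) \<circ> v) (epart (- S) v \<mu>) = \<Psi> (vpart (- S) vs) v (epart (- S) v \<mu>)"
      by (rule good_cong[OF \<Psi> ok_part[OF ok]]) (use m k(2) in \<open>auto simp: halves_epart merge_def\<close>)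
    then show ?thesis
      using True c p ksign_remove1(1)[OF d(1) vk(1) k(2), where 'k = 'k] ksign_remove1'(2)[OF d(1) vk]
        vpart_remove1[OF k(2), of vs]
      by (simp add: glue_def tensor_def tens_scale_left par_epart[OF d(2) m h] par_epart[OF d(2) m k] mult_ac)
  qed (simp add: glue_def c)
qed

lemma glue_tensor_right:
  fixes \<Phi> :: "nat list \<Rightarrow> ('h \<Rightarrow> nat) \<Rightarrow> ('h \<times> 'h) list \<Rightarrow> ('b::signed_set, 'k::field) svec"
    and \<Psi> :: "nat list \<Rightarrow> ('h \<Rightarrow> nat) \<Rightarrow> ('h \<times> 'h) list \<Rightarrow> ('c::signed_set, 'k) svec"
  assumes \<Phi>: "good C \<Phi>" and ok: "ok vs v \<mu>" and m: "monochrome S v \<mu>"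
    and h: "h \<in> halves \<mu>" "v h \<notin> S" and k: "k \<in> halves \<mu>" "v k \<notin> S"
  shows "glue h k (tensor S \<Phi> \<Psi>) vs v \<mu> = ((-1) ^ length (vpart S vs) * ksign S vs) *\<^sub>v
    (\<Phi> (vpart S vs) v (epart S v \<mu>) \<otimes> glue h k \<Psi> (vpart (- S) vs) v (epart (- S) v \<mu>))"
proof -
  note d = ok_D[OF ok]
  have m': "monochrome (- S) v \<mu>" and h': "v h \<in> - S" and k': "v k \<in> - S" using m h k by auto
  note c = cuttable_epart[OF d(2) m' h(1) k(1) h' k']
  show ?thesis
  proof (cases "cuttable v \<mu> h k")
    case True
    note p = part_rewire[OF d(2) m' h(1) h' k(1) k']
    have vk: "v k \<in> set vs" using d(3)[OF k(1)] .
    have "\<Phi> (vpart S vs) (merge (v h) (v k) \<circ> v) (epart S v \<mu>) = \<Phi> (vpart S vs) v (epart S v \<mu>)"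
      by (rule good_cong[OF \<Phi> ok_part[OF ok m]]) (use m k(2) in \<open>auto simp: halves_epart merge_def\<close>)
    then show ?thesis
      using True c p ksign_remove1'(1)[OF d(1) vk k(2), where 'k = 'k] ksign_remove1'(2)[OF d(1) vk k(2)] vpart_remove1[OF k', of vs]
      by (simp add: glue_def tensor_def tens_scale_right par_epart[OF d(2) m' h(1) h'] par_epart[OF d(2) m' k(1) k'] mult_ac)
  qed (simp add: glue_def c)
qed

section \<open>The coproduct on marked graphs\<close>

definition split2 :: "nat set \<Rightarrow> nat list \<Rightarrow> ('h \<Rightarrow> nat) \<Rightarrow> ('h \<times> 'h) list \<Rightarrow> 'k::field graph_space2" where
  "split2 S = tensor S gvec gvec"

text \<open>Monochrome subsets are unions of components, so this distributes the components over the
  two factors in all possible ways.\<close>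

definition cop :: "nat list \<Rightarrow> ('h \<Rightarrow> nat) \<Rightarrow> ('h \<times> 'h) list \<Rightarrow> 'k::field graph_space2" where
  "cop vs v \<mu> = (\<Sum>S\<in>Pow (set vs). split2 S vs v \<mu>)"

lemma good_split2: "good {S} (split2 S)"
  unfolding split2_def using good_tensor[OF good_gvec good_gvec, of S] by simp

lemma split2_rename:
  assumes "ok vs v \<mu>" "inj_on \<rho> (set vs)" "\<And>x. x \<in> set vs \<Longrightarrow> \<rho> x \<in> S' \<longleftrightarrow> x \<in> S"
  shows "split2 S' (map \<rho> vs) (\<rho> \<circ> v) \<mu> = split2 S vs v \<mu>"
  unfolding split2_def using assms by (intro tensor_rename[OF good_gvec good_gvec]) auto

lemma good_cop: "good {} cop"
proof (rule goodI, goal_cases)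
  case 1 then show ?case unfolding cop_def by (intro sum.cong refl good_cong[OF good_split2])
next
  case (2 xs a b ys v \<mu>)
  have "set (xs @ b # a # ys) = set (xs @ a # b # ys)" by auto
  then show ?case unfolding cop_def sum_negf[symmetric]
    by (intro sum.cong good_swap[OF good_split2 2 refl]) simp
next
  case 3 then show ?case unfolding cop_def by (intro sum.cong refl good_mset[OF good_split2])
next
  case 4 then show ?case unfolding cop_def sum_negf[symmetric]
    by (intro sum.cong refl good_rev[OF good_split2 _ refl])
next
  case (5 vs v \<mu> \<rho>)
  have "Pow (set (map \<rho> vs)) = (`) \<rho> ` Pow (set vs)"
    using 5(2) by (auto simp: image_iff) (metis Pow_iff image_Pow_surj imageE)
  moreover have "inj_on ((`) \<rho>) (Pow (set vs))" using 5(2) by (rule inj_on_image_Pow)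
  ultimately have "cop (map \<rho> vs) (\<rho> \<circ> v) \<mu> = (\<Sum>S\<in>Pow (set vs). split2 (\<rho> ` S) (map \<rho> vs) (\<rho> \<circ> v) \<mu>)"
    by (simp add: cop_def sum.reindex)
  also have "\<dots> = cop vs v \<mu>"
    unfolding cop_def
    by (intro sum.cong refl split2_rename[OF 5(1,2)]) (use 5(2) in \<open>auto simp: inj_on_image_mem_iff\<close>)
  finally show ?case .
qed

lemma split2_hrename: "split2 S vs v (map (map_prod \<eta> \<eta>) \<mu>) = split2 S vs (v \<circ> \<eta>) \<mu>"
proof -
  have m: "monochrome S v (map (map_prod \<eta> \<eta>) \<mu>) = monochrome S (v \<circ> \<eta>) \<mu>" by (auto simp: monochrome_def)
  have e: "epart T v (map (map_prod \<eta> \<eta>) \<mu>) = map (map_prod \<eta> \<eta>) (epart T (v \<circ> \<eta>) \<mu>)" for T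
    by (simp add: epart_def filter_map comp_def)
  show ?thesis by (simp add: split2_def tensor_def m e gvec_hrename)
qed

lemma cop_hrename: "cop vs v (map (map_prod \<eta> \<eta>) \<mu>) = cop vs (v \<circ> \<eta>) \<mu>"
  by (simp add: cop_def split2_hrename)

definition cop_map :: "'k::field graph_space \<Rightarrow> 'k graph_space2" where
  "cop_map = lext (\<lambda>X. cop (canon_vs X) (end_of (edges X)) (std (length (edges X))))"

lemma linear_cop_map: "Vector_Spaces.linear (*\<^sub>v) (*\<^sub>v) (cop_map :: 'k::field graph_space \<Rightarrow> _)"
  and cop_map_cls: "cop_map (cls X) = (cop (canon_vs X) (end_of (edges X)) (std (length (edges X))) :: 'k::field graph_space2)"
  unfolding cop_map_def by (rule lext_cls; rule good_srel[OF good_cop cop_hrename]; assumption)+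

lemma cop_map_gvec: "ok vs v \<mu> \<Longrightarrow> cop_map (gvec vs v \<mu>) = (cop vs v \<mu> :: 'k::field graph_space2)"
  unfolding gvec_def cop_map_cls by (rule canonize[OF good_cop good_cop cop_hrename])


subsection \<open>Disjoint unions\<close>

lemma nv_disjoint_union: "nv (disjoint_union X Y) = nv X + nv Y"
  and edges_disjoint_union:
    "edges (disjoint_union X Y) = edges X @ map (map_prod ((+) (nv X)) ((+) (nv X))) (edges Y)"
  by (transfer, auto)+

lemma
  assumes 1: "ok vs v \<mu>" and 2: "ok ws v \<nu>" and disj: "set vs \<inter> set ws = {}"
  shows ok_append: "ok (vs @ ws) v (\<mu> @ \<nu>)"
    and mk_append: "mk (vs @ ws) v (\<mu> @ \<nu>) = disjoint_union (mk vs v \<mu>) (mk ws v \<nu>)"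
proof -
  note d1 = ok_D[OF 1] and d2 = ok_D[OF 2]
  have disj_h: "halves \<mu> \<inter> halves \<nu> = {}" using d1(3) d2(3) disj by blast
  have dh: "distinct_halves (\<mu> @ \<nu>)"
    using d1(2) d2(2) disj_h by (auto simp: distinct_halves_def halves_def)
  have "{h \<in> halves (\<mu> @ \<nu>). v h = x} = {h \<in> halves \<mu>. v h = x}" if "x \<in> set vs" for x
    using that d2(3) disj by auto
  moreover have "{h \<in> halves (\<mu> @ \<nu>). v h = x} = {h \<in> halves \<nu>. v h = x}" if "x \<in> set ws" for x
    using that d1(3) disj by auto
  ultimately have "3 \<le> card {h \<in> halves (\<mu> @ \<nu>). v h = x}" if "x \<in> set (vs @ ws)" for x
    using that d1(4) d2(4) by (metis Un_iff set_append)
  then show ok: "ok (vs @ ws) v (\<mu> @ \<nu>)"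
    using d1 d2 disj dh by (auto simp: ok_def)
  show "mk (vs @ ws) v (\<mu> @ \<nu>) = disjoint_union (mk vs v \<mu>) (mk ws v \<nu>)"
  proof (rule lgraph_eqI)
    have "map (map_prod (\<lambda>h. Suc (pos (vs @ ws) (v h))) (\<lambda>h. Suc (pos (vs @ ws) (v h)))) \<mu>
       = map (map_prod (\<lambda>h. Suc (pos vs (v h))) (\<lambda>h. Suc (pos vs (v h)))) \<mu>"
      by (rule map_halves_cong) (simp add: pos_append d1(3))
    moreover have "map (map_prod (\<lambda>h. Suc (pos (vs @ ws) (v h))) (\<lambda>h. Suc (pos (vs @ ws) (v h)))) \<nu>
       = map (map_prod (\<lambda>h. length vs + Suc (pos ws (v h))) (\<lambda>h. length vs + Suc (pos ws (v h)))) \<nu>"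
      by (rule map_halves_cong) (use d2(3) disj in \<open>auto simp: pos_append\<close>)
    moreover have "map_prod ((+) n) ((+) n) (map_prod f f e) = map_prod (\<lambda>h. n + f h) (\<lambda>h. n + f h) e"
      for n :: nat and f and e :: "'a \<times> 'a" by (cases e) simp
    ultimately show "edges (mk (vs @ ws) v (\<mu> @ \<nu>)) = edges (disjoint_union (mk vs v \<mu>) (mk ws v \<nu>))"
      by (simp only: edges_mk[OF ok] edges_disjoint_union edges_mk[OF 1] edges_mk[OF 2] nv_mk[OF 1]
          map_append map_map comp_def)
  qed (simp add: nv_mk[OF ok] nv_disjoint_union nv_mk[OF 1] nv_mk[OF 2])
qed

lemma relabel_transpose_disjoint_union:
  assumes "u \<in> {1..nv X}" "w \<in> {1..nv X}"
  shows "disjoint_union (relabel (transpose u w) X) Z = relabel (transpose u w) (disjoint_union X Z)"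
proof (rule lgraph_eqI)
  have p: "transpose u w permutes {1..nv X}" and p': "transpose u w permutes {1..nv (disjoint_union X Z)}"
    using assms by (auto intro!: permutes_swap_id simp: nv_disjoint_union)
  have "transpose u w (nv X + x) = nv X + x" if "1 \<le> x" for x
    using assms that by (auto simp: transpose_def)
  then show "edges (disjoint_union (relabel (transpose u w) X) Z) = edges (relabel (transpose u w) (disjoint_union X Z))"
    using edges_in(1,2)[of _ Z]
    by (auto simp: edges_disjoint_union edges_relabel[OF p] edges_relabel[OF p'])
qed (simp add: nv_disjoint_union)

lemma relabel_transpose_disjoint_union':
  assumes "u \<in> {1..nv Z}" "w \<in> {1..nv Z}"
  shows "disjoint_union X (relabel (transpose u w) Z)
    = relabel (transpose (nv X + u) (nv X + w)) (disjoint_union X Z)"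
proof (rule lgraph_eqI)
  let ?t = "transpose (nv X + u) (nv X + w)"
  have p: "transpose u w permutes {1..nv Z}" and p': "?t permutes {1..nv (disjoint_union X Z)}"
    using assms by (auto intro!: permutes_swap_id simp: nv_disjoint_union)
  have 1: "?t x = x" if "x \<le> nv X" for x
    using assms that by (auto simp: transpose_def)
  have 2: "?t (nv X + x) = nv X + transpose u w x" for x by (auto simp: transpose_def)
  have "map (map_prod ?t ?t) (edges X) = edges X"
    using edges_in(1,2)[of _ X] 1 by (intro map_idI) (auto simp: prod_eq_iff)
  then show "edges (disjoint_union X (relabel (transpose u w) Z)) = edges (relabel ?t (disjoint_union X Z))"
    using 2
    by (auto simp: edges_disjoint_union edges_relabel[OF p] edges_relabel[OF p'])
qed (simp add: nv_disjoint_union)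

lemma
  assumes "srel X \<epsilon> X'"
  shows disjoint_union_srel_left:
      "(cls (disjoint_union X Z) :: (lgraph, 'k::field) svec) = of_int \<epsilon> *\<^sub>v cls (disjoint_union X' Z)"
    and disjoint_union_srel_right:
      "(cls (disjoint_union Z X) :: (lgraph, 'k::field) svec) = of_int \<epsilon> *\<^sub>v cls (disjoint_union Z X')"
proof -
  have "srel (disjoint_union X Z) \<epsilon> (disjoint_union X' Z) \<and> srel (disjoint_union Z X) \<epsilon> (disjoint_union Z X')"
  proof -
    from assms consider "\<epsilon> = 1" "nv X = nv X'" "mset (edges X) = mset (edges X')"
      | i where "\<epsilon> = -1" "i < length (edges X)" "X' = reverse_arrow i X"
      | u w where "\<epsilon> = -1" "u \<in> {1..nv X}" "w \<in> {1..nv X}" "u \<noteq> w" "X' = relabel (transpose u w) X"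
      unfolding srel_lgraph_def by blast
    then show ?thesis
    proof cases
      case 1
      then show ?thesis by (simp add: srel_lgraph_def nv_disjoint_union edges_disjoint_union)
    next
      case (2 i)
      have a: "disjoint_union X' Z = reverse_arrow i (disjoint_union X Z)"
        using 2 by (intro lgraph_eqI)
          (auto simp: nv_disjoint_union edges_disjoint_union edges_reverse_arrow list_update_append nth_append)
      have b: "disjoint_union Z X' = reverse_arrow (length (edges Z) + i) (disjoint_union Z X)"
        using 2 by (intro lgraph_eqI)
          (auto simp: nv_disjoint_union edges_disjoint_union edges_reverse_arrow list_update_append nth_append
            map_update prod.swap_def)
      have "i < length (edges (disjoint_union X Z))" "length (edges Z) + i < length (edges (disjoint_union Z X))"
        using 2 by (auto simp: edges_disjoint_union)
      then show ?thesis unfolding srel_lgraph_def using 2(1) a b by blast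
    next
      case (3 u w)
      have a: "disjoint_union X' Z = relabel (transpose u w) (disjoint_union X Z)"
        using 3 by (simp add: relabel_transpose_disjoint_union)
      have b: "disjoint_union Z X' = relabel (transpose (nv Z + u) (nv Z + w)) (disjoint_union Z X)"
        using 3 by (simp add: relabel_transpose_disjoint_union')
      have "u \<in> {1..nv (disjoint_union X Z)}" "w \<in> {1..nv (disjoint_union X Z)}"
        "nv Z + u \<in> {1..nv (disjoint_union Z X)}" "nv Z + w \<in> {1..nv (disjoint_union Z X)}"
        "nv Z + u \<noteq> nv Z + w"
        using 3 by (auto simp: nv_disjoint_union)
      then show ?thesis unfolding srel_lgraph_def using 3(1,4) a b by blast
    qed
  qed
  then show "(cls (disjoint_union X Z) :: (lgraph, 'k) svec) = of_int \<epsilon> *\<^sub>v cls (disjoint_union X' Z)"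
    "(cls (disjoint_union Z X) :: (lgraph, 'k) svec) = of_int \<epsilon> *\<^sub>v cls (disjoint_union Z X')"
    by (blast intro: srel_cls)+
qed

lemma srel_nv: "srel X \<epsilon> Y \<Longrightarrow> nv X = nv Y"
  by (auto simp: srel_lgraph_def)

section \<open>The product on the tensor square\<close>

lemma mult2_inner:
  fixes X Y :: lgraph
  defines "f \<equiv> \<lambda>(Z, W). (-1) ^ (nv Y * nv Z) *\<^sub>v (cls (disjoint_union X Z, disjoint_union Y W) :: 'k::field graph_space2)"
  shows "Vector_Spaces.linear (*\<^sub>v) (*\<^sub>v) (lext f)"
    and "lext f (cls (Z, W)) = (-1) ^ (nv Y * nv Z) *\<^sub>v cls (disjoint_union X Z, disjoint_union Y W)"
proof -
  have *: "f p = of_int \<epsilon> *\<^sub>v f q" if "srel p \<epsilon> q" for p q \<epsilon>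
  proof -
    obtain Z W Z' W' where pq: "p = (Z, W)" "q = (Z', W')" by (cases p; cases q)
    from that[unfolded srel_prod_def pq] show ?thesis
    proof (elim disjE conjE)
      assume "srel (fst (Z, W)) \<epsilon> (fst (Z', W'))" "snd (Z, W) = snd (Z', W')"
      then show ?thesis
        by (simp add: f_def pq srel_nv disjoint_union_srel_left disjoint_union_srel_right[of Z \<epsilon> Z'] tens_scale_left mult.commute
          flip: cls_tens_cls)
    next
      assume "fst (Z, W) = fst (Z', W')" "srel (snd (Z, W)) \<epsilon> (snd (Z', W'))"
      then show ?thesis
        by (simp add: f_def pq disjoint_union_srel_right[of W \<epsilon> W'] tens_scale_right mult.commute
          flip: cls_tens_cls)
    qed
  qed
  show "Vector_Spaces.linear (*\<^sub>v) (*\<^sub>v) (lext f)" by (rule lext_cls[OF *])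
  show "lext f (cls (Z, W)) = (-1) ^ (nv Y * nv Z) *\<^sub>v cls (disjoint_union X Z, disjoint_union Y W)"
    by (subst lext_cls[OF *]) (auto simp: f_def)
qed

lemma
  fixes t :: "'k::field graph_space2"
  shows linear_mult2_left: "Vector_Spaces.linear (*\<^sub>v) (*\<^sub>v) (\<lambda>s. mult2 s t)"
    and mult2_cls_left: "mult2 (cls (X, Y)) t = lext (\<lambda>(Z, W).
     (-1) ^ (nv Y * nv Z) *\<^sub>v cls (disjoint_union X Z, disjoint_union Y W)) t"
proof -
  define g :: "lgraph \<times> lgraph \<Rightarrow> 'k graph_space2 \<Rightarrow> 'k graph_space2" where
    "g = (\<lambda>(X, Y). lext (\<lambda>(Z, W). (-1) ^ (nv Y * nv Z) *\<^sub>v cls (disjoint_union X Z, disjoint_union Y W)))"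
  have "g p t = of_int \<epsilon> *\<^sub>v g q t" if "srel p \<epsilon> q" for p q \<epsilon>
  proof -
    obtain X Y X' Y' where pq: "p = (X, Y)" "q = (X', Y')" by (cases p; cases q)
    have "g p = (\<lambda>t. of_int \<epsilon> *\<^sub>v g q t)"
    proof (rule linear_eq_on_cls)
      show "Vector_Spaces.linear (*\<^sub>v) (*\<^sub>v) (g p)" by (simp add: g_def pq mult2_inner)
      show "Vector_Spaces.linear (*\<^sub>v) (*\<^sub>v) (\<lambda>t. of_int \<epsilon> *\<^sub>v g q t)"
        by (rule linear_scale_comp) (simp add: g_def pq mult2_inner)
      fix r :: "lgraph \<times> lgraph"
      obtain Z W where r: "r = (Z, W)" by fastforce
      from that[unfolded srel_prod_def pq] show "g p (cls r) = of_int \<epsilon> *\<^sub>v g q (cls r)"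
      proof (elim disjE conjE)
        assume "srel (fst (X, Y)) \<epsilon> (fst (X', Y'))" "snd (X, Y) = snd (X', Y')"
        then show ?thesis
          by (simp add: g_def pq r mult2_inner)
            (simp add: disjoint_union_srel_left[of X \<epsilon> X'] tens_scale_left mult.commute flip: cls_tens_cls)
      next
        assume "fst (X, Y) = fst (X', Y')" "srel (snd (X, Y)) \<epsilon> (snd (X', Y'))"
        then show ?thesis
          by (simp add: g_def pq r mult2_inner)
            (simp add: srel_nv disjoint_union_srel_left[of Y \<epsilon> Y'] tens_scale_right mult.commute flip: cls_tens_cls)
      qed
    qed
    then show ?thesis by (rule fun_cong)
  qed
  from lext_cls[of "\<lambda>p. g p t", OF this]
  have *: "Vector_Spaces.linear (*\<^sub>v) (*\<^sub>v) (lext (\<lambda>p. g p t))" "lext (\<lambda>p. g p t) (cls (X, Y)) = g (X, Y) t" by auto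
  have "mult2 s t = lext (\<lambda>p. g p t) s" for s
    by (simp add: mult2_def g_def case_prod_unfold)
  then show "Vector_Spaces.linear (*\<^sub>v) (*\<^sub>v) (\<lambda>s. mult2 s t)"
    and "mult2 (cls (X, Y)) t = lext (\<lambda>(Z, W).
     (-1) ^ (nv Y * nv Z) *\<^sub>v cls (disjoint_union X Z, disjoint_union Y W)) t"
    using * by (simp_all add: g_def)
qed

lemma mult2_cls:
  "mult2 (cls (X, Y)) (cls (Z, W)) = (-1) ^ (nv Y * nv Z) *\<^sub>v
    (cls (disjoint_union X Z, disjoint_union Y W) :: 'k::field graph_space2)"
  by (simp only: mult2_cls_left mult2_inner)

lemma linear_mult2_right: "Vector_Spaces.linear (*\<^sub>v) (*\<^sub>v) (\<lambda>t. mult2 s t :: 'k::field graph_space2)"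
proof -
  have l: "mult2 (a + b) t = mult2 a t + mult2 b t" "mult2 (c *\<^sub>v a) t = c *\<^sub>v mult2 a t"
    for a b t :: "'k graph_space2" and c
    using linear_mult2_left[of t] by (auto simp: Vector_Spaces.linear_iff)
  have i: "mult2 (cls p) (a + b) = mult2 (cls p) a + mult2 (cls p) b" "mult2 (cls p) (c *\<^sub>v a) = c *\<^sub>v mult2 (cls p) a"
    for a b :: "'k graph_space2" and c p
    using mult2_inner(1)[of "snd p" "fst p", where 'k = 'k] mult2_cls_left[of "fst p" "snd p", where 'k = 'k]
    by (auto simp: Vector_Spaces.linear_iff)
  have "(\<lambda>s. mult2 s (a + b)) = (\<lambda>s. mult2 s a + mult2 s b)" for a b :: "'k graph_space2"
    by (rule linear_eq_on_cls[of vscale])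
      (auto simp: Vector_Spaces.linear_iff svec.vector_space_axioms l i svec.scale_right_distrib)
  moreover have "(\<lambda>s. mult2 s (c *\<^sub>v a)) = (\<lambda>s. c *\<^sub>v mult2 s a)" for a :: "'k graph_space2" and c
    by (rule linear_eq_on_cls[of vscale])
      (auto simp: Vector_Spaces.linear_iff svec.vector_space_axioms l i svec.scale_right_distrib mult.commute)
  ultimately show ?thesis
    by (auto simp: Vector_Spaces.linear_iff svec.vector_space_axioms fun_eq_iff)
qed

subsection \<open>Multiplicativity\<close>

text \<open>After both parts are sorted, the vertices of the second part in \<open>S\<close> still
  have to cross those of the first part outside \<open>S\<close>. This crossing is the sign
  \<open>(-1) ^ (nv Y * nv Z)\<close> of \<open>mult2\<close>.\<close>

lemma ksign_append:
  "ksign S (xs @ ys) = ksign S xs * ksign S ys * (-1) ^ (length (vpart (- S) xs) * length (vpart S ys))"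
  by (induction xs) (auto simp: power_add algebra_simps)

lemma vpart_cong: "(\<And>x. x \<in> set vs \<Longrightarrow> x \<in> S \<longleftrightarrow> x \<in> S') \<Longrightarrow> vpart S vs = vpart S' vs"
  unfolding vpart_def by (intro filter_cong) auto

lemma ksign_cong: "(\<And>x. x \<in> set vs \<Longrightarrow> x \<in> S \<longleftrightarrow> x \<in> S') \<Longrightarrow> ksign S vs = ksign S' vs"
  by (induction vs) (auto cong: vpart_cong)

lemma tensor_cong:
  fixes \<Phi> :: "nat list \<Rightarrow> ('h \<Rightarrow> nat) \<Rightarrow> ('h \<times> 'h) list \<Rightarrow> ('b::signed_set, 'k::field) svec"
    and \<Psi> :: "nat list \<Rightarrow> ('h \<Rightarrow> nat) \<Rightarrow> ('h \<times> 'h) list \<Rightarrow> ('c::signed_set, 'k) svec"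
  assumes ok: "ok vs v \<mu>" and S: "\<And>x. x \<in> set vs \<Longrightarrow> x \<in> S \<longleftrightarrow> x \<in> S'"
  shows "tensor S \<Phi> \<Psi> vs v \<mu> = tensor S' \<Phi> \<Psi> vs v \<mu>"
proof -
  have S': "v h \<in> S \<longleftrightarrow> v h \<in> S'" if "h \<in> halves \<mu>" for h using S ok_D(3)[OF ok that] .
  have "vpart S vs = vpart S' vs" "vpart (- S) vs = vpart (- S') vs" "ksign S vs = (ksign S' vs :: 'k)"
    by (intro vpart_cong ksign_cong; use S in auto)+
  moreover have "epart S v \<mu> = epart S' v \<mu>" "epart (- S) v \<mu> = epart (- S') v \<mu>"
    by (intro epart_cong; use S' in auto)+
  moreover have "monochrome S v \<mu> = monochrome S' v \<mu>" by (intro monochrome_cong) (use S' in auto)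
  ultimately show ?thesis by (simp add: tensor_def)
qed

lemma split2_append:
  assumes 1: "ok vs v \<mu>" and 2: "ok ws v \<nu>" and disj: "set vs \<inter> set ws = {}"
    and S: "S \<subseteq> set vs" and T: "T \<subseteq> set ws"
  shows "split2 (S \<union> T) (vs @ ws) v (\<mu> @ \<nu>) = mult2 (split2 S vs v \<mu>) (split2 T ws v \<nu> :: 'k::field graph_space2)"
proof -
  have s: "x \<in> S \<union> T \<longleftrightarrow> x \<in> S" if "x \<in> set vs" for x using that disj T by auto
  have t: "x \<in> S \<union> T \<longleftrightarrow> x \<in> T" if "x \<in> set ws" for x using that disj S by auto
  have vp: "vpart (S \<union> T) vs = vpart S vs" "vpart (- (S \<union> T)) vs = vpart (- S) vs"
    "vpart (S \<union> T) ws = vpart T ws" "vpart (- (S \<union> T)) ws = vpart (- T) ws"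
    by (rule vpart_cong; use s t in auto)+
  have ks: "ksign (S \<union> T) vs = (ksign S vs :: 'k)" "ksign (S \<union> T) ws = (ksign T ws :: 'k)"
    by (rule ksign_cong; use s t in auto)+
  have mo: "monochrome (S \<union> T) v \<mu> = monochrome S v \<mu>" "monochrome (S \<union> T) v \<nu> = monochrome T v \<nu>"
    using ok_D(3)[OF 1] ok_D(3)[OF 2] s t by (auto intro!: monochrome_cong simp del: Un_iff)
  have ep: "epart (S \<union> T) v \<mu> = epart S v \<mu>" "epart (- (S \<union> T)) v \<mu> = epart (- S) v \<mu>"
    "epart (S \<union> T) v \<nu> = epart T v \<nu>" "epart (- (S \<union> T)) v \<nu> = epart (- T) v \<nu>"
    using ok_D(3)[OF 1] ok_D(3)[OF 2] s t by (auto intro!: epart_cong simp del: Un_iff)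
  have ma: "monochrome (S \<union> T) v (\<mu> @ \<nu>) \<longleftrightarrow> monochrome S v \<mu> \<and> monochrome T v \<nu>"
    unfolding mo[symmetric] by (auto simp: monochrome_def)
  have lin: "mult2 0 b = 0" "mult2 a 0 = 0" "mult2 (c *\<^sub>v a) b = c *\<^sub>v mult2 a b"
    "mult2 a (c *\<^sub>v b) = c *\<^sub>v mult2 a b" for a b :: "'k graph_space2" and c
  proof -
    show l: "mult2 (c *\<^sub>v a) b = c *\<^sub>v mult2 a b" "mult2 a (c *\<^sub>v b) = c *\<^sub>v mult2 a b" for a b :: "'k graph_space2" and c
      using linear_mult2_left[of b] linear_mult2_right[of a] by (auto simp: Vector_Spaces.linear_iff)
    show "mult2 0 b = 0" "mult2 a 0 = 0" using l(1)[of 0 0 b] l(2)[of a 0 0] by simp_all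
  qed
  show ?thesis
  proof (cases "monochrome S v \<mu> \<and> monochrome T v \<nu>")
    case True
    then have m: "monochrome S v \<mu>" "monochrome T v \<nu>" "monochrome (- S) v \<mu>" "monochrome (- T) v \<nu>" by auto
    note o = ok_part[OF 1 m(1)] ok_part[OF 2 m(2)] ok_part[OF 1 m(3)] ok_part[OF 2 m(4)]
    have "gvec (vpart S vs @ vpart T ws) v (epart S v \<mu> @ epart T v \<nu>)
      = (cls (disjoint_union (mk (vpart S vs) v (epart S v \<mu>)) (mk (vpart T ws) v (epart T v \<nu>))) :: 'k graph_space)"
      unfolding gvec_def by (subst mk_append[OF o(1,2)]) (use disj in auto)
    moreover have "gvec (vpart (- S) vs @ vpart (- T) ws) v (epart (- S) v \<mu> @ epart (- T) v \<nu>)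
      = (cls (disjoint_union (mk (vpart (- S) vs) v (epart (- S) v \<mu>)) (mk (vpart (- T) ws) v (epart (- T) v \<nu>))) :: 'k graph_space)"
      unfolding gvec_def by (subst mk_append[OF o(3,4)]) (use disj in auto)
    ultimately have L: "split2 (S \<union> T) (vs @ ws) v (\<mu> @ \<nu>)
      = (ksign S vs * ksign T ws * (-1) ^ (length (vpart (- S) vs) * length (vpart T ws))) *\<^sub>v
        (cls (disjoint_union (mk (vpart S vs) v (epart S v \<mu>)) (mk (vpart T ws) v (epart T v \<nu>)),
          disjoint_union (mk (vpart (- S) vs) v (epart (- S) v \<mu>)) (mk (vpart (- T) ws) v (epart (- T) v \<nu>))) :: 'k graph_space2)"
      using True
      by (simp only: split2_def tensor_def ma simp_thms if_True vpart_simps(3) epart_simps(3) vp ep ks ksign_append cls_tens_cls)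
    have R: "mult2 (split2 S vs v \<mu>) (split2 T ws v \<nu> :: 'k graph_space2)
      = (ksign S vs * ksign T ws * (-1) ^ (length (vpart (- S) vs) * length (vpart T ws))) *\<^sub>v
        (cls (disjoint_union (mk (vpart S vs) v (epart S v \<mu>)) (mk (vpart T ws) v (epart T v \<nu>)),
          disjoint_union (mk (vpart (- S) vs) v (epart (- S) v \<mu>)) (mk (vpart (- T) ws) v (epart (- T) v \<nu>))))"
      using m by (simp add: split2_def tensor_def gvec_def cls_tens_cls lin mult2_cls
          nv_mk[OF o(2)] nv_mk[OF o(3)])
    show ?thesis unfolding L R ..
  next
    case False
    then show ?thesis using ma lin by (auto simp: split2_def tensor_def)
  qed
qed

text \<open>A subset of a disjoint union is a pair of subsets, so the sum over colourings
  factors.\<close>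

lemma cop_append:
  assumes 1: "ok vs v \<mu>" and 2: "ok ws v \<nu>" and disj: "set vs \<inter> set ws = {}"
  shows "cop (vs @ ws) v (\<mu> @ \<nu>) = mult2 (cop vs v \<mu>) (cop ws v \<nu> :: 'k::field graph_space2)"
proof -
  interpret l: Vector_Spaces.linear "(*\<^sub>v)" "(*\<^sub>v)" "\<lambda>s. mult2 s (t :: 'k graph_space2)" for t
    by (rule linear_mult2_left)
  interpret r: Vector_Spaces.linear "(*\<^sub>v)" "(*\<^sub>v)" "\<lambda>t. mult2 s t :: 'k graph_space2" for s
    by (rule linear_mult2_right)
  have "cop (vs @ ws) v (\<mu> @ \<nu>)
      = (\<Sum>(S, T)\<in>Pow (set vs) \<times> Pow (set ws). split2 (S \<union> T) (vs @ ws) v (\<mu> @ \<nu>) :: 'k graph_space2)"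
    unfolding cop_def
    by (rule sum.reindex_bij_witness[of _ "\<lambda>(S, T). S \<union> T" "\<lambda>U. (U \<inter> set vs, U \<inter> set ws)"])
      (use disj in \<open>auto simp: Int_absorb2 simp flip: Int_Un_distrib\<close>)
  also have "\<dots> = (\<Sum>S\<in>Pow (set vs). \<Sum>T\<in>Pow (set ws). mult2 (split2 S vs v \<mu>) (split2 T ws v \<nu>))"
    unfolding sum.cartesian_product by (intro sum.cong refl) (auto intro!: split2_append[OF 1 2 disj])
  also have "\<dots> = mult2 (cop vs v \<mu>) (cop ws v \<nu>)"
    by (simp add: cop_def l.sum r.sum) (rule sum.swap)
  finally show ?thesis .
qed

text \<open>\<open>cop_append\<close> asks for one incidence map on both graphs; the half-edge names
  and vertices of \<open>Y\<close> are shifted past those of \<open>X\<close>.\<close>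

lemma canon_disjoint_union:
  fixes X Y :: lgraph
  obtains vs ws \<mu> \<nu> and v :: "half_edge \<Rightarrow> nat" where
    "ok vs v \<mu>" "ok ws v \<nu>" "set vs \<inter> set ws = {}" "mk vs v \<mu> = X" "mk ws v \<nu> = Y"
proof -
  define m where "m = length (edges X)"
  define \<eta> :: "half_edge \<Rightarrow> half_edge" where "\<eta> h = (fst h + m, snd h)" for h
  define \<rho> where "\<rho> x = nv X + x" for x
  define v where "v h = (if fst h < m then end_of (edges X) h else \<rho> (end_of (edges Y) (fst h - m, snd h)))"
    for h :: half_edge
  have inj: "inj_on \<eta> A" for A by (auto simp: inj_on_def \<eta>_def)
  have inj': "inj_on \<rho> A" for A by (auto simp: inj_on_def \<rho>_def)
  have v: "v \<circ> \<eta> = \<rho> \<circ> end_of (edges Y)" by (auto simp: v_def \<eta>_def)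
  show ?thesis
  proof (rule that[of "canon_vs X" v "std m" "map \<rho> (canon_vs Y)" "map (map_prod \<eta> \<eta>) (std (length (edges Y)))"])
    have e: "end_of (edges X) h = v h" if "h \<in> halves (std m)" for h
      using that by (auto simp: halves_std v_def)
    show ok1: "ok (canon_vs X) v (std m)"
      by (rule ok_cong[OF ok_canon[of X, folded m_def] e])
    have ok2': "ok (map \<rho> (canon_vs Y)) (\<rho> \<circ> end_of (edges Y)) (std (length (edges Y)))"
      by (rule ok_rename[OF ok_canon inj'])
    then show ok2: "ok (map \<rho> (canon_vs Y)) v (map (map_prod \<eta> \<eta>) (std (length (edges Y))))"
      unfolding ok_hrename[OF inj] v .
    show "set (canon_vs X) \<inter> set (map \<rho> (canon_vs Y)) = {}" by (auto simp: \<rho>_def simp del: upt_Suc)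
    have "mk (canon_vs X) v (std m) = mk (canon_vs X) (end_of (edges X)) (std m)"
      unfolding mk_def Let_def
      by (intro arg_cong[of _ _ Abs_lgraph] arg_cong[of _ _ "Pair _"] map_halves_cong) (simp add: e del: upt_Suc)
    then show "mk (canon_vs X) v (std m) = X" using mk_canon[of X] by (simp add: m_def del: upt_Suc)
    have "mk (map \<rho> (canon_vs Y)) v (map (map_prod \<eta> \<eta>) (std (length (edges Y))))
      = mk (canon_vs Y) (end_of (edges Y)) (std (length (edges Y)))"
    proof (rule lgraph_eqI)
      note ok = ok_canon[of Y]
      show "edges (mk (map \<rho> (canon_vs Y)) v (map (map_prod \<eta> \<eta>) (std (length (edges Y)))))
        = edges (mk (canon_vs Y) (end_of (edges Y)) (std (length (edges Y))))"
        unfolding edges_mk[OF ok] edges_mk[OF ok2] map_map map_prod_compose[symmetric]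
      proof (rule map_halves_cong)
        fix h
        have "v (\<eta> h) = \<rho> (end_of (edges Y) h)" using v by (metis comp_apply)
        then show "((\<lambda>h. Suc (pos (map \<rho> (canon_vs Y)) (v h))) \<circ> \<eta>) h = Suc (pos (canon_vs Y) (end_of (edges Y) h))"
          by (simp add: pos_map[OF inj'] del: upt_Suc)
      qed
    qed (simp add: nv_mk[OF ok2] nv_mk[OF ok_canon] del: upt_Suc)
    then show "mk (map \<rho> (canon_vs Y)) v (map (map_prod \<eta> \<eta>) (std (length (edges Y)))) = Y"
      by (simp only: mk_canon)
  qed
qed

lemma cop_map_disjoint_union:
  "cop_map (cls (disjoint_union X Y)) = mult2 (cop_map (cls X)) (cop_map (cls Y) :: 'k::field graph_space2)"
proof -
  obtain vs ws \<mu> \<nu> and v :: "half_edge \<Rightarrow> nat" where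
    s: "ok vs v \<mu>" "ok ws v \<nu>" "set vs \<inter> set ws = {}" "mk vs v \<mu> = X" "mk ws v \<nu> = Y"
    by (rule canon_disjoint_union)
  show ?thesis
    using cop_map_gvec[OF s(1), where 'k = 'k] cop_map_gvec[OF s(2), where 'k = 'k]
      cop_map_gvec[OF ok_append[OF s(1-3)], where 'k = 'k] mk_append[OF s(1-3)] cop_append[OF s(1-3), where 'k = 'k]
    by (simp add: gvec_def s)
qed

section \<open>The properties that characterize the coproduct\<close>

lemma empty_graph: "nv empty_graph = 0" "edges empty_graph = []"
  by (transfer, simp)+

lemma ok_Nil: "ok [] v []"
  by (simp add: ok_def)

lemma mk_Nil: "mk [] v [] = empty_graph"
  by (rule lgraph_eqI) (simp_all add: nv_mk[OF ok_Nil] edges_mk[OF ok_Nil] empty_graph)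

lemma split2_trivial:
  assumes ok: "ok vs v \<mu>"
  shows "split2 {} vs v \<mu> = (cls empty_graph \<otimes> gvec vs v \<mu> :: 'k::field graph_space2)"
    and "split2 (set vs) vs v \<mu> = (gvec vs v \<mu> \<otimes> cls empty_graph :: 'k::field graph_space2)"
proof -
  have e: "vpart {} vs = []" "epart {} v \<mu> = []" "vpart UNIV vs = vs" "epart UNIV v \<mu> = \<mu>"
    by (simp_all add: vpart_def epart_def)
  have k: "ksign {} xs = (1::'k)" "ksign UNIV xs = (1::'k)" for xs
    by (induction xs) (simp_all add: vpart_def)
  show "split2 {} vs v \<mu> = (cls empty_graph \<otimes> gvec vs v \<mu> :: 'k graph_space2)"
    by (simp add: split2_def tensor_def monochrome_def e k gvec_def[of "[]"] mk_Nil)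
  have "split2 (set vs) vs v \<mu> = (split2 UNIV vs v \<mu> :: 'k graph_space2)"
    unfolding split2_def by (rule tensor_cong[OF ok]) simp
  then show "split2 (set vs) vs v \<mu> = (gvec vs v \<mu> \<otimes> cls empty_graph :: 'k graph_space2)"
    by (simp add: split2_def tensor_def monochrome_def e k gvec_def[of "[]"] mk_Nil)
qed

lemma cop_map_empty: "cop_map (cls empty_graph) = (cls empty_graph \<otimes> cls empty_graph :: 'k::field graph_space2)"
proof -
  have "ok [] (\<lambda>_::nat. 0) []" by (rule ok_Nil)
  from cop_map_gvec[OF this, where 'k = 'k] split2_trivial(1)[OF this, where 'k = 'k]
  show ?thesis by (simp add: gvec_def mk_Nil cop_def)
qed

text \<open>A monochrome set is closed under adjacency, so on a connected graph only the empty and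
  the full set contribute; \<open>1 \<le> nv X\<close> keeps these two apart.\<close>

lemma cop_map_connected:
  assumes "connected_graph X"
  shows "cop_map (cls X) = (cls X \<otimes> cls empty_graph + cls empty_graph \<otimes> cls X :: 'k::field graph_space2)"
proof -
  let ?vs = "canon_vs X" and ?v = "end_of (edges X)" and ?\<mu> = "std (length (edges X))"
  note ok = ok_canon[of X]
  have n: "1 \<le> nv X" using assms by (simp add: connected_graph_def)
  have sv: "set ?vs = {1..nv X}" by auto
  have z: "split2 S ?vs ?v ?\<mu> = (0 :: 'k graph_space2)" if S: "S \<in> Pow (set ?vs) - {{}, set ?vs}" for S
  proof (rule ccontr)
    assume "split2 S ?vs ?v ?\<mu> \<noteq> (0 :: 'k graph_space2)"
    then have m: "monochrome S ?v ?\<mu>" by (auto simp: split2_def tensor_def split: if_splits)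
    have edge: "a \<in> S \<longleftrightarrow> b \<in> S" if "(a, b) \<in> set (edges X)" for a b
    proof -
      have "(a, b) \<in> set (map (map_prod ?v ?v) ?\<mu>)" using that by (simp only: map_std)
      then show ?thesis using m by (auto simp: monochrome_def)
    qed
    have path: "a \<in> S \<longleftrightarrow> b \<in> S" if "(a, b) \<in> (set (edges X) \<union> (set (edges X))\<inverse>)\<^sup>*" for a b
      using that by (induction rule: rtrancl_induct) (use edge in auto)
    obtain a b where "a \<in> S" "b \<in> set ?vs" "b \<notin> S" using S by blast
    moreover from this have "a \<in> {1..nv X}" "b \<in> {1..nv X}" using S sv by auto
    ultimately show False using path[of a b] assms unfolding connected_graph_def by blast
  qed
  have "cop_map (cls X) = (\<Sum>S\<in>Pow (set ?vs). split2 S ?vs ?v ?\<mu> :: 'k graph_space2)"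
    by (simp add: cop_map_cls cop_def del: upt_Suc)
  also have "\<dots> = (\<Sum>S\<in>{{}, set ?vs}. split2 S ?vs ?v ?\<mu>)"
    by (rule sum.mono_neutral_right) (use z in auto)
  also have "\<dots> = split2 {} ?vs ?v ?\<mu> + split2 (set ?vs) ?vs ?v ?\<mu>"
    using n sv by (subst sum.insert) (auto simp del: upt_Suc)
  also have "\<dots> = cls X \<otimes> cls empty_graph + cls empty_graph \<otimes> cls X"
    by (simp only: split2_trivial[OF ok] gvec_canon add.commute)
  finally show ?thesis .
qed

text \<open>The vertices reachable from a fixed one form a monochrome set. Sorting the vertices by
  it exhibits the graph, up to sign, as a disjoint union.\<close>

lemma disconnected_split:
  assumes "nv X \<noteq> 0" "\<not> connected_graph X"
  obtains A B and c :: "'k::field" where "cls X = c *\<^sub>v cls (disjoint_union A B)" "nv A < nv X" "nv B < nv X"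
proof -
  let ?vs = "canon_vs X" and ?v = "end_of (edges X)" and ?\<mu> = "std (length (edges X))"
  let ?R = "set (edges X) \<union> (set (edges X))\<inverse>"
  note ok = ok_canon[of X]
  note d = ok_D[OF ok]
  have sv: "set ?vs = {1..nv X}" by auto
  obtain a b where ab: "a \<in> {1..nv X}" "b \<in> {1..nv X}" "(a, b) \<notin> ?R\<^sup>*"
    using assms unfolding connected_graph_def by (metis less_one not_less)
  define S where "S = {x. (a, x) \<in> ?R\<^sup>*}"
  have aS: "a \<in> S" "b \<notin> S" using ab by (auto simp: S_def)
  have m: "monochrome S ?v ?\<mu>"
    unfolding monochrome_def
  proof
    fix e assume "e \<in> set ?\<mu>"
    then have "map_prod ?v ?v e \<in> set (map (map_prod ?v ?v) ?\<mu>)" by simp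
    then have "(?v (fst e), ?v (snd e)) \<in> set (edges X)" by (simp only: map_std) (simp add: map_prod_def case_prod_unfold)
    then have "(?v (fst e), ?v (snd e)) \<in> ?R" "(?v (snd e), ?v (fst e)) \<in> ?R" by auto
    then show "(?v (fst e) \<in> S) = (?v (snd e) \<in> S)" unfolding S_def by (auto intro: rtrancl_into_rtrancl)
  qed
  then have m': "monochrome (- S) ?v ?\<mu>" by simp
  define vs1 where "vs1 = vpart S ?vs"
  define vs2 where "vs2 = vpart (- S) ?vs"
  define \<mu>1 where "\<mu>1 = epart S ?v ?\<mu>"
  define \<mu>2 where "\<mu>2 = epart (- S) ?v ?\<mu>"
  have o1: "ok vs1 ?v \<mu>1" and o2: "ok vs2 ?v \<mu>2"
    using ok_part[OF ok m] ok_part[OF ok m'] by (simp_all add: vs1_def vs2_def \<mu>1_def \<mu>2_def)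
  have disj: "set vs1 \<inter> set vs2 = {}" by (auto simp: vs1_def vs2_def)
  have "mset (\<mu>1 @ \<mu>2) = mset ?\<mu>"
    by (simp add: \<mu>1_def \<mu>2_def epart_def)
  note ok' = ok_mset[OF ok this[symmetric]]
  have "distinct (vs1 @ vs2)" "set (vs1 @ vs2) = set ?vs"
    using d(1) by (auto simp: vs1_def vs2_def distinct_vpart simp del: upt_Suc)
  then obtain p where p: "p permutes set ?vs" "map p ?vs = vs1 @ vs2"
    using list_permutation[of ?vs "vs1 @ vs2"] d(1) by metis
  have "(cls X :: 'k graph_space) = gvec ?vs ?v (\<mu>1 @ \<mu>2)"
    unfolding gvec_canon[symmetric] by (rule good_mset[OF good_gvec ok, symmetric]) fact
  moreover have "gvec (vs1 @ vs2) ?v (\<mu>1 @ \<mu>2) = of_int (sign p) *\<^sub>v (gvec ?vs ?v (\<mu>1 @ \<mu>2) :: 'k graph_space)"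
    unfolding p(2)[symmetric] by (rule good_permute[OF good_gvec ok' p(1)])
  moreover have "of_int (sign p) * of_int (sign p) = (1::'k)" by (simp add: sign_def)
  ultimately have "(cls X :: 'k graph_space) = of_int (sign p) *\<^sub>v gvec (vs1 @ vs2) ?v (\<mu>1 @ \<mu>2)" by simp
  then have "(cls X :: 'k graph_space) = of_int (sign p) *\<^sub>v cls (disjoint_union (mk vs1 ?v \<mu>1) (mk vs2 ?v \<mu>2))"
    by (simp add: gvec_def mk_append[OF o1 o2 disj] del: upt_Suc)
  moreover have "length vs1 < nv X"
  proof -
    have "length vs1 = card (set vs1)" using ok_D(1)[OF o1] by (simp add: distinct_card)
    also have "set vs1 \<subset> {1..nv X}"
      using ab aS unfolding sv[symmetric] vs1_def vpart_simps(4) by blast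
    then have "card (set vs1) < card {1..nv X}" by (intro psubset_card_mono) auto
    finally show ?thesis by simp
  qed
  moreover have "length vs2 < nv X"
  proof -
    have "length vs2 = card (set vs2)" using ok_D(1)[OF o2] by (simp add: distinct_card)
    also have "set vs2 \<subset> {1..nv X}"
      using ab aS unfolding sv[symmetric] vs2_def vpart_simps(4) by blast
    then have "card (set vs2) < card {1..nv X}" by (intro psubset_card_mono) auto
    finally show ?thesis by simp
  qed
  ultimately show ?thesis
    unfolding nv_mk[OF o1, symmetric] nv_mk[OF o2, symmetric]
    by (rule that[of "of_int (sign p)" "mk vs1 ?v \<mu>1" "mk vs2 ?v \<mu>2"])
qed

lemma nv_0_empty: "nv X = 0 \<Longrightarrow> X = empty_graph"
proof (rule lgraph_eqI)
  assume n: "nv X = 0"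
  then show "nv X = nv empty_graph" by (simp add: empty_graph)
  have "edges X = []"
  proof (rule ccontr)
    assume "edges X \<noteq> []"
    from edges_in(1)[OF hd_in_set[OF this]] show False using n by simp
  qed
  then show "edges X = edges empty_graph" by (simp add: empty_graph)
qed

text \<open>Uniqueness goes by induction on the number of vertices: the value at empty and connected
  graphs is prescribed, and any other graph is, up to a scalar, a product of smaller ones.\<close>

lemma coproduct_eq_cop_map: "(coproduct :: 'k::field graph_space \<Rightarrow> _) = cop_map"
proof -
  have "(THE D. Vector_Spaces.linear (*\<^sub>v) (*\<^sub>v) D \<and>
     D (cls empty_graph) = cls empty_graph \<otimes> cls empty_graph \<and>
     (\<forall>X. connected_graph X \<longrightarrow> D (cls X) = cls X \<otimes> cls empty_graph + cls empty_graph \<otimes> cls X) \<and>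
     (\<forall>X Y. D (cls (disjoint_union X Y)) = mult2 (D (cls X)) (D (cls Y)))) = (cop_map :: 'k graph_space \<Rightarrow> _)"
  proof (rule the_equality)
    show "Vector_Spaces.linear (*\<^sub>v) (*\<^sub>v) (cop_map :: 'k graph_space \<Rightarrow> _) \<and>
     cop_map (cls empty_graph) = (cls empty_graph \<otimes> cls empty_graph :: 'k graph_space2) \<and>
     (\<forall>X. connected_graph X \<longrightarrow> cop_map (cls X) = (cls X \<otimes> cls empty_graph + cls empty_graph \<otimes> cls X :: 'k graph_space2)) \<and>
     (\<forall>X Y. cop_map (cls (disjoint_union X Y)) = mult2 (cop_map (cls X)) (cop_map (cls Y) :: 'k graph_space2))"
      by (intro conjI allI impI linear_cop_map cop_map_empty cop_map_connected cop_map_disjoint_union)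
  next
    fix D :: "'k graph_space \<Rightarrow> 'k graph_space2"
    assume D: "Vector_Spaces.linear (*\<^sub>v) (*\<^sub>v) D \<and>
     D (cls empty_graph) = cls empty_graph \<otimes> cls empty_graph \<and>
     (\<forall>X. connected_graph X \<longrightarrow> D (cls X) = cls X \<otimes> cls empty_graph + cls empty_graph \<otimes> cls X) \<and>
     (\<forall>X Y. D (cls (disjoint_union X Y)) = mult2 (D (cls X)) (D (cls Y)))"
    then have l: "D (c *\<^sub>v x) = c *\<^sub>v D x" for c x by (simp add: Vector_Spaces.linear_iff)
    have l': "cop_map (c *\<^sub>v x) = c *\<^sub>v (cop_map x :: 'k graph_space2)" for c x
      using linear_cop_map[where 'k = 'k] by (simp add: Vector_Spaces.linear_iff)
    have "D (cls X) = cop_map (cls X)" for X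
    proof (induction "nv X" arbitrary: X rule: less_induct)
      case less
      consider "nv X = 0" | "connected_graph X" | "nv X \<noteq> 0" "\<not> connected_graph X" by blast
      then show ?case
      proof cases
        case 1
        then show ?thesis using D nv_0_empty[OF 1] by (simp add: cop_map_empty)
      next
        case 2
        then show ?thesis using D by (simp add: cop_map_connected)
      next
        case 3
        then obtain A B and c :: 'k where "cls X = c *\<^sub>v cls (disjoint_union A B)" "nv A < nv X" "nv B < nv X"
          by (rule disconnected_split)
        then show ?thesis using D less by (simp add: l l' cop_map_disjoint_union)
      qed
    qed
    then show "D = cop_map" using D by (intro linear_eq_on_cls[of vscale]) (auto intro: linear_cop_map)
  qed
  then show ?thesis unfolding coproduct_def .
qed

lemma linear_coproduct: "Vector_Spaces.linear (*\<^sub>v) (*\<^sub>v) (coproduct :: 'k::field graph_space \<Rightarrow> _)"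
  by (simp add: coproduct_eq_cop_map linear_cop_map)

lemma coproduct_gvec:
  "ok vs v \<mu> \<Longrightarrow> coproduct (gvec vs v \<mu>) = (cop vs v \<mu> :: 'k::field graph_space2)"
  by (simp add: coproduct_eq_cop_map cop_map_gvec)

section \<open>The cobracket on marked graphs\<close>

lemma linear_zero: "Vector_Spaces.linear (*\<^sub>v) (*\<^sub>v) L \<Longrightarrow> L 0 = 0"
  by (metis Vector_Spaces.linear_iff svec.scale_zero_left)

text \<open>\<open>glue\<close> only rescales a value of its argument function, so linear maps such
  as \<open>phi\<close>, \<open>tau\<close> and \<open>sigma\<close> pass through it.\<close>

lemma linear_glue:
  assumes L: "Vector_Spaces.linear (*\<^sub>v) (*\<^sub>v) L"
    and ok: "ok vs v \<mu>"
    and eq: "\<And>ws w \<nu>. ok ws w \<nu> \<Longrightarrow> L (\<Phi> ws w \<nu>) = \<Psi> ws w \<nu>"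
  shows "L (glue h k \<Phi> vs v \<mu>) = glue h k \<Psi> vs v \<mu>"
proof -
  interpret Vector_Spaces.linear "(*\<^sub>v)" "(*\<^sub>v)" L by fact
  show ?thesis using eq[OF ok_glue[OF ok]] by (simp add: glue_def scale zero)
qed

lemma glue_cong:
  assumes ok: "ok vs v \<mu>"
    and eq: "\<And>ws w \<nu>. ok ws w \<nu> \<Longrightarrow> set ws \<subseteq> set vs \<Longrightarrow> \<Phi> ws w \<nu> = \<Psi> ws w \<nu>"
  shows "glue h k \<Phi> vs v \<mu> = glue h k \<Psi> vs v \<mu>"
  using eq[OF ok_glue[OF ok] set_remove1_subset] by (simp add: glue_def)

lemma dH2:
  shows linear_dH2: "Vector_Spaces.linear (*\<^sub>v) (*\<^sub>v) (dH2 :: 'k::field_char_0 graph_space2 \<Rightarrow> _)"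
    and dH2_cls: "dH2 (cls (X, Y)) = (dH (cls X) \<otimes> cls Y + (-1) ^ nv X *\<^sub>v (cls X \<otimes> dH (cls Y)) :: 'k::field_char_0 graph_space2)"
proof -
  interpret d: Vector_Spaces.linear "(*\<^sub>v)" "(*\<^sub>v)" "dH :: 'k graph_space \<Rightarrow> _" by (rule linear_dH)
  define f :: "lgraph \<times> lgraph \<Rightarrow> 'k graph_space2" where
    "f = (\<lambda>(X, Y). dH (cls X) \<otimes> cls Y + (-1) ^ nv X *\<^sub>v (cls X \<otimes> dH (cls Y)))"
  have *: "f p = of_int \<epsilon> *\<^sub>v f q" if "srel p \<epsilon> q" for p q \<epsilon>
  proof -
    obtain Z W Z' W' where pq: "p = (Z, W)" "q = (Z', W')" by (cases p; cases q)
    from that[unfolded srel_prod_def pq] show ?thesis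
    proof (elim disjE conjE)
      assume *: "srel (fst (Z, W)) \<epsilon> (fst (Z', W'))" "snd (Z, W) = snd (Z', W')"
      have "cls Z = (of_int \<epsilon> *\<^sub>v cls Z' :: 'k graph_space)" using *(1) by (intro srel_cls) simp
      then show ?thesis using * srel_nv[of Z \<epsilon> Z']
        by (simp add: f_def pq d.scale tens_scale_left svec.scale_right_distrib mult.commute)
    next
      assume *: "fst (Z, W) = fst (Z', W')" "srel (snd (Z, W)) \<epsilon> (snd (Z', W'))"
      have "cls W = (of_int \<epsilon> *\<^sub>v cls W' :: 'k graph_space)" using *(2) by (intro srel_cls) simp
      then show ?thesis using *
        by (simp add: f_def pq d.scale tens_scale_right svec.scale_right_distrib mult.commute)
    qed
  qed
  have "dH2 = lext f" by (simp add: dH2_def f_def)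
  then show "Vector_Spaces.linear (*\<^sub>v) (*\<^sub>v) (dH2 :: 'k graph_space2 \<Rightarrow> _)"
    and "dH2 (cls (X, Y)) = (dH (cls X) \<otimes> cls Y + (-1) ^ nv X *\<^sub>v (cls X \<otimes> dH (cls Y)) :: 'k graph_space2)"
    using lext_cls[of f, OF *] by (simp_all add: f_def)
qed

lemma sum_if_split:
  fixes f :: "'a \<Rightarrow> 'a \<Rightarrow> 'b::ab_group_add"
  assumes "finite H"
  shows "(\<Sum>h\<in>H. \<Sum>k\<in>H. if P h \<longleftrightarrow> P k then f h k else 0)
    = (\<Sum>h\<in>{h \<in> H. P h}. \<Sum>k\<in>{h \<in> H. P h}. f h k) + (\<Sum>h\<in>{h \<in> H. \<not> P h}. \<Sum>k\<in>{h \<in> H. \<not> P h}. f h k)"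
proof -
  have "(\<Sum>h\<in>H. \<Sum>k\<in>H. if P h \<longleftrightarrow> P k then f h k else 0)
      = (\<Sum>h\<in>H. if P h then \<Sum>k\<in>{h \<in> H. P h}. f h k else \<Sum>k\<in>{h \<in> H. \<not> P h}. f h k)"
    using assms by (intro sum.cong refl) (auto simp: sum.If_cases Int_def)
  also have "\<dots> = (\<Sum>h\<in>{h \<in> H. P h}. \<Sum>k\<in>{h \<in> H. P h}. f h k) + (\<Sum>h\<in>{h \<in> H. \<not> P h}. \<Sum>k\<in>{h \<in> H. \<not> P h}. f h k)"
    using assms by (simp add: sum.If_cases Int_def)
  finally show ?thesis .
qed

text \<open>Pairs with both half-edges in \<open>S\<close> make up the operator on the first factor,
  pairs with both outside the operator on the second, by \<open>glue_tensor_left\<close> and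
  \<open>glue_tensor_right\<close>. Mixed pairs do not arise from either factor.\<close>

lemma dH2_split2:
  assumes ok: "ok vs v \<mu>"
  shows "dH2 (split2 S vs v \<mu>) = (1 / 2) *\<^sub>v (\<Sum>h\<in>halves \<mu>. \<Sum>k\<in>halves \<mu>.
    if monochrome S v \<mu> \<and> (v h \<in> S \<longleftrightarrow> v k \<in> S) then glue h k (split2 S) vs v \<mu> else (0 :: 'k::field_char_0 graph_space2))"
proof (cases "monochrome S v \<mu>")
  case False
  then show ?thesis by (simp add: split2_def tensor_def linear_zero[OF linear_dH2])
next
  case True
  interpret d2: Vector_Spaces.linear "(*\<^sub>v)" "(*\<^sub>v)" "dH2 :: 'k graph_space2 \<Rightarrow> _" by (rule linear_dH2)
  have True': "monochrome (- S) v \<mu>" using True by simp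
  note o1 = ok_part[OF ok True] and o2 = ok_part[OF ok True']
  let ?A = "vpart S vs" and ?\<alpha> = "epart S v \<mu>" and ?B = "vpart (- S) vs" and ?\<beta> = "epart (- S) v \<mu>"
  let ?HA = "{h \<in> halves \<mu>. v h \<in> S}" and ?HB = "{h \<in> halves \<mu>. v h \<notin> S}"
  have HA: "halves ?\<alpha> = ?HA" and HB: "halves ?\<beta> = ?HB"
    using halves_epart[OF True] halves_epart[OF True'] by auto
  have "dH2 (split2 S vs v \<mu>) = ksign S vs *\<^sub>v dH2 (cls (mk ?A v ?\<alpha>, mk ?B v ?\<beta>) :: 'k graph_space2)"
    using True by (simp add: split2_def tensor_def gvec_def cls_tens_cls d2.scale)
  also have "\<dots> = ksign S vs *\<^sub>v (dH (gvec ?A v ?\<alpha>) \<otimes> gvec ?B v ?\<beta> + (-1) ^ length ?A *\<^sub>v (gvec ?A v ?\<alpha> \<otimes> dH (gvec ?B v ?\<beta>)))"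
    by (simp only: dH2_cls gvec_def nv_mk[OF o1])
  also have "\<dots> = (1 / 2) *\<^sub>v ((\<Sum>h\<in>?HA. \<Sum>k\<in>?HA. ksign S vs *\<^sub>v (glue h k gvec ?A v ?\<alpha> \<otimes> gvec ?B v ?\<beta>))
      + (\<Sum>h\<in>?HB. \<Sum>k\<in>?HB. ((-1) ^ length ?A * ksign S vs) *\<^sub>v (gvec ?A v ?\<alpha> \<otimes> glue h k gvec ?B v ?\<beta>)))"
    unfolding dH_gvec[OF o1] dH_gvec[OF o2] glue_sum_def HA HB
    by (simp add: tens_scale_left tens_scale_right tens_sum svec.scale_right_distrib svec.scale_sum_right mult_ac)
  also have "(\<Sum>h\<in>?HA. \<Sum>k\<in>?HA. ksign S vs *\<^sub>v (glue h k gvec ?A v ?\<alpha> \<otimes> gvec ?B v ?\<beta>))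
      = (\<Sum>h\<in>?HA. \<Sum>k\<in>?HA. glue h k (split2 S) vs v \<mu> :: 'k graph_space2)"
    unfolding split2_def by (intro sum.cong refl glue_tensor_left[OF good_gvec ok True, symmetric]) auto
  also have "(\<Sum>h\<in>?HB. \<Sum>k\<in>?HB. ((-1) ^ length ?A * ksign S vs) *\<^sub>v (gvec ?A v ?\<alpha> \<otimes> glue h k gvec ?B v ?\<beta>))
      = (\<Sum>h\<in>?HB. \<Sum>k\<in>?HB. glue h k (split2 S) vs v \<mu> :: 'k graph_space2)"
    unfolding split2_def by (intro sum.cong refl glue_tensor_right[OF good_gvec ok True, symmetric]) auto
  finally show ?thesis
    using True by (simp add: sum_if_split)
qed

text \<open>Colourings of the glued graph correspond to colourings of the old vertices that agree on
  \<open>v h\<close> and \<open>v k\<close>: the deleted vertex \<open>v k\<close> inherits the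
  colour of \<open>v h\<close>.\<close>

lemma coproduct_glue:
  assumes ok: "ok vs v \<mu>"
  shows "coproduct (glue h k gvec vs v \<mu>)
    = (\<Sum>S\<in>Pow (set vs). if v h \<in> S \<longleftrightarrow> v k \<in> S then glue h k (split2 S) vs v \<mu> else (0 :: 'k::field graph_space2))"
proof (cases "cuttable v \<mu> h k")
  case True
  interpret c: Vector_Spaces.linear "(*\<^sub>v)" "(*\<^sub>v)" "coproduct :: 'k graph_space \<Rightarrow> _" by (rule linear_coproduct)
  note ok' = ok_glue[OF ok True]
  let ?ws = "remove1 (v k) vs" and ?w = "merge (v h) (v k) \<circ> v" and ?\<nu> = "rewire \<mu> h k"
  have hk: "v h \<in> set vs" "v k \<in> set vs" "v h \<noteq> v k" using True ok_D(3)[OF ok] by (auto simp: cuttable_def)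
  have s: "set ?ws = set vs - {v k}" using ok_D(1)[OF ok] by simp
  let ?c = "sg \<mu> h * sg \<mu> k * (-1) ^ pos vs (v k) :: 'k"
  have "coproduct (glue h k gvec vs v \<mu>) = ?c *\<^sub>v (cop ?ws ?w ?\<nu> :: 'k graph_space2)"
    using True by (simp add: glue_def c.scale coproduct_gvec[OF ok'])
  also have "cop ?ws ?w ?\<nu> = (\<Sum>S\<in>{S \<in> Pow (set vs). v h \<in> S \<longleftrightarrow> v k \<in> S}. split2 S ?ws ?w ?\<nu> :: 'k graph_space2)"
    unfolding cop_def s
  proof (rule sum.reindex_bij_witness[of _ "\<lambda>S. S - {v k}" "\<lambda>S. if v h \<in> S then insert (v k) S else S"])
    fix S assume "S \<in> Pow (set vs - {v k})"
    then show "split2 (if v h \<in> S then insert (v k) S else S) ?ws ?w ?\<nu> = (split2 S ?ws ?w ?\<nu> :: 'k graph_space2)"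
      unfolding split2_def by (intro tensor_cong[OF ok']) (use s in auto)
  qed (use hk in \<open>auto split: if_splits\<close>)
  also have "?c *\<^sub>v \<dots> = (\<Sum>S\<in>{S \<in> Pow (set vs). v h \<in> S \<longleftrightarrow> v k \<in> S}. glue h k (split2 S) vs v \<mu>)"
    using True by (simp add: glue_def svec.scale_sum_right)
  also have "\<dots> = (\<Sum>S\<in>Pow (set vs). if v h \<in> S \<longleftrightarrow> v k \<in> S then glue h k (split2 S) vs v \<mu> else 0)"
    by (rule sum.inter_filter) simp
  finally show ?thesis .
next
  case False
  then show ?thesis by (simp add: glue_def linear_zero[OF linear_coproduct] cong: if_cong)
qed

lemma linear_theta: "Vector_Spaces.linear (*\<^sub>v) (*\<^sub>v) (theta :: 'k::field_char_0 graph_space \<Rightarrow> _)"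
  using linear_dH[where 'k = 'k] linear_dH2[where 'k = 'k] linear_coproduct[where 'k = 'k]
  by (simp add: Vector_Spaces.linear_iff theta_def svec.scale_right_diff_distrib)

lemma theta_gvec:
  assumes ok: "ok vs v \<mu>"
  shows "theta (gvec vs v \<mu>) = (1 / 2) *\<^sub>v (\<Sum>h\<in>halves \<mu>. \<Sum>k\<in>halves \<mu>. \<Sum>S\<in>Pow (set vs).
    if (v h \<in> S \<longleftrightarrow> v k \<in> S) \<and> \<not> monochrome S v \<mu> then glue h k (split2 S) vs v \<mu> else (0 :: 'k::field_char_0 graph_space2))"
proof -
  interpret c: Vector_Spaces.linear "(*\<^sub>v)" "(*\<^sub>v)" "coproduct :: 'k graph_space \<Rightarrow> _" by (rule linear_coproduct)
  interpret d2: Vector_Spaces.linear "(*\<^sub>v)" "(*\<^sub>v)" "dH2 :: 'k graph_space2 \<Rightarrow> _" by (rule linear_dH2)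
  let ?H = "halves \<mu>" and ?P = "Pow (set vs)"
  let ?g = "\<lambda>h k S. glue h k (split2 S) vs v \<mu> :: 'k graph_space2"
  have 1: "coproduct (dH (gvec vs v \<mu>)) = (1 / 2) *\<^sub>v (\<Sum>h\<in>?H. \<Sum>k\<in>?H. \<Sum>S\<in>?P. if v h \<in> S \<longleftrightarrow> v k \<in> S then ?g h k S else 0)"
    by (simp add: dH_gvec[OF ok] glue_sum_def c.scale c.sum coproduct_glue[OF ok])
  have "dH2 (coproduct (gvec vs v \<mu>)) = (\<Sum>S\<in>?P. (1 / 2) *\<^sub>v (\<Sum>h\<in>?H. \<Sum>k\<in>?H.
      if monochrome S v \<mu> \<and> (v h \<in> S \<longleftrightarrow> v k \<in> S) then ?g h k S else 0))"
    by (simp add: coproduct_gvec[OF ok] cop_def d2.sum dH2_split2[OF ok])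
  also have "\<dots> = (1 / 2) *\<^sub>v (\<Sum>S\<in>?P. \<Sum>h\<in>?H. \<Sum>k\<in>?H.
      if monochrome S v \<mu> \<and> (v h \<in> S \<longleftrightarrow> v k \<in> S) then ?g h k S else 0)"
    by (simp add: svec.scale_sum_right)
  also have "(\<Sum>S\<in>?P. \<Sum>h\<in>?H. \<Sum>k\<in>?H. if monochrome S v \<mu> \<and> (v h \<in> S \<longleftrightarrow> v k \<in> S) then ?g h k S else 0)
     = (\<Sum>h\<in>?H. \<Sum>k\<in>?H. \<Sum>S\<in>?P. if monochrome S v \<mu> \<and> (v h \<in> S \<longleftrightarrow> v k \<in> S) then ?g h k S else 0)"
    by (subst sum.swap, intro sum.cong refl, rule sum.swap)
  finally have 2: "dH2 (coproduct (gvec vs v \<mu>)) = (1 / 2) *\<^sub>v (\<Sum>h\<in>?H. \<Sum>k\<in>?H. \<Sum>S\<in>?P.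
      if monochrome S v \<mu> \<and> (v h \<in> S \<longleftrightarrow> v k \<in> S) then ?g h k S else 0)" .
  show ?thesis
    unfolding theta_def 1 2 svec.scale_right_diff_distrib[symmetric] sum_subtractf[symmetric]
    by (intro arg_cong[of _ _ "(*\<^sub>v) (1 / 2)"] sum.cong refl) auto
qed

lemma phi:
  shows linear_phi: "Vector_Spaces.linear (*\<^sub>v) (*\<^sub>v) (phi :: 'k::field graph_space2 \<Rightarrow> _)"
    and phi_cls: "phi (cls (X, Y)) = ((-1) ^ nv X *\<^sub>v cls (X, Y) :: 'k::field graph_space2)"
proof -
  define f :: "lgraph \<times> lgraph \<Rightarrow> 'k graph_space2" where
    "f = (\<lambda>(A, B). (-1) ^ nv A *\<^sub>v (cls A \<otimes> cls B))"
  have *: "f p = of_int \<epsilon> *\<^sub>v f q" if "srel p \<epsilon> q" for p q \<epsilon>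
  proof -
    have "nv (fst p) = nv (fst q)" using that srel_nv by (auto simp: srel_prod_def)
    moreover have "(cls p :: 'k graph_space2) = of_int \<epsilon> *\<^sub>v cls q" using that by (rule srel_cls)
    ultimately show ?thesis by (simp add: f_def case_prod_unfold cls_tens_cls mult.commute)
  qed
  have "phi = lext f" by (simp add: phi_def f_def)
  then show "Vector_Spaces.linear (*\<^sub>v) (*\<^sub>v) (phi :: 'k graph_space2 \<Rightarrow> _)"
    "phi (cls (X, Y)) = ((-1) ^ nv X *\<^sub>v cls (X, Y) :: 'k graph_space2)"
    using lext_cls[of f, OF *] by (simp_all add: f_def cls_tens_cls)
qed

text \<open>\<open>phi\<close> acts after the gluing, so its sign counts vertices of the glued graph
  and has to sit inside the function that \<open>glue\<close> evaluates.\<close>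

definition ssplit2 :: "nat set \<Rightarrow> nat list \<Rightarrow> ('h \<Rightarrow> nat) \<Rightarrow> ('h \<times> 'h) list \<Rightarrow> 'k::field graph_space2" where
  "ssplit2 S vs v \<mu> = (-1) ^ length (vpart S vs) *\<^sub>v split2 S vs v \<mu>"

lemma phi_split2:
  assumes ok: "ok vs v \<mu>"
  shows "phi (split2 S vs v \<mu>) = (ssplit2 S vs v \<mu> :: 'k::field graph_space2)"
proof (cases "monochrome S v \<mu>")
  case True
  interpret p: Vector_Spaces.linear "(*\<^sub>v)" "(*\<^sub>v)" "phi :: 'k graph_space2 \<Rightarrow> _" by (rule linear_phi)
  show ?thesis
    using True by (simp add: split2_def ssplit2_def tensor_def gvec_def cls_tens_cls p.scale phi_cls
        nv_mk[OF ok_part[OF ok True]] mult.commute)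
next
  case False
  then show ?thesis by (simp add: split2_def ssplit2_def tensor_def linear_zero[OF linear_phi])
qed

lemma linear_theta_phi: "Vector_Spaces.linear (*\<^sub>v) (*\<^sub>v) (theta_phi :: 'k::field_char_0 graph_space \<Rightarrow> _)"
  using linear_theta[where 'k = 'k] linear_phi[where 'k = 'k]
  by (simp add: Vector_Spaces.linear_iff theta_phi_def)

theorem theta_phi_gvec:
  assumes ok: "ok vs v \<mu>"
  shows "theta_phi (gvec vs v \<mu>) = (1 / 2) *\<^sub>v (\<Sum>h\<in>halves \<mu>. \<Sum>k\<in>halves \<mu>. \<Sum>S\<in>Pow (set vs).
    if (v h \<in> S \<longleftrightarrow> v k \<in> S) \<and> \<not> monochrome S v \<mu> then glue h k (ssplit2 S) vs v \<mu> else (0 :: 'k::field_char_0 graph_space2))"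
proof -
  interpret p: Vector_Spaces.linear "(*\<^sub>v)" "(*\<^sub>v)" "phi :: 'k graph_space2 \<Rightarrow> _" by (rule linear_phi)
  have "phi (glue h k (split2 S) vs v \<mu>) = (glue h k (ssplit2 S) vs v \<mu> :: 'k graph_space2)" for h k S
    by (rule linear_glue[OF linear_phi ok phi_split2])
  then show ?thesis
    by (simp add: theta_phi_def theta_gvec[OF ok] p.scale p.sum if_distrib[of phi] p.zero cong: if_cong)
qed


subsection \<open>Co-antisymmetry\<close>

lemma grading_shifted_degree: "grading shifted_degree"
  by (auto simp: grading_def shifted_degree_def srel_nv)

lemma tau:
  fixes deg :: "'b::signed_set \<Rightarrow> int"
  assumes "grading deg"
  shows linear_tau: "Vector_Spaces.linear (*\<^sub>v) (*\<^sub>v) (tau deg :: ('b \<times> 'b, 'k::field) svec \<Rightarrow> _)"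
    and tau_cls: "tau deg (cls (x, y)) = ((-1) powi (deg x * deg y) *\<^sub>v cls (y, x) :: ('b \<times> 'b, 'k::field) svec)"
proof -
  define f :: "'b \<times> 'b \<Rightarrow> ('b \<times> 'b, 'k) svec" where
    "f = (\<lambda>(v, w). (-1) powi (deg v * deg w) *\<^sub>v cls (w, v))"
  have *: "f p = of_int \<epsilon> *\<^sub>v f q" if "srel p \<epsilon> q" for p q \<epsilon>
  proof -
    have "deg (fst p) = deg (fst q)" "deg (snd p) = deg (snd q)"
      using that assms by (auto simp: srel_prod_def grading_def)
    moreover have "srel (snd p, fst p) \<epsilon> (snd q, fst q)" using that by (auto simp: srel_prod_def)
    then have "(cls (snd p, fst p) :: ('b \<times> 'b, 'k) svec) = of_int \<epsilon> *\<^sub>v cls (snd q, fst q)" by (rule srel_cls)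
    ultimately show ?thesis by (simp add: f_def case_prod_unfold mult.commute)
  qed
  have "tau deg = lext f" by (simp add: tau_def f_def)
  then show "Vector_Spaces.linear (*\<^sub>v) (*\<^sub>v) (tau deg :: ('b \<times> 'b, 'k) svec \<Rightarrow> _)"
    "tau deg (cls (x, y)) = ((-1) powi (deg x * deg y) *\<^sub>v cls (y, x) :: ('b \<times> 'b, 'k) svec)"
    using lext_cls[of f, OF *] by (simp_all add: f_def)
qed

lemma minus_one_powi: "(-1) powi i = (if even i then 1 else -1 :: 'k::field)"
proof (cases "i \<ge> 0")
  case True
  then obtain n where "i = int n" by (metis nonneg_int_cases)
  then show ?thesis by (cases "even n") simp_all
next
  case False
  then obtain n where "i = - int n" by (metis int_cases2 not_le of_nat_0_le_iff)
  then show ?thesis by (cases "even n") (simp_all add: power_int_minus)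
qed

lemma minus_one_pow: "(-1) ^ n = (if even n then 1 else -1 :: 'k::field)"
  by simp

lemma ksign_compl:
  "ksign (- S) vs = (ksign S vs * (-1) ^ (length (vpart S vs) * length (vpart (- S) vs)) :: 'k::field)"
  by (induction vs) (auto simp: power_add mult_ac)

text \<open>With \<open>a, b\<close> vertices in the two parts, \<open>(a - 1) * (b - 1) + a\<close>
  and \<open>a * b + b + 1\<close> have the same parity. The term \<open>a * b\<close> is absorbed
  by \<open>ksign_compl\<close>, and \<open>b\<close> is the sign of \<open>phi\<close> after the
  exchange. The remaining 1 stems from the degree shift and turns symmetry into
  antisymmetry.\<close>

lemma tau_ssplit2:
  assumes ok: "ok vs v \<mu>"
  shows "tau shifted_degree (ssplit2 S vs v \<mu>) = (- ssplit2 (- S) vs v \<mu> :: 'k::field graph_space2)"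
proof (cases "monochrome S v \<mu>")
  case True
  interpret t: Vector_Spaces.linear "(*\<^sub>v)" "(*\<^sub>v)" "tau shifted_degree :: 'k graph_space2 \<Rightarrow> _"
    by (rule linear_tau[OF grading_shifted_degree])
  have m': "monochrome (- S) v \<mu>" using True by simp
  show ?thesis
    using True by (simp add: split2_def ssplit2_def tensor_def gvec_def cls_tens_cls t.scale
        tau_cls[OF grading_shifted_degree] nv_mk[OF ok_part[OF ok True]] nv_mk[OF ok_part[OF ok m']]
        shifted_degree_def minus_one_powi minus_one_pow ksign_compl svec.scale_minus_left flip: svec.scale_minus_left)
next
  case False
  then show ?thesis
    by (simp add: split2_def ssplit2_def tensor_def linear_zero[OF linear_tau[OF grading_shifted_degree]])
qed

lemma ssplit2_cong:
  assumes "ok vs v \<mu>" "\<And>x. x \<in> set vs \<Longrightarrow> x \<in> S \<longleftrightarrow> x \<in> S'"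
  shows "ssplit2 S vs v \<mu> = ssplit2 S' vs v \<mu>"
  unfolding ssplit2_def split2_def using tensor_cong[OF assms] vpart_cong[OF assms(2)] by simp

lemma tau_theta_phi: "tau shifted_degree (theta_phi x) = (- theta_phi x :: 'k::field_char_0 graph_space2)"
proof -
  interpret t: Vector_Spaces.linear "(*\<^sub>v)" "(*\<^sub>v)" "tau shifted_degree :: 'k graph_space2 \<Rightarrow> _"
    by (rule linear_tau[OF grading_shifted_degree])
  have gen: "tau shifted_degree (theta_phi (gvec vs v \<mu>)) = (- theta_phi (gvec vs v \<mu>) :: 'k graph_space2)"
    if ok: "ok vs v \<mu>" for vs and v :: "half_edge \<Rightarrow> nat" and \<mu>
  proof -
    let ?f = "\<lambda>h k S. if (v h \<in> S \<longleftrightarrow> v k \<in> S) \<and> \<not> monochrome S v \<mu> then glue h k (ssplit2 S) vs v \<mu> else (0 :: 'k graph_space2)"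
    have glue: "tau shifted_degree (glue h k (ssplit2 S) vs v \<mu>) = (- glue h k (ssplit2 (set vs - S)) vs v \<mu> :: 'k graph_space2)"
      for h k S
    proof -
      have "tau shifted_degree (glue h k (ssplit2 S) vs v \<mu>)
          = (glue h k (\<lambda>ws w \<nu>. - ssplit2 (- S) ws w \<nu>) vs v \<mu> :: 'k graph_space2)"
        by (rule linear_glue[OF linear_tau[OF grading_shifted_degree] ok tau_ssplit2])
      \<comment> \<open>Taking the complement inside \<open>set vs\<close> keeps the colour class
        within the range of summation.\<close>
      also have "\<dots> = glue h k (\<lambda>ws w \<nu>. - ssplit2 (set vs - S) ws w \<nu>) vs v \<mu>"
        by (rule glue_cong[OF ok], rule arg_cong[of _ _ uminus], erule ssplit2_cong) auto
      finally show ?thesis by (simp add: glue_def svec.scale_minus_right)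
    qed
    have "(\<Sum>S\<in>Pow (set vs). tau shifted_degree (?f h k S)) = - (\<Sum>S\<in>Pow (set vs). ?f h k S)"
      if "h \<in> halves \<mu>" "k \<in> halves \<mu>" for h k
    proof -
      have "(\<Sum>S\<in>Pow (set vs). tau shifted_degree (?f h k S)) = (\<Sum>S\<in>Pow (set vs). - ?f h k (set vs - S))"
      proof (intro sum.cong refl)
        fix S assume "S \<in> Pow (set vs)"
        have "monochrome (set vs - S) v \<mu> = monochrome (- S) v \<mu>"
          by (rule monochrome_cong) (simp add: ok_D(3)[OF ok])
        then show "tau shifted_degree (?f h k S) = - ?f h k (set vs - S)"
          using that by (simp add: glue t.zero ok_D(3)[OF ok])
      qed
      also have "\<dots> = (\<Sum>S\<in>Pow (set vs). - ?f h k S)"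
        by (rule sum.reindex_bij_witness[of _ "\<lambda>S. set vs - S" "\<lambda>S. set vs - S"]) (auto simp: double_diff)
      finally show ?thesis by (simp add: sum_negf)
    qed
    then show ?thesis
      by (simp add: theta_phi_gvec[OF ok] t.scale t.sum sum_negf svec.scale_minus_right)
  qed
  have "(\<lambda>x. tau shifted_degree (theta_phi x)) = (\<lambda>x. - theta_phi x :: 'k graph_space2)"
  proof (rule linear_eq_on_cls)
    show "Vector_Spaces.linear (*\<^sub>v) (*\<^sub>v) (\<lambda>x. tau shifted_degree (theta_phi x) :: 'k graph_space2)"
      using linear_theta_phi[where 'k = 'k] linear_tau[OF grading_shifted_degree, where 'k = 'k]
      by (simp add: Vector_Spaces.linear_iff)
    show "Vector_Spaces.linear (*\<^sub>v) (*\<^sub>v) (\<lambda>x. - theta_phi x :: 'k graph_space2)"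
      using linear_theta_phi[where 'k = 'k] by (simp add: Vector_Spaces.linear_iff svec.scale_minus_right)
    show "tau shifted_degree (theta_phi (cls X)) = (- theta_phi (cls X) :: 'k graph_space2)" for X
      using gen[OF ok_canon[of X]] by (simp only: gvec_canon)
  qed
  then show ?thesis by (rule fun_cong)
qed

text \<open>An antisymmetric \<open>t\<close> is half of \<open>t - tau deg t\<close>, and on a
  generator \<open>x\<close> the difference \<open>x - tau deg x\<close> is one of the spanning
  elements.\<close>

lemma antisym_exterior_square:
  fixes t :: "('b::signed_set \<times> 'b, 'k::field_char_0) svec"
  assumes g: "grading deg" and "tau deg t = - t"
  shows "t \<in> exterior_square deg"
proof -
  interpret t: Vector_Spaces.linear "(*\<^sub>v)" "(*\<^sub>v)" "tau deg :: ('b \<times> 'b, 'k) svec \<Rightarrow> _" by (rule linear_tau[OF g])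
  have *: "x - tau deg x \<in> exterior_square deg" for x :: "('b \<times> 'b, 'k) svec"
  proof -
    have "x \<in> svec.span (range cls)" by (simp add: span_cls)
    then show ?thesis
    proof (induction rule: svec.span_induct_alt)
      case base
      then show ?case by (simp add: t.zero exterior_square_def svec.span_zero)
    next
      case (step c y x)
      obtain a b where y: "y = cls (a, b)" using step(1) by auto
      have "y - tau deg y \<in> exterior_square deg"
        unfolding exterior_square_def y tau_cls[OF g]
        unfolding cls_tens_cls by (intro svec.span_base) blast
      then have "c *\<^sub>v (y - tau deg y) + (x - tau deg x) \<in> exterior_square deg"
        using step(2) unfolding exterior_square_def by (intro svec.span_add svec.span_scale)
      then show ?case by (simp add: t.add t.scale svec.scale_right_diff_distrib algebra_simps)
    qed
  qed
  have "(1 / 2) *\<^sub>v (t - tau deg t) \<in> exterior_square deg"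
    using *[of t] unfolding exterior_square_def by (intro svec.span_scale)
  moreover have "(1 / 2) *\<^sub>v (t - tau deg t) = t"
    using assms(2) by (simp add: svec.scale_right_distrib flip: svec.scale_left_distrib)
  ultimately show ?thesis by simp
qed

section \<open>The co-Jacobi identity\<close>

lemma
  assumes f: "Vector_Spaces.linear (*\<^sub>v) (*\<^sub>v) (f :: ('b::signed_set, 'k::field) svec \<Rightarrow> ('c::signed_set, 'k) svec)"
  shows linear_id_tens: "Vector_Spaces.linear (*\<^sub>v) (*\<^sub>v) (id_tens f :: ('a::signed_set \<times> 'b, 'k) svec \<Rightarrow> _)"
    and id_tens_cls: "id_tens f (cls (x, y)) = (cls x \<otimes> f (cls y) :: ('a \<times> 'c, 'k) svec)"
proof -
  interpret f: Vector_Spaces.linear "(*\<^sub>v)" "(*\<^sub>v)" f by fact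
  define g :: "'a \<times> 'b \<Rightarrow> ('a \<times> 'c, 'k) svec" where "g = (\<lambda>(x, y). cls x \<otimes> f (cls y))"
  have *: "g p = of_int \<epsilon> *\<^sub>v g q" if "srel p \<epsilon> q" for p q \<epsilon>
    using that unfolding srel_prod_def
  proof (elim disjE conjE)
    assume *: "srel (fst p) \<epsilon> (fst q)" "snd p = snd q"
    show ?thesis using * by (simp add: g_def case_prod_unfold srel_cls[OF *(1)] tens_scale_left)
  next
    assume *: "fst p = fst q" "srel (snd p) \<epsilon> (snd q)"
    show ?thesis using * by (simp add: g_def case_prod_unfold srel_cls[OF *(2)] f.scale tens_scale_right)
  qed
  have "id_tens f = lext g" by (simp add: id_tens_def g_def)
  then show "Vector_Spaces.linear (*\<^sub>v) (*\<^sub>v) (id_tens f :: ('a \<times> 'b, 'k) svec \<Rightarrow> _)"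
    "id_tens f (cls (x, y)) = (cls x \<otimes> f (cls y) :: ('a \<times> 'c, 'k) svec)"
    using lext_cls[of g, OF *] by (simp_all add: g_def)
qed

lemma
  fixes deg :: "'b::signed_set \<Rightarrow> int"
  assumes "grading deg"
  shows linear_sigma: "Vector_Spaces.linear (*\<^sub>v) (*\<^sub>v) (sigma deg :: ('b \<times> 'b \<times> 'b, 'k::field) svec \<Rightarrow> _)"
    and sigma_cls: "sigma deg (cls (x, y, z))
      = ((-1) powi (deg z * (deg x + deg y)) *\<^sub>v cls (z, x, y) :: ('b \<times> 'b \<times> 'b, 'k::field) svec)"
proof -
  define f :: "'b \<times> 'b \<times> 'b \<Rightarrow> ('b \<times> 'b \<times> 'b, 'k) svec" where
    "f = (\<lambda>(u, v, w). (-1) powi (deg w * (deg u + deg v)) *\<^sub>v cls (w, u, v))"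
  have *: "f p = of_int \<epsilon> *\<^sub>v f q" if "srel p \<epsilon> q" for p q \<epsilon>
  proof -
    obtain a b c a' b' c' where pq: "p = (a, b, c)" "q = (a', b', c')" by (cases p; cases q)
    have "deg a = deg a'" "deg b = deg b'" "deg c = deg c'"
      using that assms by (auto simp: srel_prod_def grading_def pq)
    moreover have "srel (c, a, b) \<epsilon> (c', a', b')" using that by (auto simp: srel_prod_def pq)
    then have "(cls (c, a, b) :: ('b \<times> 'b \<times> 'b, 'k) svec) = of_int \<epsilon> *\<^sub>v cls (c', a', b')" by (rule srel_cls)
    ultimately show ?thesis by (simp add: f_def pq mult.commute)
  qed
  have "sigma deg = lext f" by (simp add: sigma_def f_def)
  then show "Vector_Spaces.linear (*\<^sub>v) (*\<^sub>v) (sigma deg :: ('b \<times> 'b \<times> 'b, 'k) svec \<Rightarrow> _)"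
    "sigma deg (cls (x, y, z)) = ((-1) powi (deg z * (deg x + deg y)) *\<^sub>v cls (z, x, y) :: ('b \<times> 'b \<times> 'b, 'k) svec)"
    using lext_cls[of f, OF *] by (simp_all add: f_def)
qed

text \<open>The colours are \<open>A\<close>, \<open>B\<close> and neither. Of the two signs of
  \<open>phi\<close> only that of the second application shows: the first cancels against the sign
  with which the second gluing passes the first factor.\<close>

definition split3 ::
    "nat set \<Rightarrow> nat set \<Rightarrow> nat list \<Rightarrow> ('h \<Rightarrow> nat) \<Rightarrow> ('h \<times> 'h) list \<Rightarrow> (lgraph \<times> lgraph \<times> lgraph, 'k::field) svec" where
  "split3 A B = tensor A gvec (ssplit2 B)"

lemma good_ssplit2: "good {S} (ssplit2 S :: _ \<Rightarrow> ('h \<Rightarrow> nat) \<Rightarrow> _ \<Rightarrow> 'k::field graph_space2)"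
proof -
  have gs: "good {S} (split2 S :: _ \<Rightarrow> ('h \<Rightarrow> nat) \<Rightarrow> _ \<Rightarrow> 'k graph_space2)" by (rule good_split2)
  show ?thesis
  proof (rule goodI, goal_cases)
    case 1 show ?case using good_cong[OF gs 1] by (simp add: ssplit2_def)
  next
    case (2 xs a b ys v \<mu>)
    have "length (vpart S (xs @ b # a # ys)) = length (vpart S (xs @ a # b # ys))" by simp
    then show ?case using good_swap[OF gs 2 refl]
      by (simp add: ssplit2_def svec.scale_minus_right del: vpart_simps)
  next
    case 3 show ?case using good_mset[OF gs 3] by (simp add: ssplit2_def)
  next
    case 4 show ?case using good_rev[OF gs 4 refl] by (simp add: ssplit2_def svec.scale_minus_right)
  next
    case (5 vs v \<mu> \<rho>)
    have "vpart S (map \<rho> vs) = map \<rho> (vpart S vs)" by (rule length_vpart_map) (use 5 in auto)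
    then show ?case using good_rename[OF gs 5] by (simp add: ssplit2_def)
  qed
qed

lemma good_split3: "good {A, B} (split3 A B)"
  unfolding split3_def using good_tensor[OF good_gvec good_ssplit2, of A B] by (simp add: insert_commute)

lemma vpart_vpart: "vpart S (vpart T xs) = vpart (S \<inter> T) xs"
  by (simp add: vpart_def conj_commute)

lemma epart_epart: "epart S v (epart T v \<mu>) = epart (S \<inter> T) v \<mu>"
  by (simp add: epart_def conj_commute)

lemma monochrome_epart:
  assumes "A \<inter> B = {}" "monochrome A v \<mu>"
  shows "monochrome B v (epart (- A) v \<mu>) = monochrome B v \<mu>"
  using assms unfolding monochrome_def epart_def by auto

text \<open>The left side sorts the vertices into the order neither, \<open>A\<close>,
  \<open>B\<close>. The right side sorts them into \<open>A\<close>, \<open>B\<close>, neither, and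
  then moves the last block to the front.\<close>

lemma ksign_rotate:
  assumes "A \<inter> B = {}"
  shows "ksign (- (A \<union> B)) xs * ksign A (vpart (A \<union> B) xs)
    = (ksign A xs * ksign B (vpart (- A) xs)
      * (-1) ^ (length (vpart (- (A \<union> B)) xs) * (length (vpart A xs) + length (vpart B xs))) :: 'k::field)"
proof (induction xs)
  case (Cons x xs)
  have i: "A \<inter> (A \<union> B) = A" "B \<inter> - A = B" using assms by auto
  show ?case
    using Cons assms by (cases "x \<in> A"; cases "x \<in> B") (auto simp: vpart_vpart i power_add mult_ac)
qed simp

text \<open>The rotation leaves no sign: the sign of \<open>sigma\<close> in shifted degrees, the
  crossing sign of \<open>ksign_rotate\<close>, and the change from the sign of \<open>B\<close> to
  that of \<open>A\<close> cancel. The parity identity behind this is \<open>sgn\<close>.\<close>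

lemma sigma_split3:
  assumes ok: "ok vs v \<mu>" and disj: "A \<inter> B = {}"
  shows "sigma shifted_degree (split3 A B vs v \<mu>) = (split3 (- (A \<union> B)) A vs v \<mu> :: (_, 'k::field) svec)"
proof -
  interpret s: Vector_Spaces.linear "(*\<^sub>v)" "(*\<^sub>v)" "sigma shifted_degree :: (lgraph \<times> lgraph \<times> lgraph, 'k) svec \<Rightarrow> _"
    by (rule linear_sigma[OF grading_shifted_degree])
  let ?C = "- (A \<union> B)"
  have sets: "B \<inter> - A = B" "- B \<inter> - A = ?C" "A \<inter> (A \<union> B) = A" "- A \<inter> (A \<union> B) = B" "- ?C = A \<union> B"
    using disj by auto
  have mC: "monochrome ?C v \<mu> \<and> monochrome A v \<mu> \<longleftrightarrow> monochrome A v \<mu> \<and> monochrome B v \<mu>"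
    using disj unfolding monochrome_def by auto
  show ?thesis
  proof (cases "monochrome A v \<mu> \<and> monochrome B v \<mu>")
    case True
    then have m: "monochrome A v \<mu>" "monochrome B v \<mu>" "monochrome ?C v \<mu>" using mC by auto
    have mB: "monochrome B v (epart (- A) v \<mu>)" using monochrome_epart[OF disj m(1)] m(2) by simp
    have mA: "monochrome A v (epart (A \<union> B) v \<mu>)" using m(1) unfolding monochrome_def epart_def by auto
    let ?X = "mk (vpart A vs) v (epart A v \<mu>)" and ?Y = "mk (vpart B vs) v (epart B v \<mu>)"
      and ?Z = "mk (vpart ?C vs) v (epart ?C v \<mu>)"
    note n = nv_mk[OF ok_part[OF ok m(1)]] nv_mk[OF ok_part[OF ok m(2)]] nv_mk[OF ok_part[OF ok m(3)]]
    have L: "split3 A B vs v \<mu> = (ksign A vs * ksign B (vpart (- A) vs) * (-1) ^ length (vpart B vs))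
        *\<^sub>v (cls (?X, ?Y, ?Z) :: (_, 'k) svec)"
      using m mB by (simp add: split3_def ssplit2_def split2_def tensor_def vpart_vpart epart_epart sets
          gvec_def cls_tens_cls tens_scale_right mult_ac)
    have R: "split3 ?C A vs v \<mu> = (ksign ?C vs * ksign A (vpart (A \<union> B) vs) * (-1) ^ length (vpart A vs))
        *\<^sub>v (cls (?Z, ?X, ?Y) :: (_, 'k) svec)"
      unfolding split3_def ssplit2_def split2_def tensor_def vpart_vpart epart_epart sets
      using m mA by (simp add: gvec_def cls_tens_cls tens_scale_right mult_ac)
    have sgn: "((-1) powi ((int c - 1) * (int a - 1 + (int b - 1))) :: 'k) * (-1) ^ b = (-1) ^ (c * (a + b)) * (-1) ^ a"
      for a b c :: nat by (simp add: minus_one_powi minus_one_pow)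
    have "((-1) powi (shifted_degree ?Z * (shifted_degree ?X + shifted_degree ?Y)) :: 'k) * (-1) ^ length (vpart B vs)
        = (-1) ^ (length (vpart ?C vs) * (length (vpart A vs) + length (vpart B vs))) * (-1) ^ length (vpart A vs)"
      unfolding shifted_degree_def n by (rule sgn)
    then show ?thesis
      unfolding L R s.scale sigma_cls[OF grading_shifted_degree] ksign_rotate[OF disj]
      by (simp add: mult_ac del: Compl_Un)
  next
    case False
    then have "split3 A B vs v \<mu> = (0 :: (_, 'k) svec)"
      using monochrome_epart[OF disj] by (auto simp: split3_def ssplit2_def split2_def tensor_def)
    moreover have "split3 ?C A vs v \<mu> = (0 :: (_, 'k) svec)"
    proof -
      have "monochrome A v \<mu>" if "monochrome ?C v \<mu>" "monochrome A v (epart (A \<union> B) v \<mu>)"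
        unfolding monochrome_def
      proof
        fix e assume e: "e \<in> set \<mu>"
        have "v (fst e) \<in> ?C \<longleftrightarrow> v (snd e) \<in> ?C" using that(1) e unfolding monochrome_def by blast
        moreover have "v (fst e) \<in> A \<union> B \<Longrightarrow> v (fst e) \<in> A \<longleftrightarrow> v (snd e) \<in> A"
          using that(2) e by (simp add: monochrome_def epart_def)
        ultimately show "v (fst e) \<in> A \<longleftrightarrow> v (snd e) \<in> A" by blast
      qed
      then have "\<not> monochrome ?C v \<mu> \<or> \<not> monochrome A v (epart (- ?C) v \<mu>)"
        using False mC unfolding sets(5) by blast
      then show ?thesis
      proof
        assume "\<not> monochrome ?C v \<mu>"
        then show ?thesis by (simp only: split3_def tensor_def if_False)
      next
        assume "\<not> monochrome A v (epart (- ?C) v \<mu>)"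
        then show ?thesis
          by (simp only: split3_def tensor_def ssplit2_def split2_def if_False tens_zero svec.scale_zero_right if_cancel)
      qed
    qed
    ultimately show ?thesis by (simp add: s.zero del: Compl_Un)
  qed
qed

lemma split3_cong:
  assumes ok: "ok vs v \<mu>" and A: "\<And>x. x \<in> set vs \<Longrightarrow> x \<in> A \<longleftrightarrow> x \<in> A'"
    and B: "\<And>x. x \<in> set vs \<Longrightarrow> x \<in> B \<longleftrightarrow> x \<in> B'"
  shows "split3 A B vs v \<mu> = (split3 A' B' vs v \<mu> :: (_, 'k::field) svec)"
proof -
  have "tensor A gvec (ssplit2 B) vs v \<mu> = (tensor A gvec (ssplit2 B') vs v \<mu> :: (_, 'k) svec)"
  proof (cases "monochrome A v \<mu>")
    case True
    have "ssplit2 B (vpart (- A) vs) v (epart (- A) v \<mu>)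
        = (ssplit2 B' (vpart (- A) vs) v (epart (- A) v \<mu>) :: 'k graph_space2)"
      by (rule ssplit2_cong[OF ok_part[OF ok]]) (use True B in auto)
    then show ?thesis by (simp add: tensor_def)
  qed (simp add: tensor_def)
  also have "\<dots> = tensor A' gvec (ssplit2 B') vs v \<mu>" by (rule tensor_cong[OF ok A])
  finally show ?thesis by (simp add: split3_def)
qed

lemma sigma_glue_glue:
  assumes ok: "ok vs v \<mu>" and disj: "A \<inter> B = {}"
  shows "sigma shifted_degree (glue h k (glue p q (split3 A B)) vs v \<mu>)
    = (glue h k (glue p q (split3 (set vs - A - B) A)) vs v \<mu> :: (_, 'k::field) svec)"
proof -
  note l = linear_sigma[OF grading_shifted_degree]
  have "sigma shifted_degree (glue h k (glue p q (split3 A B)) vs v \<mu>)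
    = (glue h k (glue p q (split3 (- (A \<union> B)) A)) vs v \<mu> :: (_, 'k) svec)"
    by (intro linear_glue[OF l] ok sigma_split3 disj)
  also have "\<dots> = glue h k (glue p q (split3 (set vs - A - B) A)) vs v \<mu>"
  proof (rule glue_cong[OF ok], rule glue_cong)
    fix ws w \<nu> ws' w' and \<nu>' :: "('a \<times> 'a) list"
    assume "set ws \<subseteq> set vs" "set ws' \<subseteq> set ws" "ok ws' w' \<nu>'"
    then show "split3 (- (A \<union> B)) A ws' w' \<nu>' = (split3 (set vs - A - B) A ws' w' \<nu>' :: (_, 'k) svec)"
      by (intro split3_cong) auto
  qed
  finally show ?thesis .
qed

lemma id_tens_ssplit2:
  assumes ok: "ok vs v \<mu>"
  shows "id_tens theta_phi (ssplit2 A vs v \<mu>) = (1 / 2) *\<^sub>v (\<Sum>p\<in>halves \<mu>. \<Sum>q\<in>halves \<mu>. \<Sum>B\<in>Pow (set vs - A).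
    if monochrome A v \<mu> \<and> v p \<notin> A \<and> v q \<notin> A \<and> (v p \<in> B \<longleftrightarrow> v q \<in> B) \<and> \<not> monochrome B v \<mu>
    then glue p q (split3 A B) vs v \<mu> else (0 :: (_, 'k::field_char_0) svec))"
proof (cases "monochrome A v \<mu>")
  case False
  then show ?thesis by (simp add: ssplit2_def split2_def tensor_def linear_zero[OF linear_id_tens[OF linear_theta_phi]])
next
  case True
  interpret i: Vector_Spaces.linear "(*\<^sub>v)" "(*\<^sub>v)" "id_tens theta_phi :: 'k graph_space2 \<Rightarrow> _"
    by (rule linear_id_tens[OF linear_theta_phi])
  have m': "monochrome (- A) v \<mu>" using True by simp
  note o2 = ok_part[OF ok m']
  let ?A = "vpart A vs" and ?\<alpha> = "epart A v \<mu>" and ?B = "vpart (- A) vs" and ?\<beta> = "epart (- A) v \<mu>"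
  \<comment> \<open>The sign of \<open>phi\<close> times \<open>ksign A vs\<close>. It is exactly
    the coefficient in \<open>glue_tensor_right\<close>, so the second gluing can be carried out on
    the whole graph without further signs.\<close>
  let ?s = "(-1) ^ length ?A * ksign A vs :: 'k"
  let ?H = "halves \<mu>"
  have HB: "halves ?\<beta> = {h \<in> ?H. v h \<notin> A}" using halves_epart[OF m'] by auto
  let ?f = "\<lambda>p q B. if (v p \<in> B \<longleftrightarrow> v q \<in> B) \<and> \<not> monochrome B v \<mu> then glue p q (split3 A B) vs v \<mu> else (0 :: (_, 'k) svec)"
  have "id_tens theta_phi (ssplit2 A vs v \<mu>) = ?s *\<^sub>v (gvec ?A v ?\<alpha> \<otimes> theta_phi (gvec ?B v ?\<beta>) :: (_, 'k) svec)"
    using True by (simp add: ssplit2_def split2_def tensor_def gvec_def cls_tens_cls i.scale id_tens_cls[OF linear_theta_phi])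
  also have "\<dots> = (1 / 2) *\<^sub>v (\<Sum>p\<in>halves ?\<beta>. \<Sum>q\<in>halves ?\<beta>. \<Sum>B\<in>Pow (set ?B).
      if (v p \<in> B \<longleftrightarrow> v q \<in> B) \<and> \<not> monochrome B v ?\<beta> then ?s *\<^sub>v (gvec ?A v ?\<alpha> \<otimes> glue p q (ssplit2 B) ?B v ?\<beta>) else 0)"
    by (simp add: theta_phi_gvec[OF o2] tens_scale_right tens_sum svec.scale_sum_right if_distrib[of "(\<otimes>) _"] if_distrib[of "(*\<^sub>v) _"]
        mult_ac cong: if_cong)
  also have "\<dots> = (1 / 2) *\<^sub>v (\<Sum>p\<in>halves ?\<beta>. \<Sum>q\<in>halves ?\<beta>. \<Sum>B\<in>Pow (set ?B). ?f p q B)"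
  proof (intro arg_cong[of _ _ "(*\<^sub>v) (1 / 2)"] sum.cong refl if_cong)
    fix p q B assume p: "p \<in> halves ?\<beta>" and q: "q \<in> halves ?\<beta>" and B: "B \<in> Pow (set ?B)"
    then have "A \<inter> B = {}" by auto
    then show "((v p \<in> B \<longleftrightarrow> v q \<in> B) \<and> \<not> monochrome B v ?\<beta>) = ((v p \<in> B \<longleftrightarrow> v q \<in> B) \<and> \<not> monochrome B v \<mu>)"
      using monochrome_epart[OF _ True] by simp
    show "?s *\<^sub>v (gvec ?A v ?\<alpha> \<otimes> glue p q (ssplit2 B) ?B v ?\<beta>) = glue p q (split3 A B) vs v \<mu>"
      unfolding split3_def using p q by (intro glue_tensor_right[OF good_gvec ok True, symmetric]) (auto simp: HB)
  qed
  also have "(\<Sum>p\<in>halves ?\<beta>. \<Sum>q\<in>halves ?\<beta>. \<Sum>B\<in>Pow (set ?B). ?f p q B)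
    = (\<Sum>p\<in>?H. \<Sum>q\<in>?H. \<Sum>B\<in>Pow (set vs - A). if v p \<notin> A \<and> v q \<notin> A then ?f p q B else 0)"
  proof -
    have "set ?B = set vs - A" by auto
    moreover have "(\<Sum>p\<in>?H. \<Sum>q\<in>?H. \<Sum>B\<in>Pow (set vs - A). if v p \<notin> A \<and> v q \<notin> A then ?f p q B else 0)
      = (\<Sum>p\<in>?H. if v p \<notin> A then \<Sum>q\<in>?H. if v q \<notin> A then \<Sum>B\<in>Pow (set vs - A). ?f p q B else 0 else 0)"
      by (intro sum.cong refl) (auto intro!: sum.cong sum.neutral)
    ultimately show ?thesis unfolding HB by (simp only: sum.inter_filter finite_halves)
  qed
  finally show ?thesis
    using True by (auto intro!: arg_cong[of _ _ "(*\<^sub>v) (1 / 2)"] sum.cong)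
qed

text \<open>The second operation lives on the glued graph. Its colourings are pulled back as in
  \<open>coproduct_glue\<close>, and half-edges removed by the first gluing contribute 0; so all
  sums can run over data of the original graph, which is what exchanging the two operations
  requires.\<close>

lemma id_tens_glue:
  assumes ok: "ok vs v \<mu>" and hk: "v h \<in> A \<longleftrightarrow> v k \<in> A"
  shows "id_tens theta_phi (glue h k (ssplit2 A) vs v \<mu>)
    = (1 / 2) *\<^sub>v (\<Sum>p\<in>halves \<mu>. \<Sum>q\<in>halves \<mu>. \<Sum>B\<in>Pow (set vs - A).
      if (v h \<in> B \<longleftrightarrow> v k \<in> B) \<and> monochrome A v (rewire \<mu> h k) \<and> v p \<notin> A \<and> v q \<notin> A \<and> (v p \<in> B \<longleftrightarrow> v q \<in> B)
        \<and> \<not> monochrome B v (rewire \<mu> h k)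
      then glue h k (glue p q (split3 A B)) vs v \<mu> else (0 :: (_, 'k::field_char_0) svec))"
proof (cases "cuttable v \<mu> h k")
  case False
  then show ?thesis by (simp add: glue_def linear_zero[OF linear_id_tens[OF linear_theta_phi]] cong: if_cong)
next
  case True
  interpret i: Vector_Spaces.linear "(*\<^sub>v)" "(*\<^sub>v)" "id_tens theta_phi :: 'k graph_space2 \<Rightarrow> _"
    by (rule linear_id_tens[OF linear_theta_phi])
  let ?H = "halves \<mu>"
  define ws where "ws = remove1 (v k) vs"
  define w where "w = merge (v h) (v k) \<circ> v"
  define \<nu> where "\<nu> = rewire \<mu> h k"
  define c where "c = (sg \<mu> h * sg \<mu> k * (-1) ^ pos vs (v k) :: 'k)"
  have glue: "glue h k \<Phi> vs v \<mu> = c *\<^sub>v \<Phi> ws w \<nu>"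
    for \<Phi> :: "nat list \<Rightarrow> ('a \<Rightarrow> nat) \<Rightarrow> ('a \<times> 'a) list \<Rightarrow> ('b::signed_set, 'k) svec"
    using True by (simp add: glue_def c_def ws_def w_def \<nu>_def)
  have okw: "ok ws w \<nu>" using ok_glue[OF ok True] by (simp add: ws_def w_def \<nu>_def)
  note dw = ok_D[OF okw]
  have vhk: "v h \<in> set vs" "v k \<in> set vs" "v h \<noteq> v k" using True ok_D(3)[OF ok] by (auto simp: cuttable_def)
  have sws: "set ws = set vs - {v k}" using ok_D(1)[OF ok] by (simp add: ws_def)
  have "h \<noteq> k" using vhk by auto
  then have sub: "halves \<nu> \<subseteq> ?H"
    using True distinct_halves_rewire(2)[OF ok_D(2)[OF ok], of h k] by (auto simp: \<nu>_def cuttable_def)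
  have wS: "w x \<in> S \<longleftrightarrow> v x \<in> S" if "v h \<in> S \<longleftrightarrow> v k \<in> S" for x S
    using that by (simp add: w_def merge_mem)
  let ?F = "\<lambda>p q B. if monochrome A w \<nu> \<and> w p \<notin> A \<and> w q \<notin> A \<and> (w p \<in> B \<longleftrightarrow> w q \<in> B) \<and> \<not> monochrome B w \<nu>
      then glue p q (split3 A B) ws w \<nu> else (0 :: (_, 'k) svec)"
  let ?G = "\<lambda>p q B. if (v h \<in> B \<longleftrightarrow> v k \<in> B) \<and> monochrome A v \<nu> \<and> v p \<notin> A \<and> v q \<notin> A \<and> (v p \<in> B \<longleftrightarrow> v q \<in> B)
        \<and> \<not> monochrome B v \<nu> then glue p q (split3 A B) ws w \<nu> else (0 :: (_, 'k) svec)"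
  have B: "(\<Sum>B\<in>Pow (set ws - A). ?F p q B) = (\<Sum>B\<in>Pow (set vs - A). ?G p q B)"
    if pq: "p \<in> halves \<nu>" "q \<in> halves \<nu>" for p q
  proof -
    define ext where "ext T = (if v h \<in> T then insert (v k) T else T)" for T
    have "(\<Sum>B\<in>Pow (set ws - A). ?F p q B) = (\<Sum>B\<in>{B \<in> Pow (set vs - A). v h \<in> B \<longleftrightarrow> v k \<in> B}. ?G p q B)"
    proof (rule sum.reindex_bij_witness[of _ "\<lambda>B. B - {v k}" ext])
      fix T assume "T \<in> Pow (set ws - A)"
      then have T: "T \<subseteq> set ws - A" by simp
      then have e: "v h \<in> ext T \<longleftrightarrow> v k \<in> ext T" using sws vhk by (auto simp: ext_def)
      have eT: "x \<in> T \<longleftrightarrow> x \<in> ext T" if "x \<in> set ws" for x using that sws by (auto simp: ext_def)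
      have pqw: "w p \<in> set ws" "w q \<in> set ws" using dw(3) pq by auto
      have "monochrome T w \<nu> = monochrome (ext T) v \<nu>"
        by (rule monochrome_cong) (use dw(3) eT wS[OF e] in auto)
      moreover have "monochrome A w \<nu> = monochrome A v \<nu>"
        by (rule monochrome_cong) (use wS[OF hk] in auto)
      moreover have "glue p q (split3 A T) ws w \<nu> = (glue p q (split3 A (ext T)) ws w \<nu> :: (_, 'k) svec)"
        by (rule glue_cong[OF okw], rule split3_cong) (use eT in auto)
      ultimately show "?G p q (ext T) = ?F p q T"
        using wS[OF hk] wS[OF e] eT[OF pqw(1)] eT[OF pqw(2)] e by simp
    next
      fix T assume T: "T \<in> Pow (set ws - A)"
      then show "ext T - {v k} = T" using sws by (auto simp: ext_def)
      show "ext T \<in> {B \<in> Pow (set vs - A). v h \<in> B \<longleftrightarrow> v k \<in> B}"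
        using T sws vhk hk by (auto simp: ext_def)
    next
      fix B assume B: "B \<in> {B \<in> Pow (set vs - A). v h \<in> B \<longleftrightarrow> v k \<in> B}"
      then show "ext (B - {v k}) = B" using vhk by (auto simp: ext_def)
      show "B - {v k} \<in> Pow (set ws - A)" using B sws by auto
    qed
    also have "\<dots> = (\<Sum>B\<in>Pow (set vs - A). ?G p q B)"
      by (rule sum.mono_neutral_left) auto
    finally show ?thesis .
  qed
  have z: "glue p q (split3 A B) ws w \<nu> = (0 :: (_, 'k) svec)" if "p \<notin> halves \<nu> \<or> q \<notin> halves \<nu>" for p q B
    using that by (auto simp: glue_def cuttable_def)
  have "(\<Sum>p\<in>halves \<nu>. \<Sum>q\<in>halves \<nu>. \<Sum>B\<in>Pow (set ws - A). ?F p q B)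
      = (\<Sum>p\<in>halves \<nu>. \<Sum>q\<in>halves \<nu>. \<Sum>B\<in>Pow (set vs - A). ?G p q B)"
    by (intro sum.cong refl B)
  also have "\<dots> = (\<Sum>p\<in>halves \<nu>. \<Sum>q\<in>?H. \<Sum>B\<in>Pow (set vs - A). ?G p q B)"
    by (intro sum.cong refl sum.mono_neutral_left) (use sub z in \<open>auto intro!: sum.neutral\<close>)
  also have "\<dots> = (\<Sum>p\<in>?H. \<Sum>q\<in>?H. \<Sum>B\<in>Pow (set vs - A). ?G p q B)"
    by (intro sum.mono_neutral_left) (use sub z in \<open>auto intro!: sum.neutral\<close>)
  finally have main: "(\<Sum>p\<in>halves \<nu>. \<Sum>q\<in>halves \<nu>. \<Sum>B\<in>Pow (set ws - A). ?F p q B)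
    = (\<Sum>p\<in>?H. \<Sum>q\<in>?H. \<Sum>B\<in>Pow (set vs - A). ?G p q B)" .
  have "id_tens theta_phi (glue h k (ssplit2 A) vs v \<mu>)
     = c *\<^sub>v (1 / 2) *\<^sub>v (\<Sum>p\<in>?H. \<Sum>q\<in>?H. \<Sum>B\<in>Pow (set vs - A). ?G p q B)"
    unfolding glue i.scale id_tens_ssplit2[OF okw] main ..
  also have "\<dots> = (1 / 2) *\<^sub>v (\<Sum>p\<in>?H. \<Sum>q\<in>?H. \<Sum>B\<in>Pow (set vs - A). c *\<^sub>v ?G p q B)"
    by (simp add: svec.scale_sum_right mult.commute)
  finally show ?thesis unfolding glue \<nu>_def[symmetric] by (simp add: if_distrib[of "(*\<^sub>v) c"] cong: if_cong)
qed


subsection \<open>Counting colourings\<close>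

text \<open>Stated for predicates on half-edges, because the counting argument involves no
  vertices.\<close>

definition mc :: "('h \<Rightarrow> bool) \<Rightarrow> ('h \<times> 'h) list \<Rightarrow> bool" where
  "mc P \<mu> \<longleftrightarrow> (\<forall>e\<in>set \<mu>. P (fst e) \<longleftrightarrow> P (snd e))"

lemma mc_simps [simp]: "mc P []" "mc P (e # \<mu>) \<longleftrightarrow> (P (fst e) \<longleftrightarrow> P (snd e)) \<and> mc P \<mu>"
  by (auto simp: mc_def)

lemma monochrome_mc: "monochrome S v \<mu> = mc (\<lambda>x. v x \<in> S) \<mu>"
  by (simp add: monochrome_def mc_def)

text \<open>
  Colour the half-edges by \<open>P\<close>, by \<open>Q\<close>, and by neither. The predicate says that cutting and gluing at
  \<open>h, k\<close> first splits off the colour \<open>P\<close> and that \<open>p, q\<close> then separates the other two colours.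
\<close>

definition jac :: "('h \<Rightarrow> bool) \<Rightarrow> ('h \<Rightarrow> bool) \<Rightarrow> 'h \<Rightarrow> 'h \<Rightarrow> 'h \<Rightarrow> 'h \<Rightarrow> ('h \<times> 'h) list \<Rightarrow> bool" where
  "jac P Q h k p q \<mu> \<longleftrightarrow> (P h \<longleftrightarrow> P k) \<and> (Q h \<longleftrightarrow> Q k) \<and> \<not> P p \<and> \<not> P q \<and> (Q p \<longleftrightarrow> Q q) \<and>
    \<not> mc P \<mu> \<and> mc P (rewire \<mu> h k) \<and> \<not> mc Q (rewire \<mu> h k)"

text \<open>The summands belong to the three rotations of the colours. The count is a field element
  because it becomes a coefficient.\<close>

definition jcount :: "('h \<Rightarrow> bool) \<Rightarrow> ('h \<Rightarrow> bool) \<Rightarrow> 'h \<Rightarrow> 'h \<Rightarrow> 'h \<Rightarrow> 'h \<Rightarrow> ('h \<times> 'h) list \<Rightarrow> 'k::field" where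
  "jcount P Q h k p q \<mu> = of_bool (jac P Q h k p q \<mu>) + of_bool (jac Q (\<lambda>x. \<not> P x \<and> \<not> Q x) h k p q \<mu>)
    + of_bool (jac (\<lambda>x. \<not> P x \<and> \<not> Q x) P h k p q \<mu>)"

text \<open>Whether a colouring is monochrome does not depend on the order of the edges or on
  arrows. \<open>sy\<close> forgets both at once.\<close>

definition sy :: "('h \<times> 'h) list \<Rightarrow> ('h \<times> 'h) set" where
  "sy \<mu> = set \<mu> \<union> (set \<mu>)\<inverse>"

lemma sy_simps [simp]: "sy [] = {}" "sy ((a, b) # \<mu>) = {(a, b), (b, a)} \<union> sy \<mu>"
  by (auto simp: sy_def)

lemma sy_mset: "mset \<mu> = mset \<mu>' \<Longrightarrow> sy \<mu> = sy \<mu>'"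
  unfolding sy_def by (metis mset_eq_setD)

lemma mc_sy: "sy \<mu> = sy \<mu>' \<Longrightarrow> mc P \<mu> = mc P \<mu>'"
proof -
  have "mc P \<nu> \<longleftrightarrow> (\<forall>(x, y)\<in>sy \<nu>. P x \<longleftrightarrow> P y)" for \<nu> by (auto simp: mc_def sy_def)
  then show "sy \<mu> = sy \<mu>' \<Longrightarrow> mc P \<mu> = mc P \<mu>'" by simp
qed

lemma par_sy:
  assumes "distinct_halves \<mu>" "distinct_halves \<mu>'" "sy \<mu> = sy \<mu>'"
  shows "par \<mu> h = par \<mu>' h" "halves \<mu> = halves \<mu>'"
proof -
  have H: "halves \<nu> = fst ` sy \<nu>" for \<nu> :: "('a \<times> 'a) list" by (force simp: sy_def halves_def)
  show halves: "halves \<mu> = halves \<mu>'" unfolding H assms(3) ..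
  have p: "par \<nu> x = y" if "distinct_halves \<nu>" "(x, y) \<in> sy \<nu>" for \<nu> and x y :: 'a
    using that par_sg_in(1,2)[OF that(1)] by (auto simp: sy_def)
  show "par \<mu> h = par \<mu>' h"
  proof (cases "h \<in> halves \<mu>")
    case True
    then obtain y where "(h, y) \<in> sy \<mu>" unfolding H by force
    then show ?thesis using p[OF assms(1)] p[OF assms(2)] assms(3) by metis
  next
    case False
    then show ?thesis using halves by (simp add: par_notin)
  qed
qed

lemma sy_rewire:
  assumes "distinct_halves \<mu>" "distinct_halves \<mu>'" "sy \<mu> = sy \<mu>'"
  shows "sy (rewire \<mu> h k) = sy (rewire \<mu>' h k)"
proof -
  have "sy (filter (untouched h k) \<nu>) = {e \<in> sy \<nu>. untouched h k e}" for \<nu>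
    by (auto simp: sy_def untouched_def)
  then show ?thesis using par_sy(1)[OF assms] assms(3) by (simp add: rewire_def)
qed

text \<open>The hypotheses hold whenever the doubly glued term does not vanish and the colours of
  each pair match. The final graph being monochrome equates the colours of the ends left over, which
  reduces each configuration of edges to a check of finitely many truth values.\<close>

lemma jcount_sym:
  assumes d: "distinct_halves \<mu>" and hk: "h \<in> halves \<mu>" "k \<in> halves \<mu>" "h \<noteq> k" "par \<mu> h \<noteq> k"
    and pq: "p \<in> halves \<mu>" "q \<in> halves \<mu>" "p \<noteq> q" "par \<mu> p \<noteq> q" "par (rewire \<mu> h k) p \<noteq> q"
    and ne: "p \<noteq> h" "p \<noteq> k" "q \<noteq> h" "q \<noteq> k"
    and col: "P h \<longleftrightarrow> P k" "Q h \<longleftrightarrow> Q k" "P p \<longleftrightarrow> P q" "Q p \<longleftrightarrow> Q q" and excl: "\<And>x. \<not> (P x \<and> Q x)"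
    and m: "mc P (rewire (rewire \<mu> h k) p q)" "mc Q (rewire (rewire \<mu> h k) p q)"
  shows "jcount P Q h k p q \<mu> = (jcount P Q p q h k \<mu> :: 'k::field)"
proof -
  define G where "G \<nu> \<longleftrightarrow> (distinct_halves \<nu> \<and> par \<nu> h \<noteq> k \<and> par \<nu> p \<noteq> q \<and> par (rewire \<nu> h k) p \<noteq> q
    \<and> h \<in> halves \<nu> \<and> k \<in> halves \<nu>
    \<and> mc P (rewire (rewire \<nu> h k) p q) \<and> mc Q (rewire (rewire \<nu> h k) p q) \<longrightarrow>
      jcount P Q h k p q \<nu> = (jcount P Q p q h k \<nu> :: 'k))" for \<nu>
  have G_sy: "G \<nu>'" if G: "G \<nu>" and dd: "distinct_halves \<nu>' \<Longrightarrow> distinct_halves \<nu>" and s: "sy \<nu> = sy \<nu>'" for \<nu> \<nu>'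
    unfolding G_def
  proof (intro impI, elim conjE)
    assume d': "distinct_halves \<nu>'" and c: "par \<nu>' h \<noteq> k" "par \<nu>' p \<noteq> q" "par (rewire \<nu>' h k) p \<noteq> q"
      "h \<in> halves \<nu>'" "k \<in> halves \<nu>'"
      "mc P (rewire (rewire \<nu>' h k) p q)" "mc Q (rewire (rewire \<nu>' h k) p q)"
    note ps = par_sy[OF dd[OF d'] d' s] and rs = sy_rewire[OF dd[OF d'] d' s]
    have r: "distinct_halves (rewire \<nu>' h k)" "distinct_halves (rewire \<nu> h k)"
      using distinct_halves_rewire(1)[OF d' c(4,5) hk(3) c(1)]
        distinct_halves_rewire(1)[of \<nu> h k] dd[OF d'] c ps hk(3) by auto
    have "jac P' Q' a b a' b' \<nu>' = jac P' Q' a b a' b' \<nu>" for P' Q' a b a' b'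
      unfolding jac_def using mc_sy[OF s] mc_sy[OF rs] by metis
    moreover have "jcount P Q h k p q \<nu> = (jcount P Q p q h k \<nu> :: 'k)"
      using G unfolding G_def
      using dd[OF d'] c ps(1)[of h] ps(1)[of p] ps(2) par_sy(1)[OF r(2,1) rs, of p]
        mc_sy[OF sy_rewire[OF r(2,1) rs, of p q]] by metis
    ultimately show "jcount P Q h k p q \<nu>' = (jcount P Q p q h k \<nu>' :: 'k)" by (simp add: jcount_def)
  qed
  have perm: "G \<nu>'" if "mset \<nu> = mset \<nu>'" "G \<nu>" for \<nu> \<nu>'
    using that(2) by (rule G_sy) (use sy_mset[OF that(1)] distinct_halves_mset[OF that(1)] in auto)
  have rev: "G ((b, a) # \<nu>)" if "G ((a, b) # \<nu>)" for a b \<nu>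
    using that by (rule G_sy) auto
  have "G \<mu>" using d hk perm rev
  proof (rule two_front)
    fix a b R
    assume D: "distinct_halves ((h, a) # (b, k) # R)" and H: "halves ((h, a) # (b, k) # R) = halves \<mu>"
    let ?\<nu> = "(h, a) # (b, k) # R"
    have perm2: "G ((h, a) # (b, k) # \<nu>')" if "mset \<nu> = mset \<nu>'" "G ((h, a) # (b, k) # \<nu>)" for \<nu> \<nu>'
      using perm[OF _ that(2), of "(h, a) # (b, k) # \<nu>'"] that(1) by simp
    have rev2: "G ((h, a) # (b, k) # (d, c) # \<nu>)" if "G ((h, a) # (b, k) # (c, d) # \<nu>)" for c d \<nu>
    proof -
      have "G ((c, d) # (h, a) # (b, k) # \<nu>)" by (rule perm[OF _ that]) simp
      from rev[OF this] show ?thesis by (rule perm[rotated]) simp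
    qed
    have pR: "p = a \<or> p = b \<or> p \<in> halves R" and qR: "q = a \<or> q = b \<or> q \<in> halves R"
      using H pq(1,2) ne by auto
    note simps = rewire_def untouched_def filter_untouched
    have mcR: "mc (\<lambda>x. \<not> P x \<and> \<not> Q x) R'" if "mc P R'" "mc Q R'" for R'
      using that by (auto simp: mc_def)
    \<comment> \<open>With \<open>p\<close> complementary to \<open>h\<close> or \<open>k\<close>,
      the colours of \<open>h\<close>, of \<open>q\<close> and of one remaining end decide
      everything; in either order the count is 1 exactly if these three differ pairwise.\<close>
    have special: "G ((h, a) # (b, k) # (q, d) # R')" if "p = a \<or> p = b" for d R'
      unfolding G_def
    proof (intro impI, elim conjE)
      let ?\<mu> = "(h, a) # (b, k) # (q, d) # R'"
      assume D': "distinct_halves ?\<mu>" and m: "mc P (rewire (rewire ?\<mu> h k) p q)" "mc Q (rewire (rewire ?\<mu> h k) p q)"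
      have r1: "rewire ?\<mu> h k = (b, a) # (q, d) # R'" using D' ne hk(3) by (auto simp: simps)
      show "jcount P Q h k p q ?\<mu> = (jcount P Q p q h k ?\<mu> :: 'k)"
      proof (cases "p = a")
        case True
        have r: "rewire ((b, a) # (q, d) # R') p q = (d, b) # R'" "rewire ?\<mu> p q = (d, h) # (b, k) # R'"
          unfolding True using D' ne pq(3) True by (auto simp: simps)
        have mm: "mc P R'" "mc Q R'" "P d \<longleftrightarrow> P b" "Q d \<longleftrightarrow> Q b" using m by (simp_all add: r1 r)
        show ?thesis
          unfolding jcount_def jac_def r1 r using mm mcR[OF mm(1,2)] col excl[of h] excl[of q] excl[of b] True
          by (cases "P h"; cases "Q h"; cases "P q"; cases "Q q"; cases "P b"; cases "Q b"; simp)
      next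
        case False
        then have p: "p = b" using that by simp
        have r: "rewire ((b, a) # (q, d) # R') p q = (d, a) # R'" "rewire ?\<mu> p q = (d, k) # (h, a) # R'"
          unfolding p using D' ne pq(3) p by (auto simp: simps)
        have mm: "mc P R'" "mc Q R'" "P d \<longleftrightarrow> P a" "Q d \<longleftrightarrow> Q a" using m by (simp_all add: r1 r)
        show ?thesis
          unfolding jcount_def jac_def r1 r using mm mcR[OF mm(1,2)] col excl[of h] excl[of q] excl[of a] p
          by (cases "P h"; cases "Q h"; cases "P q"; cases "Q q"; cases "P a"; cases "Q a"; simp)
      qed
    qed
    have special': "G ((h, a) # (b, k) # (p, d) # R')" if "q = a \<or> q = b" for d R'
      unfolding G_def
    proof (intro impI, elim conjE)
      let ?\<mu> = "(h, a) # (b, k) # (p, d) # R'"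
      assume D': "distinct_halves ?\<mu>" and m: "mc P (rewire (rewire ?\<mu> h k) p q)" "mc Q (rewire (rewire ?\<mu> h k) p q)"
      have r1: "rewire ?\<mu> h k = (b, a) # (p, d) # R'" using D' ne hk(3) by (auto simp: simps)
      show "jcount P Q h k p q ?\<mu> = (jcount P Q p q h k ?\<mu> :: 'k)"
      proof (cases "q = a")
        case True
        have r: "rewire ((b, a) # (p, d) # R') p q = (b, d) # R'" "rewire ?\<mu> p q = (h, d) # (b, k) # R'"
          unfolding True using D' ne pq(3) True by (auto simp: simps)
        have mm: "mc P R'" "mc Q R'" "P b \<longleftrightarrow> P d" "Q b \<longleftrightarrow> Q d" using m by (simp_all add: r1 r)
        show ?thesis
          unfolding jcount_def jac_def r1 r using mm mcR[OF mm(1,2)] col excl[of h] excl[of p] excl[of b] True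
          by (cases "P h"; cases "Q h"; cases "P p"; cases "Q p"; cases "P b"; cases "Q b"; simp)
      next
        case False
        then have q: "q = b" using that by simp
        have r: "rewire ((b, a) # (p, d) # R') p q = (a, d) # R'" "rewire ?\<mu> p q = (k, d) # (h, a) # R'"
          unfolding q using D' ne pq(3) q by (auto simp: simps)
        have mm: "mc P R'" "mc Q R'" "P a \<longleftrightarrow> P d" "Q a \<longleftrightarrow> Q d" using m by (simp_all add: r1 r)
        show ?thesis
          unfolding jcount_def jac_def r1 r using mm mcR[OF mm(1,2)] col excl[of h] excl[of p] excl[of a] q
          by (cases "P h"; cases "Q h"; cases "P p"; cases "Q p"; cases "P a"; cases "Q a"; simp)
      qed
    qed
    have generic: "G ((h, a) # (b, k) # (p, c) # (d, q) # R')" for c d R'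
      unfolding G_def
    proof (intro impI, elim conjE)
      let ?\<mu> = "(h, a) # (b, k) # (p, c) # (d, q) # R'"
      assume D': "distinct_halves ?\<mu>" and m: "mc P (rewire (rewire ?\<mu> h k) p q)" "mc Q (rewire (rewire ?\<mu> h k) p q)"
      have r: "rewire ?\<mu> h k = (b, a) # (p, c) # (d, q) # R'"
        "rewire ((b, a) # (p, c) # (d, q) # R') p q = (d, c) # (b, a) # R'"
        "rewire ?\<mu> p q = (d, c) # (h, a) # (b, k) # R'"
        using D' ne hk(3) pq(3) by (auto simp: simps)
      have mm: "mc P R'" "mc Q R'" "P d \<longleftrightarrow> P c" "Q d \<longleftrightarrow> Q c" "P b \<longleftrightarrow> P a" "Q b \<longleftrightarrow> Q a"
        using m by (simp_all add: r)
      let ?N = "\<lambda>x. \<not> P x \<and> \<not> Q x"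
      \<comment> \<open>The ends \<open>a, b\<close> share a colour, and so do \<open>c, d\<close>,
        so only the edges from \<open>h\<close> to \<open>a\<close> and from \<open>p\<close> to
        \<open>c\<close> can fail to be monochrome.\<close>
      have jac: "jac T U h k p q ?\<mu> \<longleftrightarrow> \<not> T p \<and> \<not> (T h \<longleftrightarrow> T a) \<and> (T p \<longleftrightarrow> T c) \<and> \<not> (U p \<longleftrightarrow> U c)"
        "jac T U p q h k ?\<mu> \<longleftrightarrow> \<not> T h \<and> \<not> (T p \<longleftrightarrow> T c) \<and> (T h \<longleftrightarrow> T a) \<and> \<not> (U h \<longleftrightarrow> U a)"
        if "T \<in> {P, Q, ?N}" "U \<in> {P, Q, ?N}" for T U
      proof -
        have "mc T' R' \<and> (T' d \<longleftrightarrow> T' c) \<and> (T' b \<longleftrightarrow> T' a) \<and> (T' h \<longleftrightarrow> T' k) \<and> (T' p \<longleftrightarrow> T' q)"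
          if "T' \<in> {P, Q, ?N}" for T'
          using that mm mcR[OF mm(1,2)] col by auto
        note T = this[OF that(1)] and U = this[OF that(2)]
        show "jac T U h k p q ?\<mu> \<longleftrightarrow> \<not> T p \<and> \<not> (T h \<longleftrightarrow> T a) \<and> (T p \<longleftrightarrow> T c) \<and> \<not> (U p \<longleftrightarrow> U c)"
          "jac T U p q h k ?\<mu> \<longleftrightarrow> \<not> T h \<and> \<not> (T p \<longleftrightarrow> T c) \<and> (T h \<longleftrightarrow> T a) \<and> \<not> (U h \<longleftrightarrow> U a)"
          unfolding jac_def r mc_simps fst_conv snd_conv using T U by blast+
      qed
      have jacs: "jac P Q h k p q ?\<mu> \<longleftrightarrow> \<not> P p \<and> \<not> (P h \<longleftrightarrow> P a) \<and> (P p \<longleftrightarrow> P c) \<and> \<not> (Q p \<longleftrightarrow> Q c)"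
        "jac P Q p q h k ?\<mu> \<longleftrightarrow> \<not> P h \<and> \<not> (P p \<longleftrightarrow> P c) \<and> (P h \<longleftrightarrow> P a) \<and> \<not> (Q h \<longleftrightarrow> Q a)"
        "jac Q ?N h k p q ?\<mu> \<longleftrightarrow> \<not> Q p \<and> \<not> (Q h \<longleftrightarrow> Q a) \<and> (Q p \<longleftrightarrow> Q c) \<and> \<not> (?N p \<longleftrightarrow> ?N c)"
        "jac Q ?N p q h k ?\<mu> \<longleftrightarrow> \<not> Q h \<and> \<not> (Q p \<longleftrightarrow> Q c) \<and> (Q h \<longleftrightarrow> Q a) \<and> \<not> (?N h \<longleftrightarrow> ?N a)"
        "jac ?N P h k p q ?\<mu> \<longleftrightarrow> \<not> ?N p \<and> \<not> (?N h \<longleftrightarrow> ?N a) \<and> (?N p \<longleftrightarrow> ?N c) \<and> \<not> (P p \<longleftrightarrow> P c)"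
        "jac ?N P p q h k ?\<mu> \<longleftrightarrow> \<not> ?N h \<and> \<not> (?N p \<longleftrightarrow> ?N c) \<and> (?N h \<longleftrightarrow> ?N a) \<and> \<not> (P h \<longleftrightarrow> P a)"
        by (intro jac; simp)+
      show "jcount P Q h k p q ?\<mu> = (jcount P Q p q h k ?\<mu> :: 'k)"
        unfolding jcount_def jacs using excl[of h] excl[of p] excl[of a] excl[of c]
        by (cases "P h"; cases "Q h"; cases "P p"; cases "Q p"; cases "P a"; cases "Q a"; cases "P c"; cases "Q c"; simp)
    qed
    consider "p = a \<and> q = b \<or> p = b \<and> q = a" | "p = a \<or> p = b" "q \<in> halves R" | "q = a \<or> q = b" "p \<in> halves R"
      | "p \<in> halves R" "q \<in> halves R" using pR qR pq(3) by blast
    then show "G ?\<nu>"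
    proof cases
      case 1
      then have "par (rewire ?\<nu> h k) p = q" using D by (auto simp: simps)
      then show ?thesis unfolding G_def by blast
    next
      case 2
      show ?thesis by (rule one_front[where P = "\<lambda>\<nu>. G ((h, a) # (b, k) # \<nu>)", OF 2(2) perm2 rev2 special[OF 2(1)]])
    next
      case 3
      show ?thesis by (rule one_front[where P = "\<lambda>\<nu>. G ((h, a) # (b, k) # \<nu>)", OF 3(2) perm2 rev2 special'[OF 3(1)]])
    next
      case 4
      show ?thesis
      proof (cases "par R p = q")
        case True
        then have "par ?\<nu> p = q" using 4 D by auto
        then show ?thesis unfolding G_def by blast
      next
        case False
        have dR: "distinct_halves R" using D by simp
        show ?thesis
          by (rule two_front[where P = "\<lambda>\<nu>. G ((h, a) # (b, k) # \<nu>)", OF dR 4 pq(3) False perm2 rev2 generic])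
      qed
    qed
  qed
  then show ?thesis unfolding G_def using d hk pq m by blast
qed

lemma glue_nonzero:
  assumes "glue h k \<Phi> vs v \<mu> \<noteq> 0"
  shows "cuttable v \<mu> h k" "\<Phi> (remove1 (v k) vs) (merge (v h) (v k) \<circ> v) (rewire \<mu> h k) \<noteq> 0"
  using assms by (auto simp: glue_def split: if_splits)

text \<open>If the colours within a pair do not match, both coefficients vanish. If one doubly glued
  term vanishes, so does the other by \<open>glue_glue\<close>. Otherwise non-vanishing supplies the
  hypotheses of \<open>jcount_sym\<close>.\<close>

lemma jcount_glue_glue:
  fixes A B :: "nat set"
  assumes ok: "ok vs v \<mu>" and disj: "A \<inter> B = {}" and hk: "h \<in> halves \<mu>" "k \<in> halves \<mu>" "p \<in> halves \<mu>" "q \<in> halves \<mu>"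
  defines "N \<equiv> \<lambda>h k p q. jcount (\<lambda>x. v x \<in> A) (\<lambda>x. v x \<in> B) h k p q \<mu> :: 'k::field"
    and "X \<equiv> \<lambda>h k p q. glue h k (glue p q (split3 A B)) vs v \<mu> :: (_, 'k) svec"
  shows "N h k p q *\<^sub>v X h k p q = - (N p q h k *\<^sub>v X p q h k)"
proof (cases "(v h \<in> A \<longleftrightarrow> v k \<in> A) \<and> (v h \<in> B \<longleftrightarrow> v k \<in> B) \<and> (v p \<in> A \<longleftrightarrow> v q \<in> A) \<and> (v p \<in> B \<longleftrightarrow> v q \<in> B)")
  case False
  have "\<not> (v x \<in> A \<and> v x \<in> B)" for x using disj by auto
  then have "N h k p q = 0" "N p q h k = 0" using False unfolding N_def jcount_def jac_def by auto
  then show ?thesis by simp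
next
  case col: True
  have anti: "X h k p q = - X p q h k"
    unfolding X_def by (rule glue_glue[OF good_split3 ok]) (use col in auto)
  show ?thesis
  proof (cases "X h k p q = 0")
    case True
    then show ?thesis using anti by simp
  next
    case False
    note nz1 = glue_nonzero[OF False[unfolded X_def]]
    note c1 = nz1(1) and nz2 = glue_nonzero[OF nz1(2)]
    let ?w = "merge (v h) (v k) \<circ> v" and ?\<nu> = "rewire \<mu> h k"
    note c2 = nz2(1)
    let ?w' = "merge (?w p) (?w q) \<circ> ?w" and ?\<nu>' = "rewire (rewire \<mu> h k) p q"
    have w: "?w x \<in> A \<longleftrightarrow> v x \<in> A" "?w x \<in> B \<longleftrightarrow> v x \<in> B" for x using col by (simp_all add: merge_mem)
    have w': "?w' x \<in> A \<longleftrightarrow> v x \<in> A" "?w' x \<in> B \<longleftrightarrow> v x \<in> B" for x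
    proof -
      have "?w p \<in> A \<longleftrightarrow> ?w q \<in> A" "?w p \<in> B \<longleftrightarrow> ?w q \<in> B" using w col by blast+
      from this[THEN merge_mem, of "?w x"] w[of x]
      show "?w' x \<in> A \<longleftrightarrow> v x \<in> A" "?w' x \<in> B \<longleftrightarrow> v x \<in> B" by (simp_all only: comp_apply)
    qed
    \<comment> \<open>Anticommutation carries non-vanishing over to the other order, which shows
      that \<open>p, q\<close> can be cut in the original graph too.\<close>
    have "X p q h k \<noteq> 0" using False anti by simp
    then have c3: "cuttable v \<mu> p q" unfolding X_def by (rule glue_nonzero)
    have nz: "split3 A B (remove1 (?w q) (remove1 (v k) vs)) ?w' ?\<nu>' \<noteq> (0 :: (_, 'k) svec)"
      by (rule nz2(2))
    then have mA: "monochrome A ?w' ?\<nu>'" by (auto simp: split3_def tensor_def split: if_splits)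
    have "monochrome B ?w' (epart (- A) ?w' ?\<nu>')"
    proof (rule ccontr)
      assume "\<not> monochrome B ?w' (epart (- A) ?w' ?\<nu>')"
      then have "split3 A B (remove1 (?w q) (remove1 (v k) vs)) ?w' ?\<nu>' = (0 :: (_, 'k) svec)"
        by (simp only: split3_def tensor_def ssplit2_def split2_def if_False tens_zero svec.scale_zero_right if_cancel)
      then show False using nz by contradiction
    qed
    then have mB: "monochrome B ?w' ?\<nu>'" using monochrome_epart[OF disj mA] by simp
    have m: "mc (\<lambda>x. v x \<in> A) ?\<nu>'" "mc (\<lambda>x. v x \<in> B) ?\<nu>'"
      using mA mB unfolding monochrome_mc w' by auto
    have ne: "h \<noteq> k" "p \<noteq> q" using c1 c3 by (auto simp: cuttable_def)
    have H: "halves ?\<nu> = halves \<mu> - {h, k}"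
      using c1 ne by (intro distinct_halves_rewire(2)[OF ok_D(2)[OF ok]]) (auto simp: cuttable_def)
    have "N h k p q = N p q h k"
      unfolding N_def
      by (rule jcount_sym[OF ok_D(2)[OF ok] hk(1,2) ne(1) _ hk(3,4) ne(2)])
        (use c1 c2 c3 H col m disj in \<open>auto simp: cuttable_def\<close>)
    then show ?thesis using anti by (simp add: svec.scale_minus_right)
  qed
qed


section \<open>The co-Jacobi identity on marked graphs\<close>

lemma mc_cong: "(\<And>x. x \<in> halves \<mu> \<Longrightarrow> P x = P' x) \<Longrightarrow> mc P \<mu> = mc P' \<mu>"
  unfolding mc_def by (intro ball_cong refl) (simp add: halves_def)

lemma jac_cong:
  assumes P: "\<And>x. x \<in> halves \<mu> \<Longrightarrow> P x = P' x" and Q: "\<And>x. x \<in> halves \<mu> \<Longrightarrow> Q x = Q' x"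
    and hk: "h \<in> halves \<mu>" "k \<in> halves \<mu>" "p \<in> halves \<mu>" "q \<in> halves \<mu>"
  shows "jac P Q h k p q \<mu> = jac P' Q' h k p q \<mu>"
proof -
  have "x \<in> halves \<mu>" if "x \<in> halves (rewire \<mu> h k)" for x
  proof -
    have "halves (filter f \<mu>) \<subseteq> halves \<mu>" for f by (auto simp: halves_def)
    then show ?thesis using that par_in[OF hk(1)] par_in[OF hk(2)] by (auto simp: rewire_def)
  qed
  then have "mc P (rewire \<mu> h k) = mc P' (rewire \<mu> h k)" "mc Q (rewire \<mu> h k) = mc Q' (rewire \<mu> h k)"
    using P Q by (auto intro!: mc_cong)
  moreover have "mc P \<mu> = mc P' \<mu>" using P by (rule mc_cong)
  ultimately show ?thesis using P Q hk by (simp add: jac_def)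
qed

lemma eq_minus_imp_zero:
  fixes x :: "('b::signed_set, 'k::field_char_0) svec"
  assumes "x = - x"
  shows "x = 0"
proof -
  have "x + x = 0" by (subst (2) assms) simp
  then have "(1 + 1 :: 'k) *\<^sub>v x = 0" by (simp only: svec.scale_left_distrib svec.scale_one)
  then show ?thesis by simp
qed

text \<open>Reindexing the colourings moves the rotation from the terms to the conditions. The three
  summands then have the same terms, with coefficients adding up to \<open>jcount\<close>, and
  exchanging the two operations shows that the total is its own negative.\<close>

lemma co_jacobi_gvec:
  assumes ok: "ok vs v \<mu>"
  defines "t \<equiv> id_tens theta_phi (theta_phi (gvec vs v \<mu>)) :: (_, 'k::field_char_0) svec"
    and "\<sigma> \<equiv> sigma shifted_degree :: (_, 'k) svec \<Rightarrow> _"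
  shows "t + \<sigma> t + \<sigma> (\<sigma> t) = 0"
proof -
  interpret i: Vector_Spaces.linear "(*\<^sub>v)" "(*\<^sub>v)" "id_tens theta_phi :: 'k graph_space2 \<Rightarrow> _"
    by (rule linear_id_tens[OF linear_theta_phi])
  interpret s: Vector_Spaces.linear "(*\<^sub>v)" "(*\<^sub>v)" \<sigma>
    unfolding \<sigma>_def by (rule linear_sigma[OF grading_shifted_degree])
  let ?H = "halves \<mu>" and ?V = "set vs"
  define Pr where "Pr = (SIGMA A:Pow ?V. Pow (?V - A))"
  define X where "X h k p q A B = (glue h k (glue p q (split3 A B)) vs v \<mu> :: (_, 'k) svec)" for h k p q A B
  \<comment> \<open>The condition \<open>c\<close> is a parameter, so that \<open>\<sigma>\<close>
    acts by changing it; 1/4 collects the factors 1/2 of the two operations.\<close>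
  define S where "S c = (1 / 4) *\<^sub>v (\<Sum>h\<in>?H. \<Sum>k\<in>?H. \<Sum>p\<in>?H. \<Sum>q\<in>?H. \<Sum>(A, B)\<in>Pr.
      of_bool (c h k p q A B) *\<^sub>v X h k p q A B)" for c
  define J where "J h k p q A B = jac (\<lambda>x. v x \<in> A) (\<lambda>x. v x \<in> B) h k p q \<mu>" for h k p q A B
  have t: "t = S J"
  proof -
    let ?c1 = "\<lambda>h k A. (v h \<in> A \<longleftrightarrow> v k \<in> A) \<and> \<not> monochrome A v \<mu>"
    have "t = (1 / 2) *\<^sub>v (\<Sum>h\<in>?H. \<Sum>k\<in>?H. \<Sum>A\<in>Pow ?V.
        if ?c1 h k A then id_tens theta_phi (glue h k (ssplit2 A) vs v \<mu>) else 0)"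
      by (simp add: t_def theta_phi_gvec[OF ok] i.scale i.sum if_distrib[of "id_tens theta_phi"] i.zero cong: if_cong)
    also have "\<dots> = (1 / 2) *\<^sub>v (\<Sum>h\<in>?H. \<Sum>k\<in>?H. \<Sum>A\<in>Pow ?V.
        (1 / 2) *\<^sub>v (\<Sum>p\<in>?H. \<Sum>q\<in>?H. \<Sum>B\<in>Pow (?V - A). of_bool (J h k p q A B) *\<^sub>v X h k p q A B))"
    proof (intro arg_cong[of _ _ "(*\<^sub>v) (1 / 2)"] sum.cong refl)
      fix h k A
      show "(if ?c1 h k A then id_tens theta_phi (glue h k (ssplit2 A) vs v \<mu>) else 0)
        = (1 / 2) *\<^sub>v (\<Sum>p\<in>?H. \<Sum>q\<in>?H. \<Sum>B\<in>Pow (?V - A). of_bool (J h k p q A B) *\<^sub>v X h k p q A B)"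
      proof (cases "?c1 h k A")
        case True
        show ?thesis
          unfolding if_P[OF True] id_tens_glue[OF ok conjunct1[OF True]]
          by (intro arg_cong[of _ _ "(*\<^sub>v) (1 / 2)"] sum.cong refl)
            (use True in \<open>simp add: J_def jac_def X_def flip: monochrome_mc\<close>)
      next
        case False
        then have "\<not> J h k p q A B" for p q B by (auto simp: J_def jac_def monochrome_mc)
        then show ?thesis by (subst if_not_P[OF False]) simp
      qed
    qed
    also have "\<dots> = (1 / 4) *\<^sub>v (\<Sum>h\<in>?H. \<Sum>k\<in>?H. \<Sum>A\<in>Pow ?V.
        \<Sum>p\<in>?H. \<Sum>q\<in>?H. \<Sum>B\<in>Pow (?V - A). of_bool (J h k p q A B) *\<^sub>v X h k p q A B)"
      by (simp add: flip: svec.scale_sum_right)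
    also have "\<dots> = S J"
      unfolding S_def Pr_def
    proof (intro arg_cong[of _ _ "(*\<^sub>v) (1 / 4)"] sum.cong refl)
      fix h k
      let ?g = "\<lambda>p q A B. of_bool (J h k p q A B) *\<^sub>v X h k p q A B"
      have "(\<Sum>A\<in>Pow ?V. \<Sum>p\<in>?H. \<Sum>q\<in>?H. \<Sum>B\<in>Pow (?V - A). ?g p q A B)
        = (\<Sum>p\<in>?H. \<Sum>q\<in>?H. \<Sum>A\<in>Pow ?V. \<Sum>B\<in>Pow (?V - A). ?g p q A B)"
        by (subst sum.swap, intro sum.cong refl, rule sum.swap)
      also have "\<dots> = (\<Sum>p\<in>?H. \<Sum>q\<in>?H. \<Sum>(A, B)\<in>(SIGMA A:Pow ?V. Pow (?V - A)). ?g p q A B)"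
        by (intro sum.cong refl sum.Sigma) auto
      finally show "(\<Sum>A\<in>Pow ?V. \<Sum>p\<in>?H. \<Sum>q\<in>?H. \<Sum>B\<in>Pow (?V - A). ?g p q A B)
        = (\<Sum>p\<in>?H. \<Sum>q\<in>?H. \<Sum>(A, B)\<in>(SIGMA A:Pow ?V. Pow (?V - A)). ?g p q A B)" .
    qed
    finally show ?thesis .
  qed
  have sS: "\<sigma> (S c) = S (\<lambda>h k p q A B. c h k p q B (?V - A - B))" for c
  proof -
    have "\<sigma> (S c) = (1 / 4) *\<^sub>v (\<Sum>h\<in>?H. \<Sum>k\<in>?H. \<Sum>p\<in>?H. \<Sum>q\<in>?H. \<Sum>(A, B)\<in>Pr.
        of_bool (c h k p q A B) *\<^sub>v \<sigma> (X h k p q A B))"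
      by (simp add: S_def s.scale s.sum case_prod_unfold)
    also have "\<dots> = S (\<lambda>h k p q A B. c h k p q B (?V - A - B))"
      unfolding S_def
    proof (rule arg_cong[of _ _ "(*\<^sub>v) (1 / 4)"], rule sum.cong[OF refl], rule sum.cong[OF refl],
        rule sum.cong[OF refl], rule sum.cong[OF refl])
      fix h k p q
      have "\<sigma> (X h k p q A B) = X h k p q (?V - A - B) A" if "(A, B) \<in> Pr" for A B
        unfolding \<sigma>_def X_def by (rule sigma_glue_glue[OF ok]) (use that in \<open>auto simp: Pr_def\<close>)
      then have "(\<Sum>(A, B)\<in>Pr. of_bool (c h k p q A B) *\<^sub>v \<sigma> (X h k p q A B))
        = (\<Sum>(A, B)\<in>Pr. of_bool (c h k p q A B) *\<^sub>v X h k p q (?V - A - B) A)"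
        by (intro sum.cong refl) auto
      \<comment> \<open>The two witnesses are the rotation of an ordered partition of
        \<open>?V\<close> into three possibly empty blocks, and its inverse.\<close>
      also have "\<dots> = (\<Sum>(A, B)\<in>Pr. of_bool (c h k p q B (?V - A - B)) *\<^sub>v X h k p q A B)"
        by (rule sum.reindex_bij_witness[of _ "\<lambda>(A, B). (B, ?V - A - B)" "\<lambda>(A, B). (?V - A - B, A)"])
          (auto simp: Pr_def intro!: arg_cong2[of _ _ _ _ "\<lambda>u w. of_bool u *\<^sub>v w"] arg_cong[of _ _ "c h k p q _"])
      finally show "(\<Sum>(A, B)\<in>Pr. of_bool (c h k p q A B) *\<^sub>v \<sigma> (X h k p q A B))
        = (\<Sum>(A, B)\<in>Pr. of_bool (c h k p q B (?V - A - B)) *\<^sub>v X h k p q A B)" .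
    qed
    finally show ?thesis .
  qed
  define N where "N h k p q A B = (jcount (\<lambda>x. v x \<in> A) (\<lambda>x. v x \<in> B) h k p q \<mu> :: 'k)" for h k p q A B
  define Y where "Y h k p q = (\<Sum>(A, B)\<in>Pr. N h k p q A B *\<^sub>v X h k p q A B)" for h k p q
  have "t + \<sigma> t + \<sigma> (\<sigma> t) = (1 / 4) *\<^sub>v (\<Sum>h\<in>?H. \<Sum>k\<in>?H. \<Sum>p\<in>?H. \<Sum>q\<in>?H. Y h k p q)"
    unfolding t sS unfolding S_def svec.scale_right_distrib[symmetric] sum.distrib[symmetric] Y_def
  proof (intro arg_cong[of _ _ "(*\<^sub>v) (1 / 4)"] sum.cong[OF refl], clarify)
    fix h k p q A B
    assume H: "h \<in> ?H" "k \<in> ?H" "p \<in> ?H" "q \<in> ?H" and AB: "(A, B) \<in> Pr"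
    \<comment> \<open>The second rotation starts from the pair \<open>(B, ?V - A - B)\<close>, whose
      third block is \<open>A\<close>.\<close>
    have C: "?V - B - (?V - A - B) = A" using AB by (auto simp: Pr_def)
    have R: "v x \<in> ?V - A - B \<longleftrightarrow> v x \<notin> A \<and> v x \<notin> B" if "x \<in> ?H" for x
      using ok_D(3)[OF ok that] by auto
    have "J h k p q B (?V - A - B) = jac (\<lambda>x. v x \<in> B) (\<lambda>x. v x \<notin> A \<and> v x \<notin> B) h k p q \<mu>"
      "J h k p q (?V - A - B) A = jac (\<lambda>x. v x \<notin> A \<and> v x \<notin> B) (\<lambda>x. v x \<in> A) h k p q \<mu>"
      unfolding J_def by (rule jac_cong[OF _ _ H]; use R in blast)+
    then have "N h k p q A B = of_bool (J h k p q A B) + of_bool (J h k p q B (?V - A - B)) + of_bool (J h k p q (?V - A - B) A)"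
      by (simp add: N_def jcount_def J_def)
    then show "of_bool (J h k p q A B) *\<^sub>v X h k p q A B + of_bool (J h k p q B (?V - A - B)) *\<^sub>v X h k p q A B
        + of_bool (J h k p q (?V - A - B) (?V - B - (?V - A - B))) *\<^sub>v X h k p q A B = N h k p q A B *\<^sub>v X h k p q A B"
      by (simp only: C svec.scale_left_distrib)
  qed
  moreover have "(\<Sum>h\<in>?H. \<Sum>k\<in>?H. \<Sum>p\<in>?H. \<Sum>q\<in>?H. Y h k p q) = 0" (is "?T = 0")
  proof -
    have anti: "Y h k p q = - Y p q h k" if "h \<in> ?H" "k \<in> ?H" "p \<in> ?H" "q \<in> ?H" for h k p q
      unfolding Y_def sum_negf[symmetric] N_def X_def
      by (intro sum.cong refl) (use jcount_glue_glue[OF ok _ that] in \<open>auto simp: Pr_def\<close>)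
    have pair: "(\<Sum>h\<in>?H. \<Sum>k\<in>?H. f h k) = (\<Sum>x\<in>?H \<times> ?H. f (fst x) (snd x))"
      for f :: "'a \<Rightarrow> 'a \<Rightarrow> (lgraph \<times> lgraph \<times> lgraph, 'k) svec"
      by (simp add: sum.cartesian_product case_prod_unfold)
    have T: "?T = (\<Sum>x\<in>?H \<times> ?H. \<Sum>y\<in>?H \<times> ?H. Y (fst x) (snd x) (fst y) (snd y))"
      by (simp only: pair)
    also have "\<dots> = (\<Sum>x\<in>?H \<times> ?H. \<Sum>y\<in>?H \<times> ?H. - Y (fst y) (snd y) (fst x) (snd x))"
      by (intro sum.cong refl anti) auto
    also have "\<dots> = - (\<Sum>y\<in>?H \<times> ?H. \<Sum>x\<in>?H \<times> ?H. Y (fst y) (snd y) (fst x) (snd x))"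
      by (subst sum.swap) (simp add: sum_negf)
    also have "\<dots> = - ?T" by (simp only: T)
    finally show ?thesis by (rule eq_minus_imp_zero)
  qed
  ultimately show ?thesis by simp
qed

theorem proposition5p3:
  shows "range (theta_phi :: 'k::field_char_0 graph_space \<Rightarrow> 'k graph_space2)
           \<subseteq> exterior_square shifted_degree \<and>
         graded_lie_cobracket shifted_degree
           (theta_phi :: 'k graph_space \<Rightarrow> 'k graph_space2)"
proof (intro conjI)
  show "range (theta_phi :: 'k graph_space \<Rightarrow> 'k graph_space2) \<subseteq> exterior_square shifted_degree"
    using antisym_exterior_square[OF grading_shifted_degree tau_theta_phi, where 'k = 'k] by blast
  let ?\<sigma> = "sigma shifted_degree :: (lgraph \<times> lgraph \<times> lgraph, 'k) svec \<Rightarrow> _"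
  let ?t = "\<lambda>x. id_tens theta_phi (theta_phi x) :: (lgraph \<times> lgraph \<times> lgraph, 'k) svec"
  have "(\<lambda>x. ?t x + ?\<sigma> (?t x) + ?\<sigma> (?\<sigma> (?t x))) = (\<lambda>_. 0)"
  proof (rule linear_eq_on_cls)
    show "Vector_Spaces.linear (*\<^sub>v) (*\<^sub>v) (\<lambda>x. ?t x + ?\<sigma> (?t x) + ?\<sigma> (?\<sigma> (?t x)))"
      using linear_theta_phi[where 'k = 'k] linear_id_tens[OF linear_theta_phi[where 'k = 'k], where 'a = lgraph]
        linear_sigma[OF grading_shifted_degree, where 'k = 'k]
      by (simp add: Vector_Spaces.linear_iff svec.scale_right_distrib)
    show "Vector_Spaces.linear (*\<^sub>v) (*\<^sub>v) (\<lambda>_ :: 'k graph_space. 0 :: (lgraph \<times> lgraph \<times> lgraph, 'k) svec)"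
      by (simp add: Vector_Spaces.linear_iff svec.vector_space_axioms)
    show "?t (cls X) + ?\<sigma> (?t (cls X)) + ?\<sigma> (?\<sigma> (?t (cls X))) = 0" for X
      using co_jacobi_gvec[OF ok_canon[of X], where 'k = 'k] by (simp only: gvec_canon)
  qed
  then have "?t x + ?\<sigma> (?t x) + ?\<sigma> (?\<sigma> (?t x)) = 0" for x by (rule fun_cong)
  then show "graded_lie_cobracket shifted_degree (theta_phi :: 'k graph_space \<Rightarrow> 'k graph_space2)"
    unfolding graded_lie_cobracket_def Let_def
    by (auto simp: grading_shifted_degree linear_theta_phi tau_theta_phi)
qed

end
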